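(* Let $\mathcal{I}=(p_1,\ldots,p_k)$ be a $k$-tuple of invariant factors with $\deg\prod_{i=1}^k p_i=d$, where $d\le k\le n$. Then the number $N_q(n,k;\mathcal{I})=\#\{B\in M_{n,k}(\mathbb{F}_q): xI_{n,k}-B \text{ has invariant factors } p_1,\ldots,p_k\}$ (equivalently, the number of $T\in L(W,V)$ with $\mathcal{I}_T=\mathcal{I}$) equals $$N_q(n,k;\mathcal{I})={k\brack d}_q\frac{|\mathrm{GL}_d(\mathbb{F}_q)|}{\prod_{f\in S(\mathcal{I})}c_f(\Phi_{\mathcal{I}}(f))}\prod_{i=d+1}^{k}(q^n-q^i).$$
   Context: Let $\mathbb{F}_q$ be the finite field with $q$ elements, $n\ge k$ positive integers, $V$ an $n$-dimensional $\mathbb{F}_q$-vector space and $W\subseteq V$ a $k$-dimensional subspace, with an ordered basis $\mathcal{B}_1$ of $W$ extended to an ordered basis $\mathcal{B}_2$ of $V$; $L(W,V)$ is the space of linear maps $W\to V$. $I_{n,k}\in M_{n,k}(\mathbb{F}_q)$ has $(i,j)$ entry $1$ if $i=j$ and $0$ otherwise. For nonzero $A\in M_{n,k}(\mathbb{F}_q[x])$, $\delta_i(A)$ is the monic gcd of its $i\times i$ minors ($\delta_0=1$), and its invariant factors are $p_i=\delta_i(A)/\delta_{i-1}(A)$ (the diagonal of its Smith normal form). For $B\in M_{n,k}(\mathbb{F}_q)$, $xI_{n,k}-B$ has exactly $k$ invariant factors $p_1\mid\cdots\mid p_k$; the invariant factors $\mathcal{I}_T$ of $T\in L(W,V)$ are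 those of $xI_{n,k}-B$ for $B$ the matrix of $T$ w.r.t. $\mathcal{B}_1,\mathcal{B}_2$. A $k$-tuple of invariant factors is a tuple of monic polynomials $(p_1,\ldots,p_k)$ with $p_i\mid p_{i+1}$. ${k\brack d}_q=\prod_{i=0}^{d-1}\frac{q^{k-i}-1}{q^{i+1}-1}$ is the $q$-binomial coefficient. Partition notation: for a partition $\lambda$ with conjugate $\lambda'$, $m_i=\lambda_i'-\lambda_{i+1}'$, $h_i=\lambda_1'+\cdots+\lambda_i'$; for irreducible $f$ of degree $e$, $c_f(\lambda)=\prod_{i\ge1}\prod_{j=1}^{m_i}(q^{eh_i}-q^{e(h_i-j)})$. For irreducible $f$ and nonzero $g$, $\nu_f(g)=\max\{e:f^e\mid g\}$. For $\mathcal{I}=(p_1,\ldots,p_k)$ and $P=\prod p_i$, $S(\mathcal{I})$ is the set of monic irreducible divisors of $P$ and $\Phi_{\mathcal{I}}(f)=(\nu_f(p_k),\nu_f(p_{k-1}),\ldots,\nu_f(p_r))$ with $r=\min\{i:\nu_f(p_i)>0\}$. Conventions: $|\mathrm{GL}_0(\mathbb{F}_q)|=1$, empty products equal $1$. *)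

theory Defs
  imports "Jordan_Normal_Form.Determinant" "Jordan_Normal_Form.DL_Submatrix"
    "HOL-Computational_Algebra.Euclidean_Algorithm"
begin

text \<open>Monic gcd of all i x i minors (delta_0 = 1). Rows/columns chosen as
  subsets of the index range of cardinality i. Gcd on polynomials over a field
  is normalized, i.e. monic (or 0).\<close>
definition minors :: "'a::comm_ring_1 mat \<Rightarrow> nat \<Rightarrow> 'a set" where
  "minors A i = {det (submatrix A R C) | R C.
      R \<subseteq> {0..<dim_row A} \<and> C \<subseteq> {0..<dim_col A} \<and> card R = i \<and> card C = i}"

definition delta :: "'a::field_gcd poly mat \<Rightarrow> nat \<Rightarrow> 'a poly" where
  "delta A i = (if i = 0 then 1 else Gcd (minors A i))"

definition inv_factors :: "'a::field_gcd poly mat \<Rightarrow> nat \<Rightarrow> 'a poly list" where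
  "inv_factors A k = map (\<lambda>i. delta A i div delta A (i - 1)) [1..<k+1]"

definition charmat :: "'a::field_gcd mat \<Rightarrow> 'a poly mat" where
  "charmat B = mat (dim_row B) (dim_col B)
     (\<lambda>(i,j). (if i = j then [:0, 1:] else 0) - [:B $$ (i,j):])"

definition is_inv_factor_tuple :: "'a::field_gcd poly list \<Rightarrow> bool" where
  "is_inv_factor_tuple ps \<longleftrightarrow> (\<forall>p\<in>set ps. lead_coeff p = 1)
      \<and> (\<forall>i. Suc i < length ps \<longrightarrow> ps ! i dvd ps ! Suc i)"

definition N_count :: "nat \<Rightarrow> nat \<Rightarrow> 'a::{field_gcd,finite} poly list \<Rightarrow> nat" where
  "N_count n k ps = card {B \<in> carrier_mat n k. inv_factors (charmat B) k = ps}"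

definition qbinom :: "nat \<Rightarrow> nat \<Rightarrow> nat \<Rightarrow> real" where
  "qbinom q k d = (\<Prod>i<d. (real q ^ (k - i) - 1) / (real q ^ (i + 1) - 1))"

definition GL_card :: "'a::{field_gcd,finite} itself \<Rightarrow> nat \<Rightarrow> nat" where
  "GL_card _ d = card {A :: 'a mat. A \<in> carrier_mat d d \<and> invertible_mat A}"

text \<open>Partition notation; lambda given as a list of parts (1-indexed in the paper).\<close>
definition conj_part :: "nat list \<Rightarrow> nat \<Rightarrow> nat" where
  "conj_part lam j = card {i. i < length lam \<and> lam ! i \<ge> j}"

definition m_part :: "nat list \<Rightarrow> nat \<Rightarrow> nat" where
  "m_part lam i = conj_part lam i - conj_part lam (i + 1)"

definition h_part :: "nat list \<Rightarrow> nat \<Rightarrow> nat" where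
  "h_part lam i = (\<Sum>j=1..i. conj_part lam j)"

text \<open>c_f(lambda) for deg f = e; factors with i > max part have m_i = 0.\<close>
definition c_fun :: "nat \<Rightarrow> nat \<Rightarrow> nat list \<Rightarrow> real" where
  "c_fun q e lam = (\<Prod>i\<in>{1..Max (insert 0 (set lam))}. \<Prod>j=1..m_part lam i.
       (real q ^ (e * h_part lam i) - real q ^ (e * (h_part lam i - j))))"

definition S_set :: "'a::field_gcd poly list \<Rightarrow> 'a poly set" where
  "S_set ps = {f. lead_coeff f = 1 \<and> irreducible f \<and> f dvd prod_list ps}"

definition Phi :: "'a::field_gcd poly list \<Rightarrow> 'a poly \<Rightarrow> nat list" where
  "Phi ps f = (let k = length ps;
                   r = (LEAST i. 1 \<le> i \<and> i \<le> k \<and> multiplicity f (ps ! (i - 1)) > 0)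
               in rev (map (\<lambda>i. multiplicity f (ps ! (i - 1))) [r..<k+1]))"

end

theory Submission
  imports Defs "Jordan_Normal_Form.Column_Operations" "HOL-Library.Cardinality"
begin

text \<open>
  By the Smith normal form, \<open>B\<close> has invariant factors \<open>p_1, \<dots>, p_k\<close> iff the quotient of \<open>F[x]^k\<close> by
  the row module of \<open>xI - B\<close> is isomorphic to \<open>M = F[x]/(p_1) + \<dots> + F[x]/(p_k)\<close>. Count the pairs
  of such a \<open>B\<close> and a surjection from \<open>F[x]^k\<close> to \<open>M\<close> whose kernel is this row module. For fixed \<open>B\<close>
  the surjections form a torsor under the automorphism group of \<open>M\<close>. Modulo the row module every
  vector is congruent to a constant one, so a surjection amounts to a \<open>k\<close>-tuple spanning the
  \<open>d\<close>-dimensional space \<open>M\<close> over \<open>F\<close>, that is, to a \<open>d * k\<close> matrix of rank \<open>d\<close>. For a fixed tuple, a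
  change of basis of \<open>F^k\<close> brings \<open>B\<close> to the block form with rows \<open>(A, C)\<close> and \<open>(0, D)\<close>, where \<open>A\<close> is
  determined, \<open>C\<close> is arbitrary and \<open>D\<close> is simple (all its invariant factors are 1).

  The order of the automorphism group is multiplicative over the primes dividing the \<open>p_i\<close>; for a
  single prime, the columns of an automorphism are chosen one after another, from the last to the
  first. The number of simple matrices follows by induction, since the counts of all types of
  matrices add up to \<open>q^(n k)\<close>; this rests on a \<open>q\<close>-binomial identity.
\<close>

section \<open>Smith normal form\<close>

text \<open>The weights \<open>1 / |Aut M|\<close> are the obstacle to finding the number of simple
  matrices: the total over all types contains one of them for every torsion module. Only their sum
  over all modules of a given dimension \<open>d\<close> is needed, and it can be had indirectly.
  Padding by factors 1 makes this sum independent of \<open>k\<close>. In the square case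
  \<open>n = k\<close> no simple matrix of positive size exists, so the total \<open>q^(d^2)\<close>
  forces the sum to be \<open>q^(d^2) / |GL_d|\<close>. With this value the automorphism groups drop
  out of the total for general \<open>n\<close> and \<open>k\<close>, and a recursion for simple
  matrices alone remains. The explicit order of \<open>Aut M\<close> serves the final formula and
  shows that padding does not change it. The determinantal divisors connect the stated definition
  with the Smith form. That a lattice determines the tuple is proved differently: for each
  polynomial \<open>g\<close> the number of elements killed by \<open>g\<close> fixes the sum of the
  degrees of the \<open>gcd g p_i\<close>, and these sums determine a divisibility chain.\<close>

definition unimodular :: "nat \<Rightarrow> 'a::comm_ring_1 mat \<Rightarrow> bool" where
  "unimodular n P \<longleftrightarrow> P \<in> carrier_mat n n \<and>
     (\<exists>Q\<in>carrier_mat n n. P * Q = 1\<^sub>m n \<and> Q * P = 1\<^sub>m n)"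

lemma unimodularI:
  "P \<in> carrier_mat n n \<Longrightarrow> Q \<in> carrier_mat n n \<Longrightarrow> P * Q = 1\<^sub>m n \<Longrightarrow> Q * P = 1\<^sub>m n \<Longrightarrow> unimodular n P"
  by (auto simp: unimodular_def)

lemma unimodular_carrier: "unimodular n P \<Longrightarrow> P \<in> carrier_mat n n"
  by (simp add: unimodular_def)

lemma unimodular_one: "unimodular n (1\<^sub>m n)"
  by (rule unimodularI[of _ _ "1\<^sub>m n"]) auto

lemma unimodular_mult:
  assumes "unimodular n P" "unimodular n Q"
  shows "unimodular n (P * Q)"
proof -
  obtain P' Q' where c: "P \<in> carrier_mat n n" "Q \<in> carrier_mat n n"
      "P' \<in> carrier_mat n n" "Q' \<in> carrier_mat n n"
    and e: "P * P' = 1\<^sub>m n" "P' * P = 1\<^sub>m n" "Q * Q' = 1\<^sub>m n" "Q' * Q = 1\<^sub>m n"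
    using assms unfolding unimodular_def by blast
  have "(P * Q) * (Q' * P') = P * ((Q * Q') * P')"
    using c by (simp add: assoc_mult_mat[of _ n n _ n _ n])
  moreover have "(Q' * P') * (P * Q) = Q' * ((P' * P) * Q)"
    using c by (simp add: assoc_mult_mat[of _ n n _ n _ n])
  ultimately show ?thesis
    using c e by (intro unimodularI[of _ _ "Q' * P'"]) auto
qed

lemma unimodular_swaprows_mat: "k < n \<Longrightarrow> l < n \<Longrightarrow> unimodular n (swaprows_mat n k l)"
  by (rule unimodularI[of _ _ "swaprows_mat n k l"]) (auto simp: swaprows_mat_inv)

lemma unimodular_addrow_mat:
  assumes "k < n" "l < n" "k \<noteq> l"
  shows "unimodular n (addrow_mat n a k l)"
  using addrow_mat_inv[OF assms, of a] addrow_mat_inv[OF assms, of "- a"]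
  by (intro unimodularI[of _ _ "addrow_mat n (- a) k l"]) auto

lemma uminus_zero_mat: "- (0\<^sub>m n m :: 'a::group_add mat) = 0\<^sub>m n m"
  by auto

lemma unimodular_block_diag:
  assumes "unimodular n P" "unimodular m Q"
  shows "unimodular (n + m) (four_block_mat P (0\<^sub>m n m) (0\<^sub>m m n) Q)"
proof -
  obtain P' Q' where c: "P \<in> carrier_mat n n" "P' \<in> carrier_mat n n"
      "Q \<in> carrier_mat m m" "Q' \<in> carrier_mat m m"
    and e: "P * P' = 1\<^sub>m n" "P' * P = 1\<^sub>m n" "Q * Q' = 1\<^sub>m m" "Q' * Q = 1\<^sub>m m"
    using assms unfolding unimodular_def by blast
  show ?thesis
    using c e
    by (intro unimodularI[of _ _ "four_block_mat P' (0\<^sub>m n m) (0\<^sub>m m n) Q'"])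
       (auto simp: mult_four_block_mat[of _ n n _ m _ m _ _ n _ m] uminus_zero_mat)
qed

lemma unimodular_lower_block:
  assumes "C \<in> carrier_mat m n"
  shows "unimodular (n + m) (four_block_mat (1\<^sub>m n) (0\<^sub>m n m) C (1\<^sub>m m))"
proof -
  have "C + - C = 0\<^sub>m m n" "- C + C = 0\<^sub>m m n"
    using assms by auto
  then show ?thesis
    using assms
    by (intro unimodularI[of _ _ "four_block_mat (1\<^sub>m n) (0\<^sub>m n m) (- C) (1\<^sub>m m)"])
       (auto simp: mult_four_block_mat[of _ n n _ m _ m _ _ n _ m] uminus_zero_mat)
qed

lemma unimodular_upper_block:
  assumes "C \<in> carrier_mat n m"
  shows "unimodular (n + m) (four_block_mat (1\<^sub>m n) C (0\<^sub>m m n) (1\<^sub>m m))"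
proof -
  have "C + - C = 0\<^sub>m n m" "- C + C = 0\<^sub>m n m"
    using assms by auto
  then show ?thesis
    using assms
    by (intro unimodularI[of _ _ "four_block_mat (1\<^sub>m n) (- C) (0\<^sub>m m n) (1\<^sub>m m)"])
       (auto simp: mult_four_block_mat[of _ n n _ m _ m _ _ n _ m] uminus_zero_mat)
qed

section \<open>Equivalence of matrices under invertible row and column transformations\<close>

definition mat_equiv :: "nat \<Rightarrow> nat \<Rightarrow> 'a::comm_ring_1 mat \<Rightarrow> 'a mat \<Rightarrow> bool" where
  "mat_equiv n k X Y \<longleftrightarrow> X \<in> carrier_mat n k \<and>
     (\<exists>P Q. unimodular n P \<and> unimodular k Q \<and> Y = P * X * Q)"

lemma mat_equiv_refl: "X \<in> carrier_mat n k \<Longrightarrow> mat_equiv n k X X"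
  unfolding mat_equiv_def by (intro conjI exI[of _ "1\<^sub>m n"] exI[of _ "1\<^sub>m k"]) (auto simp: unimodular_one)

lemma mat_equiv_carrier: "mat_equiv n k X Y \<Longrightarrow> Y \<in> carrier_mat n k"
  unfolding mat_equiv_def by (auto dest!: unimodular_carrier)

lemma mat_equiv_left: "X \<in> carrier_mat n k \<Longrightarrow> unimodular n P \<Longrightarrow> mat_equiv n k X (P * X)"
  unfolding mat_equiv_def
  by (intro conjI exI[of _ P] exI[of _ "1\<^sub>m k"]) (auto simp: unimodular_one dest!: unimodular_carrier)

lemma mat_equiv_right: "X \<in> carrier_mat n k \<Longrightarrow> unimodular k Q \<Longrightarrow> mat_equiv n k X (X * Q)"
  unfolding mat_equiv_def
  by (intro conjI exI[of _ "1\<^sub>m n"] exI[of _ Q]) (auto simp: unimodular_one dest!: unimodular_carrier)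

lemma mat_equiv_sym:
  assumes "mat_equiv n k X Y"
  shows "mat_equiv n k Y X"
proof -
  obtain P Q P' Q' where X: "X \<in> carrier_mat n k"
    and c: "P \<in> carrier_mat n n" "P' \<in> carrier_mat n n" "Q \<in> carrier_mat k k" "Q' \<in> carrier_mat k k"
    and e: "P * P' = 1\<^sub>m n" "P' * P = 1\<^sub>m n" "Q * Q' = 1\<^sub>m k" "Q' * Q = 1\<^sub>m k"
    and Y: "Y = P * X * Q"
    using assms unfolding mat_equiv_def unimodular_def by blast
  have "P' * Y * Q' = (P' * P) * X * (Q * Q')"
    unfolding Y using c X
    by (simp add: assoc_mult_mat[of _ n n _ n _ k] assoc_mult_mat[of _ n n _ k _ k]
        assoc_mult_mat[of _ n k _ k _ k])
  also have "\<dots> = X" using e X by simp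
  finally have "X = P' * Y * Q'" ..
  moreover have "unimodular n P'" "unimodular k Q'"
    using c e by (auto intro: unimodularI)
  ultimately show ?thesis
    unfolding mat_equiv_def using mat_equiv_carrier[OF assms] by blast
qed

lemma mat_equiv_trans:
  assumes "mat_equiv n k X Y" "mat_equiv n k Y Z"
  shows "mat_equiv n k X Z"
proof -
  obtain P Q P' Q' where X: "X \<in> carrier_mat n k"
    and u: "unimodular n P" "unimodular k Q" "unimodular n P'" "unimodular k Q'"
    and e: "Y = P * X * Q" "Z = P' * Y * Q'"
    using assms unfolding mat_equiv_def by blast
  note c = u[THEN unimodular_carrier]
  have "Z = (P' * P) * X * (Q * Q')"
    unfolding e using c X
    by (simp add: assoc_mult_mat[of _ n n _ n _ k] assoc_mult_mat[of _ n n _ k _ k]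
        assoc_mult_mat[of _ n k _ k _ k])
  then show ?thesis
    unfolding mat_equiv_def using X u unimodular_mult by blast
qed

section \<open>Existence of the Smith normal form over a Euclidean ring\<close>

definition snf_form :: "nat \<Rightarrow> nat \<Rightarrow> 'a::comm_ring_1 mat \<Rightarrow> bool" where
  "snf_form n k D \<longleftrightarrow> D \<in> carrier_mat n k \<and> (\<forall>i<n. \<forall>j<k. i \<noteq> j \<longrightarrow> D $$ (i,j) = 0) \<and>
     (\<forall>i. Suc i < n \<longrightarrow> Suc i < k \<longrightarrow> D $$ (i,i) dvd D $$ (Suc i, Suc i))"

lemma dvd_mult_mat_entries:
  fixes a :: "'a::comm_ring_1"
  assumes "X \<in> carrier_mat n k" "P \<in> carrier_mat n n" "Q \<in> carrier_mat k k"
    and "\<And>i j. i < n \<Longrightarrow> j < k \<Longrightarrow> a dvd X $$ (i,j)"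
    and "i < n" "j < k"
  shows "a dvd (P * X * Q) $$ (i,j)"
proof -
  define W where "W = P * X"
  have "a dvd W $$ (r,s)" if "r < n" "s < k" for r s
    using assms(1,2,4) that by (auto simp: W_def scalar_prod_def intro!: dvd_sum dvd_mult)
  moreover have "W \<in> carrier_mat n k" using assms by (simp add: W_def)
  ultimately show ?thesis
    unfolding W_def[symmetric] using assms(3,5,6)
    by (auto simp: scalar_prod_def intro!: dvd_sum dvd_mult2)
qed

text \<open>A nonzero entry of least Euclidean size among all matrices equivalent to
  \<open>X\<close> divides its row and its column, since a remainder would be smaller. Moved to the
  corner, it clears both and divides the remaining block, which is treated by induction on the
  number of rows.\<close>

lemma snf_exists:
  fixes X :: "'a::euclidean_ring mat"
  assumes "X \<in> carrier_mat n k"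
  shows "\<exists>D. mat_equiv n k X D \<and> snf_form n k D"
  using assms
proof (induction n arbitrary: k X)
  case 0
  then show ?case
    by (intro exI[of _ X]) (auto simp: snf_form_def mat_equiv_refl)
next
  case (Suc n k' X)
  show ?case
  proof (cases "\<forall>i<Suc n. \<forall>j<k'. X $$ (i,j) = 0")
    case True
    then show ?thesis
      using Suc.prems by (intro exI[of _ X]) (auto simp: snf_form_def mat_equiv_refl)
  next
    case False
    then obtain i0 j0 where ij0: "i0 < Suc n" "j0 < k'" "X $$ (i0,j0) \<noteq> 0" by blast
    then obtain k where k': "k' = Suc k" by (cases k') auto
    \<comment> \<open>Minimality ranges over the whole equivalence class, so it can be invoked again
      for every matrix met later; this replaces a terminating elimination procedure.\<close>
    define good where "good = (\<lambda>(Y,i,j). mat_equiv (Suc n) k' X Y \<and> i < Suc n \<and> j < k' \<and> Y $$ (i,j) \<noteq> 0)"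
    have "good (X,i0,j0)"
      using Suc.prems ij0 mat_equiv_refl by (auto simp: good_def)
    then obtain t where t: "good t" "\<And>s. good s \<Longrightarrow>
        euclidean_size (fst t $$ snd t) \<le> euclidean_size (fst s $$ snd s)"
      using ex_has_least_nat[of good _ "\<lambda>s. euclidean_size (fst s $$ snd s)"] by blast
    obtain Y i j where t_eq: "t = (Y,i,j)" by (cases t)
    have Y: "mat_equiv (Suc n) k' X Y" "i < Suc n" "j < k'" "Y $$ (i,j) \<noteq> 0"
      using t(1) by (auto simp: t_eq good_def)
    define a where "a = Y $$ (i,j)"
    have min: "euclidean_size a \<le> euclidean_size (Z $$ (r,s))"
      if "mat_equiv (Suc n) k' X Z" "r < Suc n" "s < k'" "Z $$ (r,s) \<noteq> 0" for Z r s
      using t(2)[of "(Z,r,s)"] that by (auto simp: good_def a_def t_eq)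
    have a0: "a \<noteq> 0" using Y by (simp add: a_def)
    have colclaim: "a dvd Z $$ (r,0)"
      if Z: "mat_equiv (Suc n) k' X Z" "Z $$ (0,0) = a" "r < Suc n" for Z r
    proof (cases "r = 0")
      case False
      have Zc: "Z \<in> carrier_mat (Suc n) k'" using mat_equiv_carrier Z by blast
      let ?q = "- (Z $$ (r,0) div a)"
      let ?Z = "addrow_mat (Suc n) ?q r 0 * Z"
      have e: "?Z = addrow ?q r 0 Z"
        using Zc by (simp add: addrow_mat)
      have "mat_equiv (Suc n) k' X ?Z"
        using mat_equiv_trans[OF Z(1) mat_equiv_left[OF Zc unimodular_addrow_mat]] False Z(3) by simp
      moreover have v: "?Z $$ (r,0) = Z $$ (r,0) mod a"
        unfolding e using Zc Z False k' by (simp add: minus_div_mult_eq_mod[symmetric])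
      ultimately show ?thesis
        using min[of ?Z r 0] Z(3) k' mod_size_less[OF a0, of "Z $$ (r,0)"]
        by (auto simp: dvd_eq_mod_eq_0)
    qed (use Z in auto)
    \<comment> \<open>Stated for every equivalent \<open>Z\<close> with corner \<open>a\<close>:
      besides \<open>Y1\<close> it is applied below to a matrix obtained from \<open>Y3\<close> by a
      row operation.\<close>
    have rowclaim: "a dvd Z $$ (0,r)"
      if Z: "mat_equiv (Suc n) k' X Z" "Z $$ (0,0) = a" "r < k'" for Z r
    proof (cases "r = 0")
      case False
      have Zc: "Z \<in> carrier_mat (Suc n) k'" using mat_equiv_carrier Z by blast
      let ?q = "- (Z $$ (0,r) div a)"
      let ?Z = "Z * addrow_mat k' ?q 0 r"
      have e: "?Z = addcol ?q r 0 Z"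
        using Zc k' by (simp add: addcol_mat)
      have "mat_equiv (Suc n) k' X ?Z"
        using mat_equiv_trans[OF Z(1) mat_equiv_right[OF Zc unimodular_addrow_mat]] False Z(3) by simp
      moreover have v: "?Z $$ (0,r) = Z $$ (0,r) mod a"
        unfolding e using Zc Z False k' by (simp add: minus_div_mult_eq_mod[symmetric])
      ultimately show ?thesis
        using min[of ?Z 0 r] Z(3) mod_size_less[OF a0, of "Z $$ (0,r)"]
        by (auto simp: dvd_eq_mod_eq_0)
    qed (use Z in auto)
    have Yc: "Y \<in> carrier_mat (Suc n) k'" using mat_equiv_carrier Y by blast
    define Y1 where "Y1 = swaprows_mat (Suc n) 0 i * Y * swaprows_mat k' 0 j"
    have Y1X: "mat_equiv (Suc n) k' X Y1"
    proof -
      have "mat_equiv (Suc n) k' Y Y1"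
        unfolding mat_equiv_def Y1_def using Yc Y(2,3) unimodular_swaprows_mat[of 0 "Suc n" i]
          unimodular_swaprows_mat[of 0 k' j] by auto
      then show ?thesis using mat_equiv_trans Y(1) by blast
    qed
    have Y1c: "Y1 \<in> carrier_mat (Suc n) k'" using mat_equiv_carrier Y1X by blast
    have "Y1 = swapcols 0 j (swaprows 0 i Y)"
    proof -
      have "swaprows_mat (Suc n) 0 i * Y = swaprows 0 i Y"
        using swaprows_mat[OF Yc, of 0 i] Y by simp
      moreover have "swaprows 0 i Y \<in> carrier_mat (Suc n) k'" using Yc by simp
      ultimately show ?thesis
        unfolding Y1_def using swapcols_mat[of "swaprows 0 i Y" "Suc n" k' 0 j] Y k' by simp
    qed
    then have Y100: "Y1 $$ (0,0) = a"
      using Yc Y k' by (simp add: a_def)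
    define A where "A = mat 1 1 (\<lambda>_. a)"
    define r where "r = mat 1 k (\<lambda>(_,j). Y1 $$ (0, Suc j))"
    define c where "c = mat n 1 (\<lambda>(i,_). Y1 $$ (Suc i, 0))"
    define Z where "Z = mat n k (\<lambda>(i,j). Y1 $$ (Suc i, Suc j))"
    define r' where "r' = mat 1 k (\<lambda>(_,j). Y1 $$ (0, Suc j) div a)"
    define c' where "c' = mat n 1 (\<lambda>(i,_). Y1 $$ (Suc i, 0) div a)"
    note defs = A_def r_def c_def Z_def r'_def c'_def
    have cc: "A \<in> carrier_mat 1 1" "r \<in> carrier_mat 1 k" "c \<in> carrier_mat n 1" "Z \<in> carrier_mat n k"
       "r' \<in> carrier_mat 1 k" "c' \<in> carrier_mat n 1"
      by (auto simp: defs)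
    have Y1fb: "Y1 = four_block_mat A r c Z"
      using Y1c k' Y100 by (intro eq_matI) (auto simp: defs Suc_diff_le)
    have Ar: "A * r' = r"
      using rowclaim[OF Y1X Y100] k' by (intro eq_matI) (auto simp: defs scalar_prod_def)
    have cA: "c' * A = c"
      using colclaim[OF Y1X Y100] by (intro eq_matI) (auto simp: defs scalar_prod_def)
    define Z' where "Z' = (- c') * r + Z"
    have Z'c: "Z' \<in> carrier_mat n k" using cc by (simp add: Z'_def)
    \<comment> \<open>\<open>PP\<close> clears the first column and turns the block \<open>Z\<close>
      into \<open>Z'\<close>; once the column is zero, \<open>QQ\<close> clears the top row without
      touching \<open>Z'\<close>.\<close>
    define PP where "PP = four_block_mat (1\<^sub>m 1) (0\<^sub>m 1 n) (- c') (1\<^sub>m n)"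
    define QQ where "QQ = four_block_mat (1\<^sub>m 1) (- r') (0\<^sub>m k 1) (1\<^sub>m k)"
    define Y3 where "Y3 = four_block_mat A (0\<^sub>m 1 k) (0\<^sub>m n 1) Z'"
    have PPY: "PP * Y1 = four_block_mat A r (0\<^sub>m n 1) Z'"
    proof -
      have "(- c') * A + c = 0\<^sub>m n 1"
        using cA cc by auto
      then show ?thesis
        unfolding PP_def Y1fb using cc
        by (simp add: mult_four_block_mat[of _ 1 1 _ n _ n _ _ 1 _ k] Z'_def)
    qed
    have "PP * Y1 * QQ = Y3"
    proof -
      have "A * (- r') + r = 0\<^sub>m 1 k"
        using Ar cc by auto
      then show ?thesis
        unfolding PPY unfolding QQ_def Y3_def using cc Z'c
        by (simp add: mult_four_block_mat[of _ 1 1 _ k _ n _ _ 1 _ k] uminus_zero_mat)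
    qed
    moreover have "unimodular (Suc n) PP" "unimodular k' QQ"
      using unimodular_lower_block[of "- c'" n 1] unimodular_upper_block[of "- r'" 1 k] cc k'
      by (auto simp: PP_def QQ_def)
    ultimately have "mat_equiv (Suc n) k' Y1 Y3"
      unfolding mat_equiv_def using Y1c by blast
    then have Y3X: "mat_equiv (Suc n) k' X Y3"
      using mat_equiv_trans Y1X by blast
    have Y3c: "Y3 \<in> carrier_mat (Suc n) k'" using mat_equiv_carrier Y3X by blast
    have Z'dvd: "a dvd Z' $$ (p,s)" if ps: "p < n" "s < k" for p s
    proof -
      \<comment> \<open>Adding row \<open>Suc p\<close> to the top row brings
        \<open>Z' $$ (p,s)\<close> into the top row and keeps the corner \<open>a\<close>, because
        the first column of \<open>Y3\<close> is zero below the corner.\<close>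
      let ?W = "addrow_mat (Suc n) 1 0 (Suc p) * Y3"
      have e: "?W = addrow 1 0 (Suc p) Y3"
        using Y3c ps by (simp add: addrow_mat)
      have "mat_equiv (Suc n) k' X ?W"
        using mat_equiv_trans[OF Y3X mat_equiv_left[OF Y3c unimodular_addrow_mat]] ps by simp
      moreover have "?W $$ (0,0) = a" "?W $$ (0,Suc s) = Z' $$ (p,s)"
        unfolding e using Y3c ps k' cc Z'c by (auto simp: Y3_def A_def)
      ultimately show ?thesis using rowclaim[of ?W "Suc s"] ps k' by simp
    qed
    obtain D' where D': "mat_equiv n k Z' D'" "snf_form n k D'"
      using Suc.IH[OF Z'c] by blast
    then obtain P1 Q1 where PQ: "unimodular n P1" "unimodular k Q1" "D' = P1 * Z' * Q1"
      unfolding mat_equiv_def by blast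
    note PQc = PQ(1,2)[THEN unimodular_carrier]
    have D'c: "D' \<in> carrier_mat n k" using D' by (simp add: snf_form_def)
    \<comment> \<open>Equivalence preserves common divisors of the entries; this supplies the first
      link of the divisibility chain of \<open>D\<close>.\<close>
    have D'dvd: "a dvd D' $$ (p,s)" if "p < n" "s < k" for p s
      unfolding PQ(3) using dvd_mult_mat_entries[OF Z'c PQc Z'dvd that] by blast
    define D where "D = four_block_mat A (0\<^sub>m 1 k) (0\<^sub>m n 1) D'"
    have "D = four_block_mat (1\<^sub>m 1) (0\<^sub>m 1 n) (0\<^sub>m n 1) P1 * Y3 * four_block_mat (1\<^sub>m 1) (0\<^sub>m 1 k) (0\<^sub>m k 1) Q1"
      unfolding Y3_def D_def PQ(3) using cc Z'c PQc
      by (simp add: mult_four_block_mat[of _ 1 1 _ n _ n _ _ 1 _ k]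
          mult_four_block_mat[of _ 1 1 _ k _ n _ _ 1 _ k])
    moreover have "unimodular (Suc n) (four_block_mat (1\<^sub>m 1) (0\<^sub>m 1 n) (0\<^sub>m n 1) P1)"
       "unimodular k' (four_block_mat (1\<^sub>m 1) (0\<^sub>m 1 k) (0\<^sub>m k 1) Q1)"
      using unimodular_block_diag[OF unimodular_one PQ(1), of 1]
        unimodular_block_diag[OF unimodular_one PQ(2), of 1] k' by auto
    ultimately have "mat_equiv (Suc n) k' Y3 D"
      unfolding mat_equiv_def using Y3c by blast
    then have "mat_equiv (Suc n) k' X D"
      using mat_equiv_trans Y3X by blast
    moreover have "snf_form (Suc n) k' D"
    proof -
      have "D $$ (i,i) dvd D $$ (Suc i, Suc i)" if "Suc i < Suc n" "Suc i < k'" for i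
        using that D'(2) D'dvd[of 0 0] D'c k' by (cases i) (auto simp: D_def A_def snf_form_def)
      moreover have "D $$ (i,j) = 0" if "i < Suc n" "j < k'" "i \<noteq> j" for i j
        using that D'(2) D'c k' by (cases i; cases j) (auto simp: D_def A_def snf_form_def)
      moreover have "D \<in> carrier_mat (Suc n) k'" using D'c cc k' by (auto simp: D_def)
      ultimately show ?thesis by (auto simp: snf_form_def)
    qed
    ultimately show ?thesis by blast
  qed
qed

section \<open>Determinantal divisors\<close>

text \<open>Row and column indices are arbitrary functions, not necessarily increasing or even
  injective, so that these determinants are closed under multilinear expansion.\<close>

definition gen_minor :: "'a::comm_ring_1 mat \<Rightarrow> nat \<Rightarrow> (nat \<Rightarrow> nat) \<Rightarrow> (nat \<Rightarrow> nat) \<Rightarrow> 'a" where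
  "gen_minor X i r c = det (mat i i (\<lambda>(a,b). X $$ (r a, c b)))"

definition dvd_gen_minors :: "'a::comm_ring_1 \<Rightarrow> nat \<Rightarrow> 'a mat \<Rightarrow> bool" where
  "dvd_gen_minors g i X \<longleftrightarrow> (\<forall>r c. (\<forall>a<i. r a < dim_row X) \<longrightarrow> (\<forall>b<i. c b < dim_col X) \<longrightarrow>
      g dvd gen_minor X i r c)"

lemma gen_minor_transpose:
  assumes "\<forall>a<i. r a < dim_row X" "\<forall>b<i. c b < dim_col X"
  shows "gen_minor (transpose_mat X) i c r = gen_minor X i r c"
proof -
  have "mat i i (\<lambda>(a,b). transpose_mat X $$ (c a, r b)) = transpose_mat (mat i i (\<lambda>(a,b). X $$ (r a, c b)))"
    using assms by (intro eq_matI) auto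
  then show ?thesis
    unfolding gen_minor_def by (simp add: det_transpose[of _ i])
qed

lemma dvd_gen_minors_transpose:
  assumes "dvd_gen_minors g i X"
  shows "dvd_gen_minors g i (transpose_mat X)"
  using assms gen_minor_transpose[of i _ X] unfolding dvd_gen_minors_def by auto

text \<open>The selected rows of \<open>P * X\<close> are combinations of rows of \<open>X\<close>,
  so multilinearity expands the minor into generalized minors of \<open>X\<close> with arbitrary row
  choices. For divisibility the coefficients are irrelevant, which spares the full Cauchy-Binet
  formula.\<close>

lemma dvd_gen_minors_mult_left:
  assumes X: "X \<in> carrier_mat n k" and P: "P \<in> carrier_mat m n"
    and g: "dvd_gen_minors g i X"
  shows "dvd_gen_minors g i (P * X)"
  unfolding dvd_gen_minors_def
proof (intro allI impI)
  fix r c assume r: "\<forall>a<i. r a < dim_row (P * X)" and c: "\<forall>b<i. c b < dim_col (P * X)"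
  let ?x = "\<lambda>l. vec i (\<lambda>b. X $$ (l, c b))"
  let ?v = "\<lambda>a l. P $$ (r a, l) \<cdot>\<^sub>v ?x l"
  let ?F = "{f. (\<forall>a\<in>{0..<i}. f a \<in> {0..<n}) \<and> (\<forall>a. a \<notin> {0..<i} \<longrightarrow> f a = a)}"
  have "mat i i (\<lambda>(a,b). (P * X) $$ (r a, c b)) = mat\<^sub>r i i (\<lambda>a. finsum_vec TYPE('a) i (?v a) {0..<n})"
    (is "?L = ?R")
  proof (rule eq_matI)
    fix a b assume "a < dim_row ?R" "b < dim_col ?R"
    then have ab: "a < i" "b < i" by auto
    have "finsum_vec TYPE('a) i (?v a) {0..<n} $ b = (\<Sum>l=0..<n. ?v a l $ b)"
      by (rule index_finsum_vec) (use ab in auto)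
    then show "?L $$ (a,b) = ?R $$ (a,b)"
      using ab r c P X by (simp add: scalar_prod_def)
  qed auto
  then have "gen_minor (P * X) i r c = (\<Sum>f\<in>?F. det (mat\<^sub>r i i (\<lambda>a. ?v a (f a))))"
    unfolding gen_minor_def by (subst det_linear_rows_sum[symmetric]) auto
  moreover have "g dvd det (mat\<^sub>r i i (\<lambda>a. ?v a (f a)))" if f: "f \<in> ?F" for f
  proof -
    have "det (mat\<^sub>r i i (\<lambda>a. P $$ (r a, f a) \<cdot>\<^sub>v ?x (f a)))
        = (\<Prod>a\<in>{0..<i}. P $$ (r a, f a)) * det (mat\<^sub>r i i (\<lambda>a. ?x (f a)))"
      by (rule det_rows_mul) auto
    moreover have "mat\<^sub>r i i (\<lambda>a. ?x (f a)) = mat i i (\<lambda>(a,b). X $$ (f a, c b))"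
      by (intro eq_matI) auto
    moreover have "g dvd gen_minor X i f c"
      using g f c X P unfolding dvd_gen_minors_def by auto
    ultimately show ?thesis by (simp add: gen_minor_def)
  qed
  ultimately show "g dvd gen_minor (P * X) i r c"
    by (simp only:) (rule dvd_sum)
qed

lemma dvd_gen_minors_mult_right:
  assumes X: "X \<in> carrier_mat n k" and Q: "Q \<in> carrier_mat k m"
    and g: "dvd_gen_minors g i X"
  shows "dvd_gen_minors g i (X * Q)"
proof -
  have "dvd_gen_minors g i (transpose_mat Q * transpose_mat X)"
    using dvd_gen_minors_mult_left[of "transpose_mat X" k n "transpose_mat Q" m] X Q
      dvd_gen_minors_transpose[OF g] by simp
  then have "dvd_gen_minors g i (transpose_mat (X * Q))"
    using transpose_mult[OF X Q] by simp
  from dvd_gen_minors_transpose[OF this] show ?thesis by simp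
qed

lemma dvd_gen_minors_mat_equiv:
  assumes "mat_equiv n k X Y" "dvd_gen_minors g i X"
  shows "dvd_gen_minors g i Y"
proof -
  obtain P Q where X: "X \<in> carrier_mat n k" and PQ: "unimodular n P" "unimodular k Q" and Y: "Y = P * X * Q"
    using assms unfolding mat_equiv_def by blast
  note c = PQ[THEN unimodular_carrier]
  show ?thesis unfolding Y
    using dvd_gen_minors_mult_right[of "P * X" n k Q] dvd_gen_minors_mult_left[OF X c(1) assms(2)] X c by simp
qed

lemma gen_minor_not_inj_left:
  assumes "\<not> inj_on r {0..<i}"
  shows "gen_minor X i r c = 0"
proof -
  obtain a b where ab: "a < i" "b < i" "a \<noteq> b" "r a = r b"
    using assms unfolding inj_on_def by auto
  have "row (mat i i (\<lambda>(a,b). X $$ (r a, c b))) a = row (mat i i (\<lambda>(a,b). X $$ (r a, c b))) b"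
    using ab by (intro eq_vecI) auto
  then show ?thesis
    unfolding gen_minor_def using ab by (intro det_identical_rows[of _ i a b]) auto
qed

lemma gen_minor_not_inj_right:
  assumes "\<not> inj_on c {0..<i}"
  shows "gen_minor X i r c = 0"
proof -
  obtain a b where ab: "a < i" "b < i" "a \<noteq> b" "c a = c b"
    using assms unfolding inj_on_def by auto
  have "col (mat i i (\<lambda>(a,b). X $$ (r a, c b))) a = col (mat i i (\<lambda>(a,b). X $$ (r a, c b))) b"
    using ab by (intro eq_vecI) auto
  then show ?thesis
    unfolding gen_minor_def using ab by (intro det_identical_columns[of _ i a b]) auto
qed

text \<open>\<open>p a\<close> is the rank of \<open>r a\<close> within the image of
  \<open>r\<close>; an injective choice of indices is thus a permutation of the increasing
  enumeration \<open>pick\<close>.\<close>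

lemma ex_permutes_pick:
  fixes r :: "nat \<Rightarrow> nat"
  assumes inj: "inj_on r {0..<i}"
  shows "\<exists>p. p permutes {0..<i} \<and> (\<forall>a<i. r a = pick (r ` {0..<i}) (p a))"
proof -
  let ?R = "r ` {0..<i}"
  define p where "p = (\<lambda>a. if a < i then card {y\<in>?R. y < r a} else a)"
  have pick: "r a = pick ?R (p a)" if "a < i" for a
    using pick_card_in_set[of "r a" ?R] that by (simp add: p_def)
  have "p a < i" if "a < i" for a
  proof -
    have "card {y\<in>?R. y < r a} < card ?R"
      using that by (intro psubset_card_mono) auto
    then show ?thesis using that inj by (simp add: p_def card_image)
  qed
  moreover have "inj_on p {0..<i}"
    using pick inj by (metis (no_types, lifting) atLeastLessThan_iff inj_on_def)
  ultimately have "bij_betw p {0..<i} {0..<i}"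
    by (metis (no_types, lifting) atLeastLessThan_iff bij_betw_def endo_inj_surj finite_atLeastLessThan
        image_subset_iff zero_le)
  then have "p permutes {0..<i}"
    by (intro bij_imp_permutes) (auto simp: p_def)
  then show ?thesis using pick by blast
qed

lemma gen_minor_permute_left:
  assumes "p permutes {0..<i}" "\<And>a. a < i \<Longrightarrow> r a = r' (p a)"
  shows "gen_minor X i r c = of_int (sign p) * gen_minor X i r' c"
proof -
  have "mat i i (\<lambda>(a,b). X $$ (r a, c b)) = mat i i (\<lambda>(a,b). mat i i (\<lambda>(a,b). X $$ (r' a, c b)) $$ (p a, b))"
    using assms permutes_in_image[OF assms(1)] by (intro eq_matI) auto
  then show ?thesis
    unfolding gen_minor_def using det_permute_rows[of "mat i i (\<lambda>(a,b). X $$ (r' a, c b))" i p] assms(1) by simp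
qed

lemma submatrix_eq_mat:
  assumes "R \<subseteq> {0..<dim_row X}" "C \<subseteq> {0..<dim_col X}" "card R = i" "card C = i"
  shows "submatrix X R C = mat i i (\<lambda>(a,b). X $$ (pick R a, pick C b))"
proof -
  have "{a. a < dim_row X \<and> a \<in> R} = R" "{a. a < dim_col X \<and> a \<in> C} = C"
    using assms by auto
  then show ?thesis
    using assms by (intro eq_matI) (auto simp: dim_submatrix submatrix_index)
qed

text \<open>A generalized minor with a repeated index vanishes, and any other one is, up to sign, a
  minor with increasing indices. Both families have the same common divisors, so statements about
  \<open>delta\<close> reduce to \<open>dvd_gen_minors\<close>.\<close>

lemma dvd_minors_iff:
  "(\<forall>m\<in>minors X i. g dvd m) \<longleftrightarrow> dvd_gen_minors g i X"
proof
  assume L: "\<forall>m\<in>minors X i. g dvd m"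
  show "dvd_gen_minors g i X"
    unfolding dvd_gen_minors_def
  proof (intro allI impI)
    fix r c assume r: "\<forall>a<i. r a < dim_row X" and c: "\<forall>b<i. c b < dim_col X"
    show "g dvd gen_minor X i r c"
    proof (cases "inj_on r {0..<i} \<and> inj_on c {0..<i}")
      case True
      let ?R = "r ` {0..<i}" and ?C = "c ` {0..<i}"
      obtain p where p: "p permutes {0..<i}" "\<forall>a<i. r a = pick ?R (p a)"
        using ex_permutes_pick True by blast
      obtain s where s: "s permutes {0..<i}" "\<forall>a<i. c a = pick ?C (s a)"
        using ex_permutes_pick True by blast
      have RC: "?R \<subseteq> {0..<dim_row X}" "?C \<subseteq> {0..<dim_col X}" "card ?R = i" "card ?C = i"
        using r c True by (auto simp: card_image)
      have pR: "\<forall>a<i. pick ?R a < dim_row X"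
        using RC pick_in_set_le by (metis atLeastLessThan_iff subsetD)
      have "det (submatrix X ?R ?C) \<in> minors X i"
        unfolding minors_def using RC by blast
      then have "g dvd gen_minor X i (pick ?R) (pick ?C)"
        using L submatrix_eq_mat[OF RC] by (simp add: gen_minor_def)
      moreover have "gen_minor X i r c = of_int (sign p) * gen_minor X i (pick ?R) c"
        using p gen_minor_permute_left[of p i r "pick ?R"] by blast
      moreover have "gen_minor X i (pick ?R) c = of_int (sign s) * gen_minor X i (pick ?R) (pick ?C)"
      proof -
        have "gen_minor (transpose_mat X) i c (pick ?R)
            = of_int (sign s) * gen_minor (transpose_mat X) i (pick ?C) (pick ?R)"
          using s gen_minor_permute_left[of s i c "pick ?C"] by blast
        moreover have "\<forall>a<i. pick ?C a < dim_col X"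
          using RC pick_in_set_le by (metis atLeastLessThan_iff subsetD)
        ultimately show ?thesis
          using gen_minor_transpose[OF pR c] gen_minor_transpose[OF pR, of "pick ?C"] by simp
      qed
      ultimately show ?thesis by simp
    qed (auto simp: gen_minor_not_inj_left gen_minor_not_inj_right)
  qed
next
  assume R: "dvd_gen_minors g i X"
  show "\<forall>m\<in>minors X i. g dvd m"
  proof
    fix m assume "m \<in> minors X i"
    then obtain R C where RC: "R \<subseteq> {0..<dim_row X}" "C \<subseteq> {0..<dim_col X}" "card R = i" "card C = i"
      and m: "m = det (submatrix X R C)" unfolding minors_def by blast
    have "m = gen_minor X i (pick R) (pick C)"
      unfolding m submatrix_eq_mat[OF RC] gen_minor_def ..
    moreover have "\<forall>a<i. pick R a < dim_row X" "\<forall>a<i. pick C a < dim_col X"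
      using RC pick_in_set_le by (metis atLeastLessThan_iff subsetD)+
    ultimately show "g dvd m" using R unfolding dvd_gen_minors_def by blast
  qed
qed

lemma Gcd_minors_cong:
  fixes X Y :: "'a::field_gcd poly mat"
  assumes "mat_equiv n k X Y"
  shows "Gcd (minors X i) = Gcd (minors Y i)"
proof -
  have "Gcd (minors X i) dvd Gcd (minors Y i)" if "mat_equiv n k X Y" for X Y :: "'a poly mat"
  proof -
    have "dvd_gen_minors (Gcd (minors X i)) i X"
      by (subst dvd_minors_iff[symmetric]) (auto intro: Gcd_dvd)
    then have "dvd_gen_minors (Gcd (minors X i)) i Y"
      by (rule dvd_gen_minors_mat_equiv[OF that])
    then show ?thesis
      by (subst (asm) dvd_minors_iff[symmetric]) (auto intro: Gcd_greatest)
  qed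
  then show ?thesis
    using assms mat_equiv_sym by (metis associated_eqI normalize_Gcd)
qed

section \<open>Determinantal divisors of a matrix in Smith form\<close>

lemma chain_dvd:
  fixes d :: "nat \<Rightarrow> 'a::comm_monoid_mult"
  assumes "\<And>i. Suc i < m \<Longrightarrow> d i dvd d (Suc i)" "i \<le> j" "j < m"
  shows "d i dvd d j"
  using assms(2,3)
proof (induction j rule: dec_induct)
  case (step j)
  then show ?case using assms(1)[of j] dvd_trans by (metis Suc_lessD)
qed simp

text \<open>Remove the largest index of \<open>R\<close>: a set of \<open>Suc i\<close> indices has
  maximum at least \<open>i\<close>, so \<open>d i\<close> divides the removed factor.\<close>

lemma prod_chain_dvd:
  fixes d :: "nat \<Rightarrow> 'a::comm_monoid_mult"
  assumes chain: "\<And>i. Suc i < m \<Longrightarrow> d i dvd d (Suc i)"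
  shows "R \<subseteq> {..<m} \<Longrightarrow> card R = i \<Longrightarrow> (\<Prod>j<i. d j) dvd (\<Prod>j\<in>R. d j)"
proof (induction i arbitrary: R)
  case (Suc i)
  have fin: "finite R" and ne: "R \<noteq> {}" using Suc.prems finite_subset by auto
  let ?M = "Max R"
  have M: "?M \<in> R" using Max_in[OF fin ne] .
  have "R \<subseteq> {..?M}" using fin by auto
  then have "Suc i \<le> Suc ?M" using card_mono[of "{..?M}" R] Suc.prems by simp
  then have "d i dvd d ?M" using chain_dvd[of m d i ?M, OF chain] M Suc.prems by auto
  moreover have "(\<Prod>j<i. d j) dvd (\<Prod>j\<in>R - {?M}. d j)"
  proof (rule Suc.IH)
    show "R - {?M} \<subseteq> {..<m}" using Suc.prems by blast
    show "card (R - {?M}) = i" using Suc.prems M fin by simp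
  qed
  ultimately show ?case
    using prod.remove[OF fin M, of d] by (simp add: mult_dvd_mono mult.commute)
qed simp

text \<open>In the Leibniz expansion a term survives only if all its positions lie on the diagonal.
  Its factors are then \<open>i\<close> different diagonal entries, and their product is divisible
  by that of the first \<open>i\<close>.\<close>

lemma snf_gen_minors:
  fixes D :: "'a::idom mat"
  assumes D: "snf_form n k D"
  shows "dvd_gen_minors (\<Prod>j<i. D $$ (j,j)) i D"
  unfolding dvd_gen_minors_def
proof (intro allI impI)
  fix r c assume r: "\<forall>a<i. r a < dim_row D" and c: "\<forall>b<i. c b < dim_col D"
  have Dc: "D \<in> carrier_mat n k" using D by (simp add: snf_form_def)
  show "(\<Prod>j<i. D $$ (j,j)) dvd gen_minor D i r c"
  proof (cases "inj_on r {0..<i}")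
    case True
    have *: "(\<Prod>j<i. D $$ (j,j)) dvd (\<Prod>a=0..<i. D $$ (r a, c (p a)))" if p: "p permutes {0..<i}" for p
    proof (cases "\<forall>a<i. r a = c (p a)")
      case ra: True
      have "r ` {0..<i} \<subseteq> {..<min n k}"
        using r c ra Dc permutes_in_image[OF p] by force
      then have "(\<Prod>j<i. D $$ (j,j)) dvd (\<Prod>j\<in>r ` {0..<i}. D $$ (j,j))"
        using D True by (intro prod_chain_dvd[where m = "min n k"]) (auto simp: snf_form_def card_image)
      also have "(\<Prod>j\<in>r ` {0..<i}. D $$ (j,j)) = (\<Prod>a=0..<i. D $$ (r a, r a))"
        using True by (simp add: prod.reindex)
      also have "\<dots> = (\<Prod>a=0..<i. D $$ (r a, c (p a)))"
        using ra by (intro prod.cong) auto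
      finally show ?thesis .
    next
      case False
      then obtain a where a: "a < i" "r a \<noteq> c (p a)" by blast
      then have "p a < i" using permutes_in_image[OF p, of a] by simp
      then have "D $$ (r a, c (p a)) = 0"
        using a D r c Dc by (auto simp: snf_form_def)
      then have "(\<Prod>a=0..<i. D $$ (r a, c (p a))) = 0"
        using a by (intro prod_zero) auto
      then show ?thesis by (simp only: dvd_0_right)
    qed
    have "gen_minor D i r c = (\<Sum>p | p permutes {0..<i}. of_int (sign p) * (\<Prod>a=0..<i. D $$ (r a, c (p a))))"
      unfolding gen_minor_def
      by (subst det_def'[of _ i]) (auto intro!: sum.cong prod.cong simp: permutes_in_image
           dest: permutes_in_image)
    then show ?thesis using * by (auto intro!: dvd_sum)
  qed (simp add: gen_minor_not_inj_left)
qed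

text \<open>The leading block attains the bound of \<open>snf_gen_minors\<close>, hence equality up
  to a unit, which \<open>normalize\<close> removes.\<close>

lemma snf_Gcd_minors:
  fixes D :: "'a::field_gcd poly mat"
  assumes D: "snf_form n k D" and i: "i \<le> n" "i \<le> k"
  shows "Gcd (minors D i) = normalize (\<Prod>j<i. D $$ (j,j))"
proof (rule associated_eqI)
  have Dc: "D \<in> carrier_mat n k" using D by (simp add: snf_form_def)
  show "normalize (\<Prod>j<i. D $$ (j,j)) dvd Gcd (minors D i)"
    using snf_gen_minors[OF D, of i] by (simp add: dvd_minors_iff[symmetric] Gcd_greatest)
  have "dvd_gen_minors (Gcd (minors D i)) i D"
    by (subst dvd_minors_iff[symmetric]) (auto intro: Gcd_dvd)
  then have "Gcd (minors D i) dvd gen_minor D i id id"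
    unfolding dvd_gen_minors_def using i Dc by auto
  also have "gen_minor D i id id = prod_list (diag_mat (mat i i (\<lambda>(a,b). D $$ (a, b))))"
    unfolding gen_minor_def
    using D i by (subst det_upper_triangular[of _ i]) (auto simp: snf_form_def upper_triangular_def)
  also have "\<dots> = (\<Prod>j<i. D $$ (j,j))"
    by (simp add: diag_mat_def prod.list_conv_set_nth atLeast0LessThan)
  finally show "Gcd (minors D i) dvd normalize (\<Prod>j<i. D $$ (j,j))" by simp
qed auto

lemma inv_factors_snf:
  fixes X :: "'a::field_gcd poly mat"
  assumes equiv: "mat_equiv n k X D" and D: "snf_form n k D" and kn: "k \<le> n"
    and nz: "\<And>j. j < k \<Longrightarrow> D $$ (j,j) \<noteq> 0"
  shows "inv_factors X k = map (\<lambda>j. normalize (D $$ (j,j))) [0..<k]"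
proof -
  have delta: "delta X i = normalize (\<Prod>j<i. D $$ (j,j))" if "i \<le> k" for i
    unfolding delta_def using Gcd_minors_cong[OF equiv, of i] snf_Gcd_minors[OF D, of i] that kn by auto
  have quot: "delta X (Suc i) div delta X i = normalize (D $$ (i,i))" if "i < k" for i
    using that nz delta[of i] delta[of "Suc i"] by (simp add: normalize_mult)
  have "[1..<k+1] = map Suc [0..<k]" by (simp add: map_Suc_upt)
  then show ?thesis
    unfolding inv_factors_def using quot by simp
qed

section \<open>Counting surjective matrices over a finite field\<close>

lemma card_UNIV_gt_1: "1 < CARD('a::{zero_neq_one,finite})"
proof -
  have "card {0::'a, 1} \<le> CARD('a)" by (rule card_mono) auto
  then show ?thesis by simp
qed

lemma finite_carrier_vec: "finite (carrier_vec k :: 'a::finite vec set)"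
  and card_carrier_vec: "card (carrier_vec k :: 'a::finite vec set) = CARD('a) ^ k"
proof -
  have bij: "bij_betw (\<lambda>v. restrict (\<lambda>i. v $ i) {..<k}) (carrier_vec k :: 'a vec set) ({..<k} \<rightarrow>\<^sub>E UNIV)"
    by (rule bij_betwI[where g = "vec k"]) (auto intro!: eq_vecI simp: fun_eq_iff restrict_def PiE_def extensional_def)
  have f: "finite ({..<k} \<rightarrow>\<^sub>E (UNIV :: 'a set))" by (intro finite_PiE) auto
  show "finite (carrier_vec k :: 'a vec set)" using bij_betw_finite[OF bij] f by simp
  show "card (carrier_vec k :: 'a vec set) = CARD('a) ^ k"
    using bij_betw_same_card[OF bij] by (simp add: card_PiE)
qed

lemma finite_carrier_mat: "finite (carrier_mat n k :: 'a::finite mat set)"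
  and card_carrier_mat: "card (carrier_mat n k :: 'a::finite mat set) = CARD('a) ^ (n * k)"
proof -
  have bij: "bij_betw (\<lambda>A. restrict (\<lambda>p. A $$ p) ({..<n} \<times> {..<k})) (carrier_mat n k :: 'a mat set)
      ({..<n} \<times> {..<k} \<rightarrow>\<^sub>E UNIV)"
    by (rule bij_betwI[where g = "mat n k"])
       (auto intro!: eq_matI simp: fun_eq_iff restrict_def PiE_def extensional_def)
  have f: "finite ({..<n} \<times> {..<k} \<rightarrow>\<^sub>E (UNIV :: 'a set))" by (intro finite_PiE) auto
  show "finite (carrier_mat n k :: 'a mat set)" using bij_betw_finite[OF bij] f by simp
  show "card (carrier_mat n k :: 'a mat set) = CARD('a) ^ (n * k)"
    using bij_betw_same_card[OF bij] by (simp add: card_PiE card_cartesian_product)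
qed

text \<open>Also used over \<open>F[x]\<close>, for the relations between the columns of an
  automorphism; hence the general ring.\<close>

definition lin_comb :: "nat \<Rightarrow> 'a::comm_ring_1 vec list \<Rightarrow> 'a vec \<Rightarrow> 'a vec" where
  "lin_comb k vs c = vec k (\<lambda>i. \<Sum>j<length vs. c $ j * vs ! j $ i)"

definition indep_list :: "nat \<Rightarrow> 'a::comm_ring_1 vec list \<Rightarrow> bool" where
  "indep_list k vs \<longleftrightarrow> set vs \<subseteq> carrier_vec k \<and>
     (\<forall>c\<in>carrier_vec (length vs). lin_comb k vs c = 0\<^sub>v k \<longrightarrow> c = 0\<^sub>v (length vs))"

lemma lin_comb_carrier[simp]: "lin_comb k vs c \<in> carrier_vec k"
  by (simp add: lin_comb_def)

lemma lin_comb_diff: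
  assumes "c \<in> carrier_vec (length vs)" "c' \<in> carrier_vec (length vs)"
  shows "lin_comb k vs (c - c') = lin_comb k vs c - lin_comb k vs c'"
  using assms by (intro eq_vecI) (auto simp: lin_comb_def sum_subtractf left_diff_distrib)

lemma lin_comb_smult:
  assumes "c \<in> carrier_vec (length vs)"
  shows "lin_comb k vs (a \<cdot>\<^sub>v c) = a \<cdot>\<^sub>v lin_comb k vs c"
  using assms by (intro eq_vecI) (auto simp: lin_comb_def sum_distrib_left mult.assoc)

lemma lin_comb_Cons:
  assumes "v \<in> carrier_vec k"
  shows "lin_comb k (v # vs) (vCons a c) = a \<cdot>\<^sub>v v + lin_comb k vs c"
  using assms by (intro eq_vecI) (auto simp: lin_comb_def sum.lessThan_Suc_shift simp del: sum.lessThan_Suc)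

lemma inj_on_lin_comb:
  assumes "indep_list k vs"
  shows "inj_on (lin_comb k vs) (carrier_vec (length vs))"
proof (rule inj_onI)
  fix c c' assume c: "c \<in> carrier_vec (length vs)" "c' \<in> carrier_vec (length vs)"
    and e: "lin_comb k vs c = lin_comb k vs c'"
  have "lin_comb k vs (c - c') = 0\<^sub>v k"
    using lin_comb_diff[OF c] e by (auto simp: lin_comb_def)
  then have "c - c' = 0\<^sub>v (length vs)"
    using assms c unfolding indep_list_def by (metis minus_carrier_vec)
  then have "(c - c') $ i = 0" if "i < length vs" for i using that by simp
  then show "c = c'" using c by (intro eq_vecI) auto
qed

lemma indep_list_Cons:
  fixes v :: "'a::field vec"
  assumes v: "v \<in> carrier_vec k" and vs: "set vs \<subseteq> carrier_vec k"
  shows "indep_list k (v # vs) \<longleftrightarrow> indep_list k vs \<and> v \<notin> lin_comb k vs ` carrier_vec (length vs)"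
proof
  assume L: "indep_list k (v # vs)"
  have "c = 0\<^sub>v (length vs)" if c: "c \<in> carrier_vec (length vs)" "lin_comb k vs c = 0\<^sub>v k" for c
  proof -
    have "0 \<cdot>\<^sub>v v = 0\<^sub>v k"
      using v by (intro eq_vecI) auto
    then have "lin_comb k (v # vs) (vCons 0 c) = 0\<^sub>v k"
      using v c by (simp add: lin_comb_Cons)
    then have "vCons 0 c = 0\<^sub>v (Suc (length vs))"
      using L c unfolding indep_list_def by auto
    then show ?thesis by (simp add: zero_vec_Suc)
  qed
  moreover have "v \<noteq> lin_comb k vs c" if c: "c \<in> carrier_vec (length vs)" for c
  proof
    assume e: "v = lin_comb k vs c"
    have "lin_comb k vs (- 1 \<cdot>\<^sub>v c) = - 1 \<cdot>\<^sub>v v"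
      using lin_comb_smult[OF c, of k "- 1"] e by simp
    then have "lin_comb k (v # vs) (vCons 1 (- 1 \<cdot>\<^sub>v c)) = 0\<^sub>v k"
      using v by (auto simp: lin_comb_Cons)
    moreover have "vCons 1 (- 1 \<cdot>\<^sub>v c) \<in> carrier_vec (length (v # vs))" using c by auto
    ultimately have "vCons 1 (- 1 \<cdot>\<^sub>v c) = 0\<^sub>v (length (v # vs))"
      using L unfolding indep_list_def by blast
    then have "vCons 1 (- 1 \<cdot>\<^sub>v c) $ 0 = (0::'a)" by simp
    then show False by simp
  qed
  ultimately show "indep_list k vs \<and> v \<notin> lin_comb k vs ` carrier_vec (length vs)"
    using vs by (auto simp: indep_list_def)
next
  assume R: "indep_list k vs \<and> v \<notin> lin_comb k vs ` carrier_vec (length vs)"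
  have "c = 0\<^sub>v (length (v # vs))"
    if c: "c \<in> carrier_vec (length (v # vs))" and 0: "lin_comb k (v # vs) c = 0\<^sub>v k" for c
  proof -
    obtain a b where ab: "c = vCons a b" "b \<in> carrier_vec (length vs)"
      using c by (cases c) auto
    have z: "a \<cdot>\<^sub>v v + lin_comb k vs b = 0\<^sub>v k"
      using 0 v by (simp add: ab lin_comb_Cons)
    have "a = 0"
    proof (rule ccontr)
      assume a: "a \<noteq> 0"
      have "v = lin_comb k vs (- inverse a \<cdot>\<^sub>v b)"
      proof (rule eq_vecI)
        fix i assume "i < dim_vec (lin_comb k vs (- inverse a \<cdot>\<^sub>v b))"
        then have i: "i < k" by (simp add: lin_comb_def)
        have "a * v $ i + lin_comb k vs b $ i = 0"
          using arg_cong[OF z, of "\<lambda>w. w $ i"] i v by (simp add: lin_comb_def)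
        then have "v $ i = - inverse a * lin_comb k vs b $ i"
          using a by (simp add: field_simps eq_neg_iff_add_eq_0)
        then show "v $ i = lin_comb k vs (- inverse a \<cdot>\<^sub>v b) $ i"
          unfolding lin_comb_smult[OF ab(2)] using i by (simp add: lin_comb_def)
      qed (use v in \<open>simp add: lin_comb_def\<close>)
      then show False using R ab by auto
    qed
    moreover have "0 \<cdot>\<^sub>v v = 0\<^sub>v k"
      using v by (intro eq_vecI) auto
    ultimately have "lin_comb k vs b = 0\<^sub>v k"
      using z by simp
    then have "b = 0\<^sub>v (length vs)" using R ab by (auto simp: indep_list_def)
    then show ?thesis using ab \<open>a = 0\<close> by (auto simp: zero_vec_Suc)
  qed
  then show "indep_list k (v # vs)"
    using R v by (auto simp: indep_list_def)
qed

definition indep_lists :: "nat \<Rightarrow> nat \<Rightarrow> 'a::comm_ring_1 vec list set" where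
  "indep_lists k m = {vs. length vs = m \<and> indep_list k vs}"

lemma card_lin_comb_image:
  fixes vs :: "'a::{comm_ring_1,finite} vec list"
  assumes "indep_list k vs"
  shows "card (lin_comb k vs ` carrier_vec (length vs)) = CARD('a) ^ length vs"
  using card_image[OF inj_on_lin_comb[OF assms]] by (simp add: card_carrier_vec)

lemma indep_list_length_le:
  fixes vs :: "'a::{comm_ring_1,finite} vec list"
  assumes "indep_list k vs"
  shows "length vs \<le> k"
proof -
  have "card (lin_comb k vs ` carrier_vec (length vs)) \<le> card (carrier_vec k :: 'a vec set)"
    by (intro card_mono finite_carrier_vec) auto
  then have le: "CARD('a) ^ length vs \<le> CARD('a) ^ k"
    by (simp add: card_lin_comb_image[OF assms] card_carrier_vec)
  have "1 < CARD('a)" by (rule card_UNIV_gt_1)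
  then show ?thesis using le by simp
qed

lemma indep_lists_Suc:
  "indep_lists k (Suc m) = (\<lambda>(vs, v). v # vs) `
     (SIGMA vs:indep_lists k m. carrier_vec k - lin_comb k vs ` (carrier_vec m :: 'a::field vec set))"
  (is "?L = ?R")
proof (intro equalityI subsetI)
  fix us :: "'a vec list" assume us: "us \<in> ?L"
  then obtain v vs where "us = v # vs" by (cases us) (auto simp: indep_lists_def)
  moreover from this us have "v \<in> carrier_vec k" "set vs \<subseteq> carrier_vec k" "length vs = m"
    by (auto simp: indep_lists_def indep_list_def)
  ultimately show "us \<in> ?R"
    using us indep_list_Cons[of v k vs] by (force simp: indep_lists_def)
next
  fix us :: "'a vec list" assume "us \<in> ?R"
  then obtain v vs where us: "us = v # vs" "vs \<in> indep_lists k m" "v \<in> carrier_vec k"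
    "v \<notin> lin_comb k vs ` carrier_vec m" by auto
  then show "us \<in> ?L"
    using indep_list_Cons[of v k vs] by (auto simp: indep_lists_def indep_list_def)
qed

text \<open>A vector added in front must avoid the span of the \<open>m\<close> vectors already
  chosen, which by \<open>inj_on_lin_comb\<close> has as many elements as there are coefficient
  vectors.\<close>

lemma finite_indep_lists: "finite (indep_lists k m :: 'a::{field,finite} vec list set)"
  and card_indep_lists:
    "card (indep_lists k m :: 'a vec list set) = (\<Prod>i<m. CARD('a) ^ k - CARD('a) ^ i)"
proof -
  have "finite (indep_lists k m :: 'a vec list set) \<and>
    card (indep_lists k m :: 'a vec list set) = (\<Prod>i<m. CARD('a) ^ k - CARD('a) ^ i)"
  proof (induction m)
    case 0
    have "indep_lists k 0 = {[] :: 'a vec list}"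
      by (auto simp: indep_lists_def indep_list_def)
    then show ?case by simp
  next
    case (Suc m)
    let ?I = "indep_lists k m :: 'a vec list set"
    let ?C = "\<lambda>vs. carrier_vec k - lin_comb k vs ` carrier_vec m :: 'a vec set"
    have c: "card (?C vs) = CARD('a) ^ k - CARD('a) ^ m" if "vs \<in> ?I" for vs
      using that card_lin_comb_image[of k vs]
      by (subst card_Diff_subset) (auto simp: indep_lists_def card_carrier_vec finite_carrier_vec)
    have fin: "finite (Sigma ?I ?C)"
      using Suc.IH by (intro finite_SigmaI) (auto simp: finite_carrier_vec)
    have "inj_on (\<lambda>(vs, v). v # vs) (Sigma ?I ?C)"
      by (auto simp: inj_on_def)
    then have "card (indep_lists k (Suc m) :: 'a vec list set) = card (Sigma ?I ?C)"
      unfolding indep_lists_Suc by (rule card_image)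
    also have "\<dots> = (\<Sum>vs\<in>?I. card (?C vs))"
      using Suc.IH by (intro card_SigmaI) (auto simp: finite_carrier_vec)
    also have "\<dots> = (\<Prod>i<Suc m. CARD('a) ^ k - CARD('a) ^ i)"
      using c Suc.IH by simp
    finally show ?case unfolding indep_lists_Suc using fin by (auto intro: finite_imageI)
  qed
  then show "finite (indep_lists k m :: 'a vec list set)"
    "card (indep_lists k m :: 'a vec list set) = (\<Prod>i<m. CARD('a) ^ k - CARD('a) ^ i)" by auto
qed

text \<open>Over a finite field the exchange argument becomes a count: fewer than \<open>k\<close>
  independent vectors span fewer than \<open>q^k\<close> vectors, so another one can be
  added.\<close>

lemma indep_list_extend:
  fixes vs :: "'a::{field,finite} vec list"
  assumes "indep_list k vs" "length vs + m \<le> k"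
  shows "\<exists>us. length us = m \<and> indep_list k (us @ vs)"
  using assms(2)
proof (induction m)
  case (Suc m)
  then obtain us where us: "length us = m" "indep_list k (us @ vs)" by auto
  let ?S = "lin_comb k (us @ vs) ` carrier_vec (length (us @ vs))"
  have "1 < CARD('a)" by (rule card_UNIV_gt_1)
  then have "card ?S < card (carrier_vec k :: 'a vec set)"
    using us Suc.prems unfolding card_lin_comb_image[OF us(2)] card_carrier_vec
    by (intro power_strict_increasing) auto
  then have "\<not> carrier_vec k \<subseteq> ?S"
    by (metis card_mono finite_carrier_vec finite_imageI linorder_not_less)
  then obtain v where v: "v \<in> carrier_vec k" "v \<notin> ?S" by blast
  have "indep_list k (v # us @ vs)"
    using v us by (subst indep_list_Cons) (auto simp: indep_list_def)
  then show ?case using us by (intro exI[of _ "v # us"]) auto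
qed (use assms in auto)

lemma lin_comb_append:
  assumes "c \<in> carrier_vec (length us)" "c' \<in> carrier_vec (length vs)"
  shows "lin_comb k (us @ vs) (c @\<^sub>v c') = lin_comb k us c + lin_comb k vs c'"
proof (rule eq_vecI)
  fix i assume "i < dim_vec (lin_comb k us c + lin_comb k vs c')"
  then have i: "i < k" by (simp add: lin_comb_def)
  have "(\<Sum>j<length us + length vs. (c @\<^sub>v c') $ j * (us @ vs) ! j $ i)
      = (\<Sum>j<length us. c $ j * us ! j $ i) + (\<Sum>j<length vs. c' $ j * vs ! j $ i)"
    using assms by (simp add: sum.nat_group lessThan_atLeast0 sum.atLeastLessThan_concat
       flip: sum.atLeastLessThan_concat[of 0 "length us" "length us + length vs"])
       (simp add: sum.atLeastLessThan_shift_0[of _ "length us"] nth_append)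
  then show "lin_comb k (us @ vs) (c @\<^sub>v c') $ i = (lin_comb k us c + lin_comb k vs c') $ i"
    using i by (simp add: lin_comb_def)
qed (simp add: lin_comb_def)

text \<open>Extension adds vectors in front, whereas the rows of \<open>V\<close> have to be the top
  rows of the completed matrix in \<open>indep_rows_decomp\<close>.\<close>

lemma indep_list_swap:
  assumes "indep_list k (us @ vs)"
  shows "indep_list k (vs @ us)"
  unfolding indep_list_def
proof (intro conjI ballI impI)
  show "set (vs @ us) \<subseteq> carrier_vec k" using assms by (auto simp: indep_list_def)
  fix c assume c: "c \<in> carrier_vec (length (vs @ us))" and 0: "lin_comb k (vs @ us) c = 0\<^sub>v k"
  define a where "a = vec_first c (length vs)"
  define b where "b = vec_last c (length us)"
  have ab: "a \<in> carrier_vec (length vs)" "b \<in> carrier_vec (length us)" "c = a @\<^sub>v b"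
    using c by (auto simp: a_def b_def vec_first_last_append)
  have "lin_comb k (us @ vs) (b @\<^sub>v a) = 0\<^sub>v k"
    using 0 ab by (simp add: lin_comb_append comm_add_vec[of _ k])
  then have "b @\<^sub>v a = 0\<^sub>v (length us + length vs)"
    using assms ab by (auto simp: indep_list_def)
  then have *: "(b @\<^sub>v a) $ i = 0" if "i < length us + length vs" for i using that by simp
  have "a $ i = 0" if "i < length vs" for i
    using *[of "length us + i"] that ab by simp
  moreover have "b $ i = 0" if "i < length us" for i
    using *[of i] that ab by simp
  ultimately show "c = 0\<^sub>v (length (vs @ us))"
    using ab by (intro eq_vecI) auto
qed

lemma lin_comb_mat_of_rows:
  assumes "c \<in> carrier_vec (length us)"
  shows "lin_comb k us c = transpose_mat (mat_of_rows k us) *\<^sub>v c"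
  using assms
  by (intro eq_vecI) (auto simp: lin_comb_def scalar_prod_def mat_of_rows_def mult.commute lessThan_atLeast0 intro!: sum.cong)

lemma unimodular_if_det_nonzero:
  fixes A :: "'a::field mat"
  assumes "A \<in> carrier_mat k k" "det A \<noteq> 0"
  shows "unimodular k A"
  using det_non_zero_imp_unit[OF assms, of undefined] assms
  by (auto simp: Units_def ring_mat_def unimodular_def)

lemma indep_list_unimodular:
  fixes us :: "'a::field vec list"
  assumes us: "indep_list k us" "length us = k"
  shows "unimodular k (mat_of_rows k us)"
proof -
  let ?A = "mat_of_rows k us"
  have A: "?A \<in> carrier_mat k k" using us by auto
  have "det (transpose_mat ?A) \<noteq> 0"
    using us lin_comb_mat_of_rows[of _ us k] A
    by (subst det_0_iff_vec_prod_zero_field[of _ k]) (auto simp: indep_list_def)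
  then show ?thesis using A unimodular_if_det_nonzero det_transpose[OF A] by metis
qed

text \<open>Surjections from \<open>F^k\<close> onto \<open>F^d\<close>, over a field the matrices
  of rank \<open>d\<close>. The right inverse is what yields constant preimages in
  \<open>onto_basis_mult\<close>.\<close>

definition surj_mats :: "nat \<Rightarrow> nat \<Rightarrow> 'a::comm_ring_1 mat set" where
  "surj_mats d k = {V \<in> carrier_mat d k. \<exists>W\<in>carrier_mat k d. V * W = 1\<^sub>m d}"

text \<open>Complete the rows of \<open>V\<close> to an invertible matrix \<open>?T0\<close> and let
  \<open>T\<close> be its inverse: \<open>V\<close> consists of the top \<open>d\<close> rows of
  \<open>?T0\<close>, so \<open>V * T\<close> consists of the top \<open>d\<close> rows of the
  identity.\<close>

lemma indep_rows_decomp: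
  fixes V :: "'a::{field,finite} mat"
  assumes V: "V \<in> carrier_mat d k" and ind: "indep_list k (rows V)"
  shows "\<exists>T. unimodular k T \<and> V * T = mat d k (\<lambda>(i,j). if i = j then 1 else 0)"
proof -
  have len: "length (rows V) = d" using V by simp
  then have dk: "d \<le> k" using indep_list_length_le[OF ind] by simp
  obtain us where us: "length us = k - d" "indep_list k (us @ rows V)"
    using indep_list_extend[OF ind, of "k - d"] len dk by auto
  let ?T0 = "mat_of_rows k (rows V @ us)"
  have T0c: "?T0 \<in> carrier_mat k k" using us len dk by (auto simp: mat_of_rows_def)
  have "unimodular k ?T0"
    using indep_list_unimodular[OF indep_list_swap[OF us(2)]] us len dk by simp
  then obtain T where T: "T \<in> carrier_mat k k" "?T0 * T = 1\<^sub>m k" "T * ?T0 = 1\<^sub>m k"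
    unfolding unimodular_def by blast
  have "V * T = mat d k (\<lambda>(i,j). if i = j then 1 else 0)"
  proof (rule eq_matI, goal_cases)
    case (1 i j)
    then have ij: "i < d" "j < k" by auto
    have "set (rows V @ us) \<subseteq> carrier_vec k"
      using us by (auto simp: indep_list_def)
    then have "row ?T0 i = row V i"
      using ij V len dk us by (subst mat_of_rows_row) (auto simp: nth_append subset_iff)
    then have "(V * T) $$ (i,j) = (?T0 * T) $$ (i,j)"
      using ij V T(1) T0c dk by (auto simp: index_mult_mat(1))
    then show ?case using ij dk T by simp
  qed (use V T in auto)
  moreover have "unimodular k T" using T T0c by (auto intro: unimodularI)
  ultimately show ?thesis by blast
qed

lemma surj_mats_iff_indep:
  fixes V :: "'a::{field,finite} mat"
  assumes V: "V \<in> carrier_mat d k"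
  shows "V \<in> surj_mats d k \<longleftrightarrow> indep_list k (rows V)"
proof
  assume "V \<in> surj_mats d k"
  then obtain W where W: "W \<in> carrier_mat k d" "V * W = 1\<^sub>m d" by (auto simp: surj_mats_def)
  show "indep_list k (rows V)"
    unfolding indep_list_def
  proof (intro conjI ballI impI)
    show "set (rows V) \<subseteq> carrier_vec k" using V by (auto simp: rows_def)
    fix c assume "c \<in> carrier_vec (length (rows V))" and 0: "lin_comb k (rows V) c = 0\<^sub>v k"
    then have c: "c \<in> carrier_vec d" using V by simp
    have "mat_of_rows k (rows V) = V" using V by auto
    then have "transpose_mat V *\<^sub>v c = 0\<^sub>v k"
      using lin_comb_mat_of_rows[of c "rows V" k] 0 c V by simp
    then have "transpose_mat W *\<^sub>v (transpose_mat V *\<^sub>v c) = 0\<^sub>v d"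
      using W by (intro eq_vecI) auto
    moreover have "transpose_mat W *\<^sub>v (transpose_mat V *\<^sub>v c) = (transpose_mat W * transpose_mat V) *\<^sub>v c"
      using W(1) V c by (simp add: assoc_mult_mat_vec[of _ d k _ d])
    moreover have "transpose_mat W * transpose_mat V = 1\<^sub>m d"
      using transpose_mult[OF V W(1)] W(2) by simp
    ultimately show "c = 0\<^sub>v (length (rows V))" using c V by simp
  qed
next
  assume ind: "indep_list k (rows V)"
  then have dk: "d \<le> k" using indep_list_length_le[OF ind] V by simp
  obtain T where T: "unimodular k T" "V * T = mat d k (\<lambda>(i,j). if i = j then 1 else 0)"
    using indep_rows_decomp[OF V ind] by blast
  note Tc = unimodular_carrier[OF T(1)]
  let ?E = "mat k d (\<lambda>(i,j). if i = j then 1 else 0) :: 'a mat"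
  have "V * (T * ?E) = (V * T) * ?E"
    using V Tc by (simp add: assoc_mult_mat[of _ d k _ k _ d])
  also have "\<dots> = 1\<^sub>m d"
    unfolding T(2) using dk
    by (intro eq_matI) (auto simp: scalar_prod_def if_distrib[of "\<lambda>x. x * _"] sum.delta cong: if_cong)
  finally show "V \<in> surj_mats d k"
    unfolding surj_mats_def using V Tc by (intro CollectI conjI bexI[of _ "T * ?E"]) auto
qed

text \<open>For \<open>k < d\<close> the factor with \<open>i = k\<close> is zero, so the formula
  then says that there is no surjection. This bounds the degree of the product of the invariant
  factors in \<open>sum_N_count\<close>.\<close>

lemma card_surj_mats:
  "card (surj_mats d k :: 'a::{field,finite} mat set) = (\<Prod>i<d. CARD('a) ^ k - CARD('a) ^ i)"
proof -
  have "bij_betw rows (surj_mats d k :: 'a mat set) (indep_lists k d)"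
  proof (rule bij_betwI[where g = "mat_of_rows k"])
    show "rows \<in> surj_mats d k \<rightarrow> (indep_lists k d :: 'a vec list set)"
      using surj_mats_iff_indep[where 'a='a] by (auto simp: indep_lists_def surj_mats_def)
    have c: "mat_of_rows k vs \<in> carrier_mat d k" "rows (mat_of_rows k vs) = vs" if "vs \<in> indep_lists k d"
      for vs :: "'a vec list"
      using that by (auto simp: indep_lists_def indep_list_def)
    then show "mat_of_rows k \<in> (indep_lists k d :: 'a vec list set) \<rightarrow> surj_mats d k"
      using surj_mats_iff_indep[where 'a='a] by (auto simp: indep_lists_def)
    show "rows (mat_of_rows k vs) = vs" if "vs \<in> indep_lists k d" for vs :: "'a vec list"
      using c that by blast
    show "mat_of_rows k (rows V) = V" if "V \<in> surj_mats d k" for V :: "'a mat"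
      using that by (auto simp: surj_mats_def)
  qed
  then show ?thesis using bij_betw_same_card card_indep_lists by metis
qed

lemma surj_mats_square:
  fixes A :: "'a::field mat"
  assumes "A \<in> carrier_mat d d"
  shows "A \<in> surj_mats d d \<longleftrightarrow> invertible_mat A"
proof
  assume "A \<in> surj_mats d d"
  then obtain W where W: "W \<in> carrier_mat d d" "A * W = 1\<^sub>m d" by (auto simp: surj_mats_def)
  moreover from this have "W * A = 1\<^sub>m d"
    using mat_mult_left_right_inverse[OF assms] by blast
  ultimately show "invertible_mat A"
    using assms by (auto simp: invertible_mat_def inverts_mat_def)
next
  assume "invertible_mat A"
  then obtain W where W: "A * W = 1\<^sub>m (dim_row A)" "W * A = 1\<^sub>m (dim_row W)"
    by (auto simp: invertible_mat_def inverts_mat_def)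
  have "dim_col (A * W) = d" using W(1) assms by simp
  moreover have "dim_col (W * A) = dim_row W" using W(2) by simp
  ultimately have "W \<in> carrier_mat d d" using assms by auto
  then show "A \<in> surj_mats d d" using W assms by (auto simp: surj_mats_def)
qed

lemma GL_card_eq: "GL_card TYPE('a::{field_gcd,finite}) d = (\<Prod>i<d. CARD('a) ^ d - CARD('a) ^ i)"
proof -
  have "{A :: 'a mat. A \<in> carrier_mat d d \<and> invertible_mat A} = surj_mats d d"
    using surj_mats_square[where 'a='a] by (auto simp: surj_mats_def)
  then show ?thesis unfolding GL_card_def by (simp add: card_surj_mats)
qed

section \<open>The image module of a characteristic matrix\<close>

interpretation const_poly_hom: comm_ring_hom "\<lambda>a :: 'a::comm_ring_1. [:a:]"
  by unfold_locales (auto simp: one_pCons)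

abbreviation const_vec :: "'a::comm_ring_1 vec \<Rightarrow> 'a poly vec" where
  "const_vec \<equiv> map_vec (\<lambda>a. [:a:])"

abbreviation const_mat :: "'a::comm_ring_1 mat \<Rightarrow> 'a poly mat" where
  "const_mat \<equiv> map_mat (\<lambda>a. [:a:])"

text \<open>The submodule of \<open>F[x]^k\<close> generated by the rows of the characteristic matrix, written as columns;
  its quotient is the torsion module attached to \<open>B\<close>.\<close>

definition char_image :: "'a::field_gcd mat \<Rightarrow> 'a poly vec set" where
  "char_image B = (\<lambda>y. transpose_mat (charmat B) *\<^sub>v y) ` carrier_vec (dim_row B)"

lemma charmat_carrier[simp]: "B \<in> carrier_mat n k \<Longrightarrow> charmat B \<in> carrier_mat n k"
  by (simp add: charmat_def)

lemma charmat_mult_vec_index: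
  assumes "B \<in> carrier_mat n k" "k \<le> n" "y \<in> carrier_vec n" "j < k"
  shows "(transpose_mat (charmat B) *\<^sub>v y) $ j = [:0,1:] * y $ j - (\<Sum>i<n. [:B $$ (i,j):] * y $ i)"
proof -
  have "(transpose_mat (charmat B) *\<^sub>v y) $ j
      = (\<Sum>i<n. ((if i = j then [:0,1:] else 0) - [:B $$ (i,j):]) * y $ i)"
    using assms by (auto simp: scalar_prod_def charmat_def lessThan_atLeast0 intro!: sum.cong)
  also have "\<dots> = (\<Sum>i<n. (if i = j then [:0,1:] * y $ i else 0) - [:B $$ (i,j):] * y $ i)"
    by (intro sum.cong) (auto simp: left_diff_distrib)
  also have "\<dots> = [:0,1:] * y $ j - (\<Sum>i<n. [:B $$ (i,j):] * y $ i)"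
    using assms by (subst sum_subtractf) (simp add: sum.delta)
  finally show ?thesis .
qed

lemma char_image_subset: "B \<in> carrier_mat n k \<Longrightarrow> char_image B \<subseteq> carrier_vec k"
  by (auto simp: char_image_def charmat_def intro!: mult_mat_vec_carrier[of _ k n])

lemma char_imageI: "B \<in> carrier_mat n k \<Longrightarrow> y \<in> carrier_vec n \<Longrightarrow> u = transpose_mat (charmat B) *\<^sub>v y
    \<Longrightarrow> u \<in> char_image B"
  by (auto simp: char_image_def)

lemma char_imageE:
  assumes "u \<in> char_image B" "B \<in> carrier_mat n k"
  obtains y where "y \<in> carrier_vec n" "u = transpose_mat (charmat B) *\<^sub>v y"
  using assms by (auto simp: char_image_def)

text \<open>For \<open>j < k\<close> row \<open>j\<close> of the characteristic matrix says that
  \<open>x\<close> times the unit vector \<open>j\<close> is congruent to row \<open>j\<close> of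
  \<open>B\<close>, a constant vector; \<open>k \<le> n\<close> provides such a row for every
  column. Splitting off the constant coefficients and using this relation lowers the degree, as in
  Horner's scheme.\<close>

lemma char_image_const_decomp_bounded:
  assumes B: "B \<in> carrier_mat n k" and kn: "k \<le> n"
  shows "u \<in> carrier_vec k \<Longrightarrow> (\<And>j. j < k \<Longrightarrow> degree (u $ j) \<le> m) \<Longrightarrow>
     \<exists>c\<in>carrier_vec k. u - const_vec c \<in> char_image B"
proof (induction m arbitrary: u)
  case 0
  let ?c = "vec k (\<lambda>j. coeff (u $ j) 0)"
  have "u - const_vec ?c = transpose_mat (charmat B) *\<^sub>v 0\<^sub>v n"
    using 0 B by (intro eq_vecI) (auto simp: charmat_def degree_0_id)
  then have "u - const_vec ?c \<in> char_image B"
    using B by (intro char_imageI[of _ n k]) auto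
  then show ?case by (intro bexI[of _ ?c]) auto
next
  case (Suc m)
  have "\<forall>j. \<exists>a q. j < k \<longrightarrow> u $ j = pCons a q \<and> degree q \<le> m"
  proof
    fix j
    obtain a q where "u $ j = pCons a q" by (cases "u $ j") auto
    then show "\<exists>a q. j < k \<longrightarrow> u $ j = pCons a q \<and> degree q \<le> m"
      using Suc.prems(2)[of j] by (intro exI[of _ a] exI[of _ q]) (auto split: if_splits)
  qed
  then obtain a q where aq: "\<And>j. j < k \<Longrightarrow> u $ j = pCons (a j) (q j)" "\<And>j. j < k \<Longrightarrow> degree (q j) \<le> m"
    by metis
  obtain c where c: "c \<in> carrier_vec k" "vec k q - const_vec c \<in> char_image B"
    using Suc.IH[of "vec k q"] aq by auto
  then obtain y where y: "y \<in> carrier_vec n" "vec k q - const_vec c = transpose_mat (charmat B) *\<^sub>v y"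
    using char_imageE B by blast
  \<comment> \<open>\<open>cp\<close> pads \<open>c\<close> with zeros to length \<open>n\<close>.
    If \<open>q = c + E y\<close> with \<open>E\<close> the transposed characteristic matrix, then
    \<open>x q\<close> equals \<open>E (x y + cp)\<close> plus the constant vector that the
    transpose of \<open>B\<close> makes of \<open>cp\<close>; this dictates \<open>y'\<close> and
    \<open>c'\<close>.\<close>
  define cp where "cp = (\<lambda>i. if i < k then c $ i else 0)"
  define c' where "c' = vec k (\<lambda>j. a j + (\<Sum>i<n. B $$ (i,j) * cp i))"
  define y' where "y' = [:0,1:] \<cdot>\<^sub>v y + vec n (\<lambda>i. [:cp i:])"
  have y'c: "y' \<in> carrier_vec n" using y by (auto simp: y'_def)
  have "u - const_vec c' = transpose_mat (charmat B) *\<^sub>v y'"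
  proof (rule eq_vecI, goal_cases)
    case (1 j)
    then have j: "j < k" using B by (simp add: charmat_def)
    have q: "q j - [:c $ j:] = [:0,1:] * y $ j - (\<Sum>i<n. [:B $$ (i,j):] * y $ i)"
      using arg_cong[OF y(2), of "\<lambda>v. v $ j"] charmat_mult_vec_index[OF B kn y(1) j] j c by simp
    have "(transpose_mat (charmat B) *\<^sub>v y') $ j = [:0,1:] * y' $ j - (\<Sum>i<n. [:B $$ (i,j):] * y' $ i)"
      by (rule charmat_mult_vec_index[OF B kn y'c j])
    also have "(\<Sum>i<n. [:B $$ (i,j):] * y' $ i)
        = [:0,1:] * (\<Sum>i<n. [:B $$ (i,j):] * y $ i) + (\<Sum>i<n. [:B $$ (i,j) * cp i:])"
    proof -
      have "(\<Sum>i<n. [:B $$ (i,j):] * y' $ i)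
          = (\<Sum>i<n. [:0,1:] * ([:B $$ (i,j):] * y $ i) + [:B $$ (i,j) * cp i:])"
        using y(1) by (intro sum.cong) (auto simp: y'_def smult_add_right)
      then show ?thesis by (simp only: sum.distrib sum_distrib_left)
    qed
    also have "y' $ j = [:0,1:] * y $ j + [:c $ j:]"
      using y(1) j kn by (simp add: y'_def cp_def)
    also have "[:0,1:] * ([:0,1:] * y $ j + [:c $ j:])
         - ([:0,1:] * (\<Sum>i<n. [:B $$ (i,j):] * y $ i) + (\<Sum>i<n. [:B $$ (i,j) * cp i:]))
       = [:0,1:] * ([:0,1:] * y $ j - (\<Sum>i<n. [:B $$ (i,j):] * y $ i) + [:c $ j:]) - (\<Sum>i<n. [:B $$ (i,j) * cp i:])"
      by (simp only: distrib_left right_diff_distrib) simp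
    also have "\<dots> = [:0,1:] * q j - (\<Sum>i<n. [:B $$ (i,j) * cp i:])"
      by (simp only: q[symmetric]) simp
    also have "(\<Sum>i<n. [:B $$ (i,j) * cp i:]) = [:\<Sum>i<n. B $$ (i,j) * cp i:]"
      by (rule const_poly_hom.hom_sum[symmetric])
    also have "[:0,1:] * q j - [:\<Sum>i<n. B $$ (i,j) * cp i:] = u $ j - const_vec c' $ j"
      using aq(1)[OF j] j by (simp add: c'_def)
    finally show ?case using j by (simp add: c'_def)
  qed (use B in \<open>auto simp: charmat_def c'_def\<close>)
  then have "u - const_vec c' \<in> char_image B"
    using y'c B by (intro char_imageI[of _ n k]) auto
  then show ?case by (intro bexI[of _ c']) (auto simp: c'_def)
qed

lemma char_image_const_decomp:
  assumes "B \<in> carrier_mat n k" "k \<le> n" "u \<in> carrier_vec k"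
  shows "\<exists>c\<in>carrier_vec k. u - const_vec c \<in> char_image B"
proof (rule char_image_const_decomp_bounded[OF assms, of "Max (insert 0 ((\<lambda>j. degree (u $ j)) ` {..<k}))"])
  fix j assume "j < k"
  then show "degree (u $ j) \<le> Max (insert 0 ((\<lambda>j. degree (u $ j)) ` {..<k}))"
    by (intro Max_ge) auto
qed

text \<open>At an entry \<open>y $ j\<close> of largest degree, \<open>x * y $ j\<close> exceeds
  every other term of the equation in degree. So for a square matrix the map is injective and no
  nonzero constant vector lies in its image.\<close>

lemma charmat_mult_vec_const_imp_0:
  assumes A: "A \<in> carrier_mat d d" and y: "y \<in> carrier_vec d"
    and e: "transpose_mat (charmat A) *\<^sub>v y = const_vec c" and c: "c \<in> carrier_vec d"
  shows "y = 0\<^sub>v d"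
proof (rule ccontr)
  assume "y \<noteq> 0\<^sub>v d"
  then have ne: "\<exists>j. j < d \<and> y $ j \<noteq> 0" using y by (metis eq_vecI carrier_vecD index_zero_vec)
  then obtain j where j: "j < d" "y $ j \<noteq> 0"
    and max: "\<And>i. i < d \<and> y $ i \<noteq> 0 \<Longrightarrow> degree (y $ i) \<le> degree (y $ j)"
    using ex_has_greatest_nat[of "\<lambda>j. j < d \<and> y $ j \<noteq> 0" _ "\<lambda>j. degree (y $ j)" "Suc (Max ((\<lambda>j. degree (y $ j)) ` {..<d}))"]
    by (metis (no_types, lifting) Max_ge finite_imageI finite_lessThan imageI le_imp_less_Suc lessThan_iff)
  have max': "degree (y $ i) \<le> degree (y $ j)" if "i < d" for i
    using max[of i] that by (cases "y $ i = 0") auto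
  have "[:0,1:] * y $ j = [:c $ j:] + (\<Sum>i<d. [:A $$ (i,j):] * y $ i)"
    using charmat_mult_vec_index[OF A order_refl y j(1)] e j c by (simp add: algebra_simps)
  moreover have "degree ([:c $ j:] + (\<Sum>i<d. [:A $$ (i,j):] * y $ i)) \<le> degree (y $ j)"
    using max' by (intro degree_add_le degree_sum_le) (auto intro: order.trans[OF degree_mult_le] order.trans[OF degree_smult_le])
  moreover have "degree ([:0,1:] * y $ j) = Suc (degree (y $ j))"
    using j by (subst degree_mult_eq) auto
  ultimately show False by simp
qed

text \<open>A constant unit vector would have to be the image of zero. That only the empty square
  matrix is simple is what makes the automorphism weights computable in
  \<open>surj_mult_aut_weight\<close>.\<close>

lemma char_image_square_proper:
  assumes A: "A \<in> carrier_mat d d" and im: "char_image A = carrier_vec d"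
  shows "d = 0"
proof (rule ccontr)
  assume "d \<noteq> 0"
  have "const_vec (unit_vec d 0) \<in> char_image A" unfolding im by simp
  then obtain y where y: "y \<in> carrier_vec d" "const_vec (unit_vec d 0) = transpose_mat (charmat A) *\<^sub>v y"
    using char_imageE A by blast
  have "y = 0\<^sub>v d"
    by (rule charmat_mult_vec_const_imp_0[OF A y(1) y(2)[symmetric]]) simp
  then have "const_vec (unit_vec d 0) $ 0 = (0 :: 'a poly)"
    using y(2) A \<open>d \<noteq> 0\<close> by (simp add: charmat_def)
  then show False using \<open>d \<noteq> 0\<close> by simp
qed

text \<open>The kernel of the map given by \<open>A\<close> from a free module to the direct sum of
  the \<open>F[x]/(p_i)\<close>: coordinate \<open>i\<close> is read modulo
  \<open>ps ! i\<close>.\<close>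

definition kernel_lattice :: "'a::comm_ring_1 list \<Rightarrow> 'a mat \<Rightarrow> 'a vec set" where
  "kernel_lattice ps A = {u \<in> carrier_vec (dim_col A). \<forall>i<dim_row A. ps ! i dvd (A *\<^sub>v u) $ i}"

lemma kernel_lattice_diff: "u \<in> kernel_lattice ps A \<Longrightarrow> v \<in> kernel_lattice ps A \<Longrightarrow> u - v \<in> kernel_lattice ps A"
  by (auto simp: kernel_lattice_def scalar_prod_minus_distrib[of _ "dim_col A"] intro: dvd_diff)

lemma kernel_lattice_mult_mat_vec:
  assumes A: "A \<in> carrier_mat k d" and E: "E \<in> carrier_mat d m" and y: "y \<in> carrier_vec m"
    and col: "\<And>j. j < m \<Longrightarrow> col E j \<in> kernel_lattice ps A"
  shows "E *\<^sub>v y \<in> kernel_lattice ps A"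
proof -
  have "ps ! i dvd (A *\<^sub>v (E *\<^sub>v y)) $ i" if i: "i < k" for i
  proof -
    define W where "W = A * E"
    have W: "W \<in> carrier_mat k m" using A E by (simp add: W_def)
    have "A *\<^sub>v (E *\<^sub>v y) = W *\<^sub>v y"
      using assoc_mult_mat_vec[OF A E y] by (simp add: W_def)
    then have "(A *\<^sub>v (E *\<^sub>v y)) $ i = (\<Sum>j=0..<m. W $$ (i,j) * y $ j)"
      using W y i by (simp add: scalar_prod_def)
    moreover have "ps ! i dvd W $$ (i,j)" if "j < m" for j
      using col[OF that] A E i that by (auto simp: kernel_lattice_def W_def)
    ultimately show ?thesis by (auto intro!: dvd_sum)
  qed
  moreover have "E *\<^sub>v y \<in> carrier_vec d" using E y by (rule mult_mat_vec_carrier)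
  ultimately show ?thesis using A by (auto simp: kernel_lattice_def)
qed

text \<open>Number of matrices all of whose invariant factors are trivial.\<close>

definition simple_count :: "'a::{field_gcd,finite} itself \<Rightarrow> nat \<Rightarrow> nat \<Rightarrow> nat" where
  "simple_count _ n k = card {D :: 'a mat. D \<in> carrier_mat n k \<and> char_image D = carrier_vec k}"

section \<open>Change of basis of \<open>F^k\<close>\<close>

definition I_mat :: "nat \<Rightarrow> nat \<Rightarrow> 'a::zero_neq_one mat" where
  "I_mat n k = mat n k (\<lambda>(i,j). if i = j then 1 else 0)"

lemma charmat_eq:
  "B \<in> carrier_mat n k \<Longrightarrow> charmat B = [:0,1:] \<cdot>\<^sub>m const_mat (I_mat n k) - const_mat B"
  by (intro eq_matI) (auto simp: charmat_def I_mat_def)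

text \<open>\<open>T'\<close> is meant to be the inverse of \<open>T\<close>. The left factor acts
  by \<open>T\<close> on the first \<open>k\<close> coordinates and trivially on the others, so the
  same transformation fixes \<open>I_mat n k\<close>, and the characteristic matrix is transformed
  along with \<open>B\<close>.\<close>

definition base_change :: "nat \<Rightarrow> nat \<Rightarrow> 'a::comm_ring_1 mat \<Rightarrow> 'a mat \<Rightarrow> 'a mat \<Rightarrow> 'a mat" where
  "base_change n k T T' B = four_block_mat T (0\<^sub>m k (n - k)) (0\<^sub>m (n - k) k) (1\<^sub>m (n - k)) * B * T'"

lemma block_one_mult_I_mat:
  fixes T :: "'a::comm_ring_1 mat"
  assumes T: "T \<in> carrier_mat k k" and kn: "k \<le> n"
  shows "four_block_mat T (0\<^sub>m k (n - k)) (0\<^sub>m (n - k) k) (1\<^sub>m (n - k)) * I_mat n k = I_mat n k * T"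
    (is "?T * _ = _")
proof (rule eq_matI, goal_cases)
  case (1 i j)
  then have ij: "i < n" "j < k" using T by (auto simp: I_mat_def)
  have "(?T * I_mat n k) $$ (i,j) = (\<Sum>l=0..<n. ?T $$ (i,l) * (if l = j then 1 else 0))"
    using ij T kn by (auto simp: I_mat_def scalar_prod_def intro!: sum.cong)
  also have "\<dots> = ?T $$ (i,j)"
    using ij kn by (simp add: if_distrib[of "\<lambda>x. _ * x"] sum.delta cong: if_cong)
  also have "\<dots> = (if i < k then T $$ (i,j) else 0)"
    using ij T kn by auto
  also have "\<dots> = (\<Sum>l=0..<k. (if i = l then 1 else 0) * T $$ (l,j))"
    using ij by (simp add: if_distrib[of "\<lambda>x. x * _"] sum.delta' cong: if_cong)
  also have "\<dots> = (I_mat n k * T) $$ (i,j)"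
    using ij T by (auto simp: I_mat_def scalar_prod_def intro!: sum.cong)
  finally show ?case .
qed (use T kn in \<open>auto simp: I_mat_def\<close>)

lemma charmat_base_change:
  fixes B :: "'a::field_gcd mat"
  assumes B: "B \<in> carrier_mat n k" and kn: "k \<le> n"
    and T: "T \<in> carrier_mat k k" "T' \<in> carrier_mat k k" "T * T' = 1\<^sub>m k"
  shows "charmat (base_change n k T T' B) =
    const_mat (four_block_mat T (0\<^sub>m k (n - k)) (0\<^sub>m (n - k) k) (1\<^sub>m (n - k))) * charmat B * const_mat T'"
proof -
  define S where "S = four_block_mat T (0\<^sub>m k (n - k)) (0\<^sub>m (n - k) k) (1\<^sub>m (n - k))"
  have S: "S \<in> carrier_mat n n" using T kn by (auto simp: S_def)
  have I: "(I_mat n k :: 'a mat) \<in> carrier_mat n k" by (simp add: I_mat_def)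
  have IT: "(I_mat n k :: 'a mat) = S * I_mat n k * T'"
    unfolding S_def block_one_mult_I_mat[OF T(1) kn] assoc_mult_mat[OF I T(1,2)] T(3) using I by simp
  have SBT: "S * B * T' \<in> carrier_mat n k" using S B T by simp
  have "charmat (S * B * T') = [:0,1:] \<cdot>\<^sub>m const_mat (S * I_mat n k * T') - const_mat (S * B * T')"
    using charmat_eq[OF SBT] unfolding IT[symmetric] .
  also have "const_mat (S * I_mat n k * T') = const_mat S * const_mat (I_mat n k) * const_mat T'"
    using S I T const_poly_hom.mat_hom_mult[of "S * I_mat n k" n k T' k] const_poly_hom.mat_hom_mult[of S n n "I_mat n k" k] by simp
  also have "const_mat (S * B * T') = const_mat S * const_mat B * const_mat T'"
    using S B T const_poly_hom.mat_hom_mult[of "S * B" n k T' k] const_poly_hom.mat_hom_mult[of S n n B k] by simp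
  also have "[:0,1:] \<cdot>\<^sub>m (const_mat S * const_mat (I_mat n k) * const_mat T') - const_mat S * const_mat B * const_mat T'
     = const_mat S * ([:0,1:] \<cdot>\<^sub>m const_mat (I_mat n k) - const_mat B) * const_mat T'"
  proof -
    define s where "s = const_mat S"
    define t where "t = const_mat T'"
    define b where "b = const_mat B"
    define j where "j = const_mat (I_mat n k :: 'a mat)"
    have c: "s \<in> carrier_mat n n" "t \<in> carrier_mat k k" "b \<in> carrier_mat n k" "j \<in> carrier_mat n k"
      using S T B I by (auto simp: s_def t_def b_def j_def)
    have "s * ([:0,1:] \<cdot>\<^sub>m j - b) * t = ([:0,1:] \<cdot>\<^sub>m (s * j) - s * b) * t"
      using c by (subst mult_minus_distrib_mat[of _ n n _ k]) (auto simp: mult_smult_distrib[of _ n n _ k])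
    also have "\<dots> = [:0,1:] \<cdot>\<^sub>m (s * j * t) - s * b * t"
      using c mult_smult_assoc_mat[of "s * j" n k t k "[:0,1:]"]
      by (subst minus_mult_distrib_mat[of _ n k _ _ k]) auto
    finally show ?thesis by (simp add: s_def t_def b_def j_def)
  qed
  also have "[:0,1:] \<cdot>\<^sub>m const_mat (I_mat n k) - const_mat B = charmat B"
    by (rule charmat_eq[OF B, symmetric])
  finally show ?thesis by (simp add: S_def base_change_def)
qed

lemma base_change_carrier:
  assumes "B \<in> carrier_mat n k" "k \<le> n" "T \<in> carrier_mat k k" "T' \<in> carrier_mat k k"
  shows "base_change n k T T' B \<in> carrier_mat n k"
  using assms unfolding base_change_def
  by (intro mult_carrier_mat[of _ n k] mult_carrier_mat[of _ n n]) auto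

lemma base_change_inverse:
  assumes B: "B \<in> carrier_mat n k" and kn: "k \<le> n"
    and T: "T \<in> carrier_mat k k" "T' \<in> carrier_mat k k" "T * T' = 1\<^sub>m k" "T' * T = 1\<^sub>m k"
  shows "base_change n k T' T (base_change n k T T' B) = B"
proof -
  define S where "S = (\<lambda>T. four_block_mat T (0\<^sub>m k (n - k)) (0\<^sub>m (n - k) k) (1\<^sub>m (n - k) :: 'a mat))"
  have S: "S T \<in> carrier_mat n n" "S T' \<in> carrier_mat n n" using T kn by (auto simp: S_def)
  have "S T' * S T = 1\<^sub>m n"
    unfolding S_def using T kn
    by (simp add: mult_four_block_mat[of _ k k _ "n - k" _ "n - k" _ _ k _ "n - k"])
  then have 1: "S T' * (S T * B) = B"
    using assoc_mult_mat[OF S(2,1) B] B by simp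
  have "base_change n k T' T (base_change n k T T' B) = S T' * (S T * B * T') * T"
    by (simp add: base_change_def S_def)
  also have "\<dots> = S T' * ((S T * B) * (T' * T))"
  proof -
    define X where "X = S T * B"
    have X: "X \<in> carrier_mat n k" using S B by (simp add: X_def)
    have "S T' * (X * T') * T = S T' * (X * T' * T)"
      using S X T by (intro assoc_mult_mat[of _ n n _ k _ k]) auto
    also have "X * T' * T = X * (T' * T)"
      using X T by (intro assoc_mult_mat[of _ n k _ k _ k]) auto
    finally show ?thesis by (simp add: X_def)
  qed
  also have "\<dots> = B" using 1 S B T by simp
  finally show ?thesis .
qed

lemma char_image_base_change_subset:
  fixes B :: "'a::field_gcd mat"
  assumes B: "B \<in> carrier_mat n k" and kn: "k \<le> n"
    and T: "T \<in> carrier_mat k k" "T' \<in> carrier_mat k k" "T * T' = 1\<^sub>m k"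
    and u: "u \<in> char_image (base_change n k T T' B)"
  shows "\<exists>v\<in>char_image B. u = transpose_mat (const_mat T') *\<^sub>v v"
proof -
  define S where "S = const_mat (four_block_mat T (0\<^sub>m k (n - k)) (0\<^sub>m (n - k) k) (1\<^sub>m (n - k)))"
  have S: "S \<in> carrier_mat n n" using T kn by (auto simp: S_def)
  have T't: "transpose_mat (const_mat T') \<in> carrier_mat k k" using T by simp
  have E: "transpose_mat (charmat B) \<in> carrier_mat k n" using B by simp
  obtain y where y: "y \<in> carrier_vec n" "u = transpose_mat (charmat (base_change n k T T' B)) *\<^sub>v y"
    using char_imageE[OF u base_change_carrier[OF B kn T(1,2)]] by blast
  have "transpose_mat (charmat (base_change n k T T' B))
      = transpose_mat (const_mat T') * (transpose_mat (charmat B) * transpose_mat S)"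
    unfolding charmat_base_change[OF B kn T] S_def[symmetric]
    using S B T by (subst transpose_mult[of _ n k _ k], simp, simp, subst transpose_mult[of _ n n _ k]) auto
  then have "u = transpose_mat (const_mat T') *\<^sub>v ((transpose_mat (charmat B) * transpose_mat S) *\<^sub>v y)"
    unfolding y(2) using y(1) E S by (simp only:) (rule assoc_mult_mat_vec[OF T't, of _ n], auto)
  moreover have "(transpose_mat (charmat B) * transpose_mat S) *\<^sub>v y = transpose_mat (charmat B) *\<^sub>v (transpose_mat S *\<^sub>v y)"
    using y E S by (intro assoc_mult_mat_vec[of _ k n _ n]) auto
  moreover have "transpose_mat (charmat B) *\<^sub>v (transpose_mat S *\<^sub>v y) \<in> char_image B"
    using B S y by (intro char_imageI[of _ n k "transpose_mat S *\<^sub>v y"]) (auto intro: mult_mat_vec_carrier[of _ n n])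
  ultimately show ?thesis by auto
qed

lemma transpose_mult_vec_cancel:
  fixes P :: "'a::comm_ring_1 mat"
  assumes "P \<in> carrier_mat k k" "Q \<in> carrier_mat k k" "P * Q = 1\<^sub>m k" "v \<in> carrier_vec k"
  shows "transpose_mat Q *\<^sub>v (transpose_mat P *\<^sub>v v) = v"
proof -
  have "transpose_mat Q * transpose_mat P = 1\<^sub>m k"
    using transpose_mult[OF assms(1,2)] assms(3) by simp
  then show ?thesis
    using assms assoc_mult_mat_vec[of "transpose_mat Q" k k "transpose_mat P" k v] by simp
qed

text \<open>One inclusion is \<open>char_image_base_change_subset\<close>; the other is the same
  lemma for the inverse change of basis.\<close>

lemma char_image_base_change:
  fixes B :: "'a::field_gcd mat"
  assumes B: "B \<in> carrier_mat n k" and kn: "k \<le> n"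
    and T: "T \<in> carrier_mat k k" "T' \<in> carrier_mat k k" "T * T' = 1\<^sub>m k" "T' * T = 1\<^sub>m k"
  shows "char_image (base_change n k T T' B) = (\<lambda>v. transpose_mat (const_mat T') *\<^sub>v v) ` char_image B"
proof (intro equalityI subsetI)
  fix u assume "u \<in> char_image (base_change n k T T' B)"
  then show "u \<in> (\<lambda>v. transpose_mat (const_mat T') *\<^sub>v v) ` char_image B"
    using char_image_base_change_subset[OF B kn T(1-3)] by blast
next
  fix u assume "u \<in> (\<lambda>v. transpose_mat (const_mat T') *\<^sub>v v) ` char_image B"
  then obtain v where v: "v \<in> char_image B" "u = transpose_mat (const_mat T') *\<^sub>v v" by blast
  have bc: "base_change n k T T' B \<in> carrier_mat n k" using base_change_carrier B kn T by blast
  have "v \<in> char_image (base_change n k T' T (base_change n k T T' B))"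
    using v base_change_inverse[OF B kn T] by simp
  then obtain w where w: "w \<in> char_image (base_change n k T T' B)" "v = transpose_mat (const_mat T) *\<^sub>v w"
    using char_image_base_change_subset[OF bc kn T(2,1,4)] by blast
  have "w \<in> carrier_vec k" using w char_image_subset[OF bc] by blast
  moreover have "const_mat T * const_mat T' = 1\<^sub>m k"
    using const_poly_hom.mat_hom_mult[OF T(1,2)] T(3) by (simp add: const_poly_hom.mat_hom_one)
  ultimately have "u = w"
    using v w T transpose_mult_vec_cancel[of "const_mat T" k "const_mat T'" w] by simp
  then show "u \<in> char_image (base_change n k T T' B)" using w by simp
qed

lemma char_image_zero:
  assumes "B \<in> carrier_mat n k"
  shows "0\<^sub>v k \<in> char_image B"
proof -
  have "transpose_mat (charmat B) *\<^sub>v 0\<^sub>v n = 0\<^sub>v k"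
    using assms by (intro eq_vecI) (auto simp: charmat_def)
  then show ?thesis using char_imageI[OF assms, of "0\<^sub>v n"] by simp
qed

section \<open>Matrices in block triangular form\<close>

lemma charmat_four_block:
  assumes "A \<in> carrier_mat d d" "C \<in> carrier_mat d c" "D \<in> carrier_mat m c" "c \<le> m"
  shows "charmat (four_block_mat A C (0\<^sub>m m d) D)
    = four_block_mat (charmat A) (- const_mat C) (0\<^sub>m m d) (charmat D)"
  using assms by (intro eq_matI) (auto simp: charmat_def)

text \<open>On a pair \<open>(y1, y2)\<close> the first component of the image depends on
  \<open>y1\<close> and \<open>A\<close> only, and the second is the contribution of
  \<open>D\<close> to \<open>y2\<close>, shifted by a term in \<open>C\<close> and
  \<open>y1\<close>. If \<open>D\<close> is simple, the second component is arbitrary whatever the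
  shift. Conversely, a vector with first component zero comes from \<open>y1 = 0\<close>, as the
  square part is injective, and the shift vanishes. So \<open>C\<close> has no influence and is free
  in the count.\<close>

lemma lattice_block_iff:
  fixes A :: "'a::field_gcd mat"
  assumes A: "A \<in> carrier_mat d d" and C: "C \<in> carrier_mat d c" and D: "D \<in> carrier_mat m c"
    and cm: "c \<le> m"
    and L1: "char_image A = L1"
    and B: "B = four_block_mat A C (0\<^sub>m m d) D"
  shows "char_image B = {l @\<^sub>v r | l r. l \<in> L1 \<and> r \<in> carrier_vec c} \<longleftrightarrow> char_image D = carrier_vec c"
    (is "_ = ?L \<longleftrightarrow> _")
proof -
  have Bc: "B \<in> carrier_mat (d + m) (d + c)" unfolding B using A D by auto
  have key: "transpose_mat (charmat B) *\<^sub>v (y1 @\<^sub>v y2)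
     = (transpose_mat (charmat A) *\<^sub>v y1) @\<^sub>v
       (- (transpose_mat (const_mat C) *\<^sub>v y1) + transpose_mat (charmat D) *\<^sub>v y2)"
    if y: "y1 \<in> carrier_vec d" "y2 \<in> carrier_vec m" for y1 y2
  proof -
    have c: "transpose_mat (charmat A) \<in> carrier_mat d d" "- transpose_mat (const_mat C) \<in> carrier_mat c d"
       "transpose_mat (charmat D) \<in> carrier_mat c m"
      using A C D by auto
    have t: "transpose_mat (- const_mat C) = - transpose_mat (const_mat C)"
      by (intro eq_matI) auto
    have "transpose_mat (charmat B) = four_block_mat (transpose_mat (charmat A)) (0\<^sub>m d m)
       (- transpose_mat (const_mat C)) (transpose_mat (charmat D))"
      unfolding B charmat_four_block[OF A C D cm] t[symmetric]
      using A C D by (subst transpose_four_block_mat[of _ d d _ c _ m]) auto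
    then have "transpose_mat (charmat B) *\<^sub>v (y1 @\<^sub>v y2)
      = (transpose_mat (charmat A) *\<^sub>v y1 + 0\<^sub>m d m *\<^sub>v y2) @\<^sub>v
       (- transpose_mat (const_mat C) *\<^sub>v y1 + transpose_mat (charmat D) *\<^sub>v y2)"
      using c y by (simp add: four_block_mat_mult_vec[of _ d d _ m _ c])
    moreover have "- transpose_mat (const_mat C) *\<^sub>v y1 = - (transpose_mat (const_mat C) *\<^sub>v y1)"
      using C y by (intro eq_vecI) auto
    moreover have "transpose_mat (charmat A) *\<^sub>v y1 + 0\<^sub>m d m *\<^sub>v y2 = transpose_mat (charmat A) *\<^sub>v y1"
    proof -
      have "0\<^sub>m d m *\<^sub>v y2 = 0\<^sub>v d" using y by (intro eq_vecI) auto
      then show ?thesis using c y by (simp add: right_zero_vec[OF mult_mat_vec_carrier[of _ d d]])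
    qed
    ultimately show ?thesis by simp
  qed
  have Ct: "transpose_mat (const_mat C) *\<^sub>v y \<in> carrier_vec c" if "y \<in> carrier_vec d" for y
    using C that by (intro mult_mat_vec_carrier[of _ c d]) auto
  have Dt: "transpose_mat (charmat D) *\<^sub>v y \<in> carrier_vec c" if "y \<in> carrier_vec m" for y
    using D that by (intro mult_mat_vec_carrier[of _ c m]) auto
  have At: "transpose_mat (charmat A) *\<^sub>v y \<in> carrier_vec d" if "y \<in> carrier_vec d" for y
    using A that by (intro mult_mat_vec_carrier[of _ d d]) auto
  show ?thesis
  proof
    assume im: "char_image B = ?L"
    show "char_image D = carrier_vec c"
    proof (intro equalityI subsetI)
      fix r :: "'a poly vec" assume r: "r \<in> carrier_vec c"
      have "0\<^sub>v d \<in> char_image A" by (rule char_image_zero[OF A])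
      then have "0\<^sub>v d @\<^sub>v r \<in> char_image B" unfolding im using r L1 by blast
      then obtain y where y: "y \<in> carrier_vec (d + m)" "0\<^sub>v d @\<^sub>v r = transpose_mat (charmat B) *\<^sub>v y"
        using char_imageE Bc by blast
      define y1 where "y1 = vec_first y d"
      define y2 where "y2 = vec_last y m"
      have yy: "y1 \<in> carrier_vec d" "y2 \<in> carrier_vec m" "y = y1 @\<^sub>v y2"
        using y by (auto simp: y1_def y2_def)
      have e: "0\<^sub>v d @\<^sub>v r = (transpose_mat (charmat A) *\<^sub>v y1) @\<^sub>v
         (- (transpose_mat (const_mat C) *\<^sub>v y1) + transpose_mat (charmat D) *\<^sub>v y2)"
        using y(2) key[OF yy(1,2)] yy(3) by simp
      have e1: "transpose_mat (charmat A) *\<^sub>v y1 = 0\<^sub>v d"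
        and e2: "r = - (transpose_mat (const_mat C) *\<^sub>v y1) + transpose_mat (charmat D) *\<^sub>v y2"
        using append_vec_eq[of "0\<^sub>v d" d "transpose_mat (charmat A) *\<^sub>v y1"] e At[OF yy(1)] by auto
      have "y1 = 0\<^sub>v d"
        by (rule charmat_mult_vec_const_imp_0[OF A yy(1), of "0\<^sub>v d"]) (use e1 in auto)
      moreover have "transpose_mat (const_mat C) *\<^sub>v 0\<^sub>v d = 0\<^sub>v c"
        using C by (intro eq_vecI) auto
      ultimately have "r = transpose_mat (charmat D) *\<^sub>v y2"
        using e2 Dt[OF yy(2)] by simp
      then show "r \<in> char_image D" using char_imageI[OF D yy(2)] by blast
    qed (use char_image_subset[OF D] in blast)
  next
    assume im: "char_image D = carrier_vec c"
    show "char_image B = ?L"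
    proof (intro equalityI subsetI)
      fix u assume "u \<in> char_image B"
      then obtain y where y: "y \<in> carrier_vec (d + m)" "u = transpose_mat (charmat B) *\<^sub>v y"
        using char_imageE Bc by blast
      define y1 where "y1 = vec_first y d"
      define y2 where "y2 = vec_last y m"
      have yy: "y1 \<in> carrier_vec d" "y2 \<in> carrier_vec m" "y = y1 @\<^sub>v y2"
        using y by (auto simp: y1_def y2_def)
      have "u = (transpose_mat (charmat A) *\<^sub>v y1) @\<^sub>v
         (- (transpose_mat (const_mat C) *\<^sub>v y1) + transpose_mat (charmat D) *\<^sub>v y2)"
        using y(2) key[OF yy(1,2)] yy(3) by simp
      moreover have "transpose_mat (charmat A) *\<^sub>v y1 \<in> L1"
        unfolding L1[symmetric] using char_imageI[OF A yy(1)] by blast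
      moreover have "- (transpose_mat (const_mat C) *\<^sub>v y1) + transpose_mat (charmat D) *\<^sub>v y2 \<in> carrier_vec c"
        using Ct[OF yy(1)] Dt[OF yy(2)] by auto
      ultimately show "u \<in> ?L" by blast
    next
      fix u assume "u \<in> ?L"
      then obtain l r where u: "u = l @\<^sub>v r" "l \<in> char_image A" "r \<in> carrier_vec c"
        using L1 by blast
      obtain y1 where y1: "y1 \<in> carrier_vec d" "l = transpose_mat (charmat A) *\<^sub>v y1"
        using char_imageE[OF u(2) A] by blast
      have "r + transpose_mat (const_mat C) *\<^sub>v y1 \<in> char_image D"
        unfolding im using u(3) Ct[OF y1(1)] by auto
      then obtain y2 where y2: "y2 \<in> carrier_vec m"
          "r + transpose_mat (const_mat C) *\<^sub>v y1 = transpose_mat (charmat D) *\<^sub>v y2"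
        using char_imageE D by blast
      have "- w + (r + w) = r" if "w \<in> carrier_vec c" for w
        using u(3) that by (intro eq_vecI) auto
      then have "- (transpose_mat (const_mat C) *\<^sub>v y1) + (r + transpose_mat (const_mat C) *\<^sub>v y1) = r"
        using Ct[OF y1(1)] by blast
      then have "u = transpose_mat (charmat B) *\<^sub>v (y1 @\<^sub>v y2)"
        unfolding u(1) y1(2) key[OF y1(1) y2(1)] y2(2)[symmetric] by simp
      then show "u \<in> char_image B"
        using char_imageI[OF Bc, of "y1 @\<^sub>v y2"] y1 y2 by auto
    qed
  qed
qed

text \<open>Each row of the characteristic matrix of \<open>B\<close>, cut to its first
  \<open>d\<close> entries, lies in \<open>L1\<close>. For \<open>i < d\<close> its difference from
  the row of the characteristic matrix of \<open>A\<close> is constant; for \<open>i \<ge> d\<close>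
  the cut row itself is constant. Since \<open>L1\<close> contains no constant vector except zero,
  the first \<open>d\<close> columns of \<open>B\<close> are determined.\<close>

lemma lattice_block_form:
  fixes L1 :: "'a::{field_gcd,finite} poly vec set"
  assumes A: "A \<in> carrier_mat d d" and L1: "char_image A = L1"
    and uniq: "\<And>c. c \<in> carrier_vec d \<Longrightarrow> const_vec c \<in> L1 \<Longrightarrow> c = 0\<^sub>v d"
    and diff: "\<And>u v. u \<in> L1 \<Longrightarrow> v \<in> L1 \<Longrightarrow> u - v \<in> L1"
    and c: "d + c = k" and m: "d + m = n" "c \<le> m"
    and B: "B \<in> carrier_mat n k"
    and im: "char_image B = {l @\<^sub>v r | l r. l \<in> L1 \<and> r \<in> carrier_vec c}"
  shows "\<exists>C\<in>carrier_mat d c. \<exists>D\<in>carrier_mat m c. B = four_block_mat A C (0\<^sub>m m d) D"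
proof -
  have kn: "k \<le> n" using c m by simp
  have first: "vec d (\<lambda>j. (if i = j then [:0,1:] else 0) - [:B $$ (i,j):]) \<in> L1" if i: "i < n" for i
  proof -
    have "transpose_mat (charmat B) *\<^sub>v unit_vec n i \<in> char_image B"
      by (rule char_imageI[OF B, of "unit_vec n i"]) auto
    then obtain l r where lr: "transpose_mat (charmat B) *\<^sub>v unit_vec n i = l @\<^sub>v r" "l \<in> L1" "r \<in> carrier_vec c"
      unfolding im by blast
    have lc: "l \<in> carrier_vec d" using lr(2) L1 char_image_subset[OF A] by blast
    have "l $ j = (if i = j then [:0,1:] else 0) - [:B $$ (i,j):]" if j: "j < d" for j
    proof -
      have "l $ j = (l @\<^sub>v r) $ j" using lc j lr(3) by simp
      also have "\<dots> = charmat B $$ (i,j)"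
        unfolding lr(1)[symmetric] using i j c B by (simp add: charmat_def)
      finally show ?thesis using i j c B by (simp add: charmat_def)
    qed
    then have "l = vec d (\<lambda>j. (if i = j then [:0,1:] else 0) - [:B $$ (i,j):])"
      using lc by (intro eq_vecI) auto
    then show ?thesis using lr(2) by simp
  qed
  have zero: "0\<^sub>v d \<in> L1"
    unfolding L1[symmetric] by (rule char_image_zero[OF A])
  have Bij: "B $$ (i,j) = (if i < d then A $$ (i,j) else 0)" if i: "i < n" and j: "j < d" for i j
  proof (cases "i < d")
    case True
    have "transpose_mat (charmat A) *\<^sub>v unit_vec d i \<in> L1"
      unfolding L1[symmetric] by (rule char_imageI[OF A, of "unit_vec d i"]) auto
    then have "transpose_mat (charmat A) *\<^sub>v unit_vec d i
       - vec d (\<lambda>j. (if i = j then [:0,1:] else 0) - [:B $$ (i,j):]) \<in> L1" (is "?u \<in> _")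
      using diff first[OF i] by blast
    moreover have "?u = const_vec (vec d (\<lambda>j. B $$ (i,j) - A $$ (i,j)))"
      using A True by (intro eq_vecI) (auto simp: charmat_def)
    ultimately have "vec d (\<lambda>j. B $$ (i,j) - A $$ (i,j)) = 0\<^sub>v d"
      using uniq by simp
    from arg_cong[OF this, of "\<lambda>v. v $ j"] show ?thesis using j True by simp
  next
    case False
    have "0\<^sub>v d - vec d (\<lambda>j. (if i = j then [:0,1:] else 0) - [:B $$ (i,j):]) \<in> L1" (is "?u \<in> _")
      using diff zero first[OF i] by blast
    moreover have "?u = const_vec (vec d (\<lambda>j. B $$ (i,j)))"
      using False by (intro eq_vecI) auto
    ultimately have "vec d (\<lambda>j. B $$ (i,j)) = 0\<^sub>v d"
      using uniq by simp
    from arg_cong[OF this, of "\<lambda>v. v $ j"] show ?thesis using j False by simp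
  qed
  define C where "C = mat d c (\<lambda>(i,j). B $$ (i, j + d))"
  define D where "D = mat m c (\<lambda>(i,j). B $$ (i + d, j + d))"
  have "B = four_block_mat A C (0\<^sub>m m d) D"
    using A B Bij c m by (intro eq_matI) (auto simp: C_def D_def)
  then show ?thesis by (intro bexI[of _ C] bexI[of _ D]) (auto simp: C_def D_def)
qed

lemma card_block_lattice:
  fixes L1 :: "'a::{field_gcd,finite} poly vec set"
  assumes A: "A \<in> carrier_mat d d" and L1: "char_image A = L1"
    and uniq: "\<And>c. c \<in> carrier_vec d \<Longrightarrow> const_vec c \<in> L1 \<Longrightarrow> c = 0\<^sub>v d"
    and diff: "\<And>u v. u \<in> L1 \<Longrightarrow> v \<in> L1 \<Longrightarrow> u - v \<in> L1"
    and c: "d + c = k" and m: "d + m = n" "c \<le> m"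
  shows "card {B \<in> carrier_mat n k. char_image B = {l @\<^sub>v r | l r. l \<in> L1 \<and> r \<in> carrier_vec c}}
     = CARD('a) ^ (d * c) * simple_count TYPE('a) m c"
proof -
  let ?L = "{l @\<^sub>v r | l r. l \<in> L1 \<and> r \<in> carrier_vec c}"
  let ?S = "{D :: 'a mat. D \<in> carrier_mat m c \<and> char_image D = carrier_vec c}"
  let ?f = "\<lambda>(C,D). four_block_mat A C (0\<^sub>m m d) D"
  have "{B \<in> carrier_mat n k. char_image B = ?L} = ?f ` (carrier_mat d c \<times> ?S)"
  proof (intro equalityI subsetI)
    fix B assume "B \<in> {B \<in> carrier_mat n k. char_image B = ?L}"
    then have B: "B \<in> carrier_mat n k" "char_image B = ?L" by auto
    obtain C D where CD: "C \<in> carrier_mat d c" "D \<in> carrier_mat m c" "B = four_block_mat A C (0\<^sub>m m d) D"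
      using lattice_block_form[OF A L1 uniq diff c m B] by blast
    have "char_image D = carrier_vec c"
      using lattice_block_iff[OF A CD(1,2) m(2) L1 CD(3)] B(2) by blast
    then show "B \<in> ?f ` (carrier_mat d c \<times> ?S)" using CD by auto
  next
    fix B assume "B \<in> ?f ` (carrier_mat d c \<times> ?S)"
    then obtain C D where CD: "C \<in> carrier_mat d c" "D \<in> carrier_mat m c" "char_image D = carrier_vec c"
      "B = four_block_mat A C (0\<^sub>m m d) D" by auto
    have "char_image B = ?L"
      using lattice_block_iff[OF A CD(1,2) m(2) L1 CD(4)] CD(3) by blast
    moreover have "B \<in> carrier_mat n k" using CD A c m by auto
    ultimately show "B \<in> {B \<in> carrier_mat n k. char_image B = ?L}" by blast
  qed
  moreover have "inj_on ?f (carrier_mat d c \<times> ?S)"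
  proof (rule inj_onI, clarify)
    fix C D C' D' :: "'a mat"
    assume CD: "C \<in> carrier_mat d c" "C' \<in> carrier_mat d c" "D \<in> carrier_mat m c" "D' \<in> carrier_mat m c"
      and e: "four_block_mat A C (0\<^sub>m m d) D = four_block_mat A C' (0\<^sub>m m d) D'"
    have "C $$ (i,j) = C' $$ (i,j)" if "i < d" "j < c" for i j
      using arg_cong[OF e, of "\<lambda>X. X $$ (i, d + j)"] CD A that by simp
    moreover have "D $$ (i,j) = D' $$ (i,j)" if "i < m" "j < c" for i j
      using arg_cong[OF e, of "\<lambda>X. X $$ (d + i, d + j)"] CD A that by simp
    ultimately show "C = C' \<and> D = D'"
      using CD by (auto intro!: eq_matI)
  qed
  ultimately have "card {B \<in> carrier_mat n k. char_image B = ?L} = card ((carrier_mat d c :: 'a mat set) \<times> ?S)"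
    using card_image by fastforce
  then show ?thesis
    by (simp add: card_cartesian_product card_carrier_mat simple_count_def)
qed

section \<open>Torsion modules given by their invariant factors\<close>

lemma degree_normalize_poly: "degree (normalize p) = degree (p :: 'a::field_gcd poly)"
proof (cases "p = 0")
  case False
  then show ?thesis
    using dvd_imp_degree_le[of p "normalize p"] dvd_imp_degree_le[of "normalize p" p] by simp
qed simp

lemma lead_coeff_normalize_poly:
  assumes "p \<noteq> (0 :: 'a::field_gcd poly)"
  shows "lead_coeff (normalize p) = 1"
proof -
  have "lead_coeff (normalize p) = normalize (lead_coeff p)"
    by (simp add: degree_normalize_poly coeff_normalize)
  also have "\<dots> = 1" using assms by (simp add: is_unit_normalize dvd_field_iff)
  finally show ?thesis .
qed

lemma normalize_monic:
  assumes "lead_coeff p = (1 :: 'a::field_gcd)"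
  shows "normalize p = p"
  using assms by (simp add: normalize_poly_eq_map_poly)

lemma mod_poly_eq_self_iff:
  fixes p m :: "'a::field_gcd poly"
  assumes "m \<noteq> 0"
  shows "p mod m = p \<longleftrightarrow> (\<forall>i\<ge>degree m. coeff p i = 0)"
proof
  assume p: "p mod m = p"
  then have "p = 0 \<or> degree p < degree m" using degree_mod_less[OF assms, of p] by simp
  then show "\<forall>i\<ge>degree m. coeff p i = 0" by (auto intro: coeff_eq_0)
next
  assume c: "\<forall>i\<ge>degree m. coeff p i = 0"
  show "p mod m = p"
  proof (cases "p = 0")
    case False
    then have "degree p < degree m" using c by (metis leading_coeff_0_iff linorder_not_less)
    then show ?thesis by (rule mod_poly_less)
  qed simp
qed

lemma card_residues:
  fixes m :: "'a::{field_gcd,finite} poly"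
  assumes m: "m \<noteq> 0"
  shows "finite {p. p mod m = p}" "card {p. p mod m = p} = CARD('a) ^ degree m"
proof -
  let ?n = "degree m"
  have bij: "bij_betw (\<lambda>p. vec ?n (coeff p)) {p. p mod m = p} (carrier_vec ?n)"
  proof (rule bij_betwI[where g = "\<lambda>v. \<Sum>i<?n. monom (v $ i) i"])
    have c: "coeff (\<Sum>i<?n. monom (f i) i) j = (if j < ?n then f j else 0)" for f :: "nat \<Rightarrow> 'a" and j
      by (simp add: coeff_sum sum.delta)
    show "(\<lambda>v. \<Sum>i<?n. monom (v $ i) i) \<in> carrier_vec ?n \<rightarrow> {p. p mod m = p}"
      using c by (auto simp: mod_poly_eq_self_iff[OF m])
    show "(\<Sum>i<?n. monom (vec ?n (coeff p) $ i) i) = p" if "p \<in> {p. p mod m = p}" for p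
      using that by (intro poly_eqI) (auto simp: c mod_poly_eq_self_iff[OF m])
    show "vec ?n (coeff (\<Sum>i<?n. monom (v $ i) i)) = v" if "v \<in> carrier_vec ?n" for v :: "'a vec"
      using that by (intro eq_vecI) (auto simp: c)
  qed auto
  show "finite {p. p mod m = p}" using bij_betw_finite[OF bij] finite_carrier_vec by blast
  show "card {p. p mod m = p} = CARD('a) ^ degree m"
    using bij_betw_same_card[OF bij] by (simp add: card_carrier_vec)
qed

text \<open>With \<open>h = gcd g m\<close>, the condition \<open>m dvd g * p\<close> says that
  \<open>p\<close> is a multiple of \<open>m div h\<close>; the cofactors run through the residues
  modulo \<open>h\<close>.\<close>

lemma card_torsion_residues:
  fixes m g :: "'a::{field_gcd,finite} poly"
  assumes m: "m \<noteq> 0"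
  shows "card {p. p mod m = p \<and> m dvd g * p} = CARD('a) ^ degree (gcd g m)"
proof -
  define h where "h = gcd g m"
  define c where "c = m div h"
  have h0: "h \<noteq> 0" using m by (simp add: h_def)
  have mc: "m = c * h" by (simp add: c_def h_def)
  have c0: "c \<noteq> 0" using m mc by auto
  have "bij_betw (\<lambda>t. t * c) {t. t mod h = t} {p. p mod m = p \<and> m dvd g * p}"
  proof (rule bij_betw_imageI)
    show "inj_on (\<lambda>t. t * c) {t. t mod h = t}" using c0 by (auto simp: inj_on_def)
    show "(\<lambda>t. t * c) ` {t. t mod h = t} = {p. p mod m = p \<and> m dvd g * p}"
    proof (intro equalityI subsetI)
      fix p assume "p \<in> (\<lambda>t. t * c) ` {t. t mod h = t}"
      then obtain t where t: "p = t * c" "t mod h = t" by blast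
      have "p mod m = p"
        using t mod_mult_mult1[of c t h] unfolding mc by (simp add: mult.commute)
      moreover have "m dvd g * p"
      proof -
        have "h dvd g" by (simp add: h_def)
        then have "c * h dvd c * (t * g)" by (intro mult_dvd_mono) auto
        then show ?thesis unfolding t mc by (simp add: mult_ac)
      qed
      ultimately show "p \<in> {p. p mod m = p \<and> m dvd g * p}" by simp
    next
      fix p assume "p \<in> {p. p mod m = p \<and> m dvd g * p}"
      then have p: "p mod m = p" "m dvd g * p" by auto
      have "g = (g div h) * h" by (simp add: h_def)
      then have "c * h dvd (g div h * p) * h" using p(2) unfolding mc by (metis mult.assoc mult.commute)
      then have "c dvd g div h * p" using h0 by simp
      moreover have "coprime (g div h) c"
        unfolding c_def h_def using m by (intro div_gcd_coprime) auto
      ultimately have "c dvd p" by (metis coprime_commute coprime_dvd_mult_right_iff)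
      then obtain t where t: "p = t * c" by (metis dvd_def mult.commute)
      have "t mod h = t"
        using p(1) c0 mod_mult_mult1[of c t h] unfolding t mc by (simp add: mult.commute)
      then show "p \<in> (\<lambda>t. t * c) ` {t. t mod h = t}" using t by blast
    qed
  qed
  from bij_betw_same_card[OF this] show ?thesis
    unfolding card_residues(2)[OF h0] by (simp add: h_def)
qed

text \<open>Elements and maps of the module are vectors and matrices over \<open>F[x]\<close>, with
  row \<open>i\<close> taken modulo \<open>ps ! i\<close>; reduction makes representatives unique,
  so that they can be counted. Besides the tuple of invariant factors, the instances are its coprime
  parts, lists of prime powers, and lists with all entries equal to \<open>f\<close>.\<close>

locale factor_list =
  fixes ps :: "'a::{field_gcd,finite} poly list" and k :: nat
  assumes len: "length ps = k" and nz: "i < k \<Longrightarrow> ps ! i \<noteq> 0"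
begin

definition zmod :: "'a poly vec \<Rightarrow> bool" where
  "zmod v \<longleftrightarrow> (\<forall>i<k. ps ! i dvd v $ i)"

definition red :: "'a poly vec \<Rightarrow> 'a poly vec" where
  "red v = vec k (\<lambda>i. v $ i mod ps ! i)"

text \<open>Reduced representatives of the elements of \<open>F[x]/(p_1) + \<dots> + F[x]/(p_k)\<close>.\<close>

definition M :: "'a poly vec set" where
  "M = {w \<in> carrier_vec k. red w = w}"

definition redm :: "'a poly mat \<Rightarrow> 'a poly mat" where
  "redm G = mat k (dim_col G) (\<lambda>(i,j). G $$ (i,j) mod ps ! i)"

definition onto :: "nat \<Rightarrow> 'a poly mat \<Rightarrow> bool" where
  "onto m A \<longleftrightarrow> (\<forall>w\<in>carrier_vec k. \<exists>u\<in>carrier_vec m. zmod (A *\<^sub>v u - w))"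

lemma red_carrier[simp]: "red v \<in> carrier_vec k"
  by (simp add: red_def)

lemma red_in_M[simp]: "red v \<in> M"
  by (auto simp: M_def red_def)

lemma red_eq_iff:
  assumes "u \<in> carrier_vec k" "v \<in> carrier_vec k"
  shows "red u = red v \<longleftrightarrow> zmod (u - v)"
proof -
  have "red u = red v \<longleftrightarrow> (\<forall>i<k. u $ i mod ps ! i = v $ i mod ps ! i)"
    unfolding red_def by (auto simp: vec_eq_iff)
  then show ?thesis using assms by (auto simp: zmod_def mod_eq_dvd_iff)
qed

lemma zmod_add: "u \<in> carrier_vec k \<Longrightarrow> v \<in> carrier_vec k \<Longrightarrow> zmod u \<Longrightarrow> zmod v \<Longrightarrow> zmod (u + v)"
  by (auto simp: zmod_def)

lemma zmod_diff: "u \<in> carrier_vec k \<Longrightarrow> v \<in> carrier_vec k \<Longrightarrow> zmod u \<Longrightarrow> zmod v \<Longrightarrow> zmod (u - v)"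
  by (auto simp: zmod_def)

lemma zmod_minus_commute:
  "u \<in> carrier_vec k \<Longrightarrow> v \<in> carrier_vec k \<Longrightarrow> zmod (u - v) \<Longrightarrow> zmod (v - u)"
  by (auto simp: zmod_def dvd_diff_commute)

lemma zmod_trans:
  assumes c: "u \<in> carrier_vec k" "v \<in> carrier_vec k" "w \<in> carrier_vec k"
    and uv: "zmod (u - v)" and vw: "zmod (v - w)"
  shows "zmod (u - w)"
proof -
  have "zmod ((u - v) + (v - w))" using c uv vw by (intro zmod_add) auto
  also have "(u - v) + (v - w) = u - w" using c by (intro eq_vecI) auto
  finally show ?thesis .
qed

lemma zmod_cong_iff:
  assumes c: "u \<in> carrier_vec k" "v \<in> carrier_vec k" and uv: "zmod (u - v)"
  shows "zmod u \<longleftrightarrow> zmod v"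
proof -
  have "zmod w \<longleftrightarrow> zmod (w - 0\<^sub>v k)" if "w \<in> carrier_vec k" for w
    using that by (simp add: zmod_def)
  moreover have z: "0\<^sub>v k \<in> carrier_vec k" by simp
  ultimately show ?thesis
    using c uv zmod_trans[OF c z] zmod_trans[OF c(2,1) z] zmod_minus_commute[OF c uv] by blast
qed

lemma red_cong: "v \<in> carrier_vec k \<Longrightarrow> zmod (red v - v)"
  by (auto simp: zmod_def red_def simp flip: mod_eq_dvd_iff)

text \<open>The torsion of a direct sum splits into coordinates. It is used with
  \<open>g = 0\<close> for the order of \<open>M\<close>, with arbitrary \<open>g\<close> to recover
  the tuple from the module, and with powers of a prime to count automorphisms.\<close>

lemma card_M_torsion:
  shows "finite M" "card {w \<in> M. zmod (g \<cdot>\<^sub>v w)} = CARD('a) ^ (\<Sum>i<k. degree (gcd g (ps ! i)))"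
proof -
  let ?R = "\<lambda>i. {p. p mod ps ! i = p}"
  have bijM: "bij_betw (\<lambda>v. restrict (\<lambda>i. v $ i) {..<k}) M (PiE {..<k} ?R)"
  proof (rule bij_betwI[where g = "vec k"])
    show "(\<lambda>v. restrict (\<lambda>i. v $ i) {..<k}) \<in> M \<rightarrow> PiE {..<k} ?R"
    proof (intro funcsetI PiE_I)
      fix v i assume v: "v \<in> M" and i: "i \<in> {..<k}"
      then have "red v $ i = v $ i" by (simp add: M_def)
      then show "restrict (\<lambda>i. v $ i) {..<k} i \<in> ?R i" using i by (simp add: red_def)
    qed auto
    show "vec k \<in> PiE {..<k} ?R \<rightarrow> M"
      by (auto simp: M_def red_def vec_eq_iff PiE_iff)
    show "vec k (restrict (\<lambda>i. v $ i) {..<k}) = v" if "v \<in> M" for v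
      using that by (auto simp: M_def intro!: eq_vecI)
    show "restrict (\<lambda>i. vec k f $ i) {..<k} = f" if "f \<in> PiE {..<k} ?R" for f
      using that by (auto simp: fun_eq_iff restrict_def PiE_def extensional_def)
  qed
  have "finite (PiE {..<k} ?R)" using nz card_residues(1) by (intro finite_PiE) auto
  then show fin: "finite M" using bij_betw_finite[OF bijM] by simp
  let ?T = "\<lambda>i. {p. p mod ps ! i = p \<and> ps ! i dvd g * p}"
  have img: "(\<lambda>v. restrict (\<lambda>i. v $ i) {..<k}) ` {w \<in> M. zmod (g \<cdot>\<^sub>v w)} = PiE {..<k} ?T"
  proof (intro equalityI subsetI)
    fix f assume "f \<in> (\<lambda>v. restrict (\<lambda>i. v $ i) {..<k}) ` {w \<in> M. zmod (g \<cdot>\<^sub>v w)}"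
    then obtain w where w: "w \<in> M" "zmod (g \<cdot>\<^sub>v w)" "f = restrict (\<lambda>i. w $ i) {..<k}" by blast
    have "f \<in> PiE {..<k} ?R" using bij_betw_apply[OF bijM w(1)] w(3) by simp
    then show "f \<in> PiE {..<k} ?T" using w by (auto simp: zmod_def M_def PiE_iff)
  next
    fix f assume f: "f \<in> PiE {..<k} ?T"
    then have "f \<in> PiE {..<k} ?R" by (auto simp: PiE_iff)
    then obtain w where w: "w \<in> M" "f = restrict (\<lambda>i. w $ i) {..<k}"
      using bijM unfolding bij_betw_def by (metis (no_types, lifting) imageE)
    moreover have "ps ! i dvd (g \<cdot>\<^sub>v w) $ i" if "i < k" for i
      using f that w by (auto simp: PiE_iff M_def)
    ultimately show "f \<in> (\<lambda>v. restrict (\<lambda>i. v $ i) {..<k}) ` {w \<in> M. zmod (g \<cdot>\<^sub>v w)}"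
      by (auto simp: zmod_def)
  qed
  have "inj_on (\<lambda>v. restrict (\<lambda>i. v $ i) {..<k}) {w \<in> M. zmod (g \<cdot>\<^sub>v w)}"
    using bijM by (auto simp: bij_betw_def intro: inj_on_subset)
  from card_image[OF this] have "card {w \<in> M. zmod (g \<cdot>\<^sub>v w)} = card (PiE {..<k} ?T)"
    unfolding img ..
  also have "\<dots> = (\<Prod>i<k. CARD('a) ^ degree (gcd g (ps ! i)))"
    using nz by (subst card_PiE) (auto simp: card_torsion_residues intro!: prod.cong)
  finally show "card {w \<in> M. zmod (g \<cdot>\<^sub>v w)} = CARD('a) ^ (\<Sum>i<k. degree (gcd g (ps ! i)))"
    by (simp add: power_sum)
qed

lemma card_M: "card M = CARD('a) ^ (\<Sum>i<k. degree (ps ! i))"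
proof -
  have "{w \<in> M. zmod (0 \<cdot>\<^sub>v w)} = M" by (auto simp: zmod_def M_def)
  then show ?thesis using card_M_torsion(2)[of 0] by (simp add: degree_normalize_poly)
qed

lemma kernel_lattice_eq: "A \<in> carrier_mat k m \<Longrightarrow> kernel_lattice ps A = {u \<in> carrier_vec m. zmod (A *\<^sub>v u)}"
  by (auto simp: kernel_lattice_def zmod_def)

lemma redm_carrier: "G \<in> carrier_mat k m \<Longrightarrow> redm G \<in> carrier_mat k m"
  by (simp add: redm_def)

lemma redm_mult_vec_cong:
  assumes G: "G \<in> carrier_mat k m" and v: "v \<in> carrier_vec m"
  shows "zmod (redm G *\<^sub>v v - G *\<^sub>v v)"
  unfolding zmod_def
proof (intro allI impI)
  fix i assume i: "i < k"
  have "(redm G *\<^sub>v v - G *\<^sub>v v) $ i = (\<Sum>j=0..<m. (G $$ (i,j) mod ps ! i - G $$ (i,j)) * v $ j)"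
    using i G v by (simp add: redm_def scalar_prod_def sum_subtractf left_diff_distrib)
  moreover have "ps ! i dvd G $$ (i,j) mod ps ! i - G $$ (i,j)" for j
    by (simp flip: mod_eq_dvd_iff)
  ultimately show "ps ! i dvd (redm G *\<^sub>v v - G *\<^sub>v v) $ i"
    by (auto intro!: dvd_sum)
qed

lemma kernel_lattice_redm:
  assumes G: "G \<in> carrier_mat k m"
  shows "kernel_lattice ps (redm G) = kernel_lattice ps G"
  using kernel_lattice_eq[OF G] kernel_lattice_eq[OF redm_carrier[OF G]] redm_mult_vec_cong[OF G] redm_carrier[OF G] G
    zmod_cong_iff by (smt (verit, best) Collect_cong mult_mat_vec_carrier)

lemma onto_redm:
  assumes G: "G \<in> carrier_mat k m"
  shows "onto m (redm G) \<longleftrightarrow> onto m G"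
proof -
  have "zmod (redm G *\<^sub>v u - w) \<longleftrightarrow> zmod (G *\<^sub>v u - w)" if u: "u \<in> carrier_vec m" and w: "w \<in> carrier_vec k" for u w
  proof -
    have c: "redm G *\<^sub>v u \<in> carrier_vec k" "G *\<^sub>v u \<in> carrier_vec k"
      using G redm_carrier[OF G] u by auto
    show ?thesis
      using zmod_trans[OF c w] zmod_trans[OF c(2,1) w] redm_mult_vec_cong[OF G u]
        zmod_minus_commute[OF c] by blast
  qed
  then show ?thesis by (auto simp: onto_def)
qed

end

section \<open>The module as a vector space over \<open>F\<close>\<close>

lemma mult_mat_vec_const:
  fixes V :: "'a::comm_ring_1 mat"
  assumes "V \<in> carrier_mat d m" "c \<in> carrier_vec m"
  shows "const_mat V *\<^sub>v const_vec c = const_vec (V *\<^sub>v c)"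
  using const_poly_hom.mult_mat_vec_hom[OF assms] by simp

text \<open>The coefficients are constants: these are \<open>F\<close>-linear combinations of the
  columns of \<open>W\<close>, not \<open>F[x]\<close>-linear ones.\<close>

definition comb :: "'a::comm_ring_1 poly mat \<Rightarrow> 'a vec \<Rightarrow> 'a poly vec" where
  "comb W c = W *\<^sub>v const_vec c"

lemma comb_carrier: "W \<in> carrier_mat k m \<Longrightarrow> comb W c \<in> carrier_vec k"
  unfolding comb_def by (rule carrier_vecI) simp

lemma dim_comb[simp]: "dim_vec (comb W c) = dim_row W"
  by (simp add: comb_def)

lemma comb_index:
  assumes "W \<in> carrier_mat k m" "c \<in> carrier_vec m" "i < k"
  shows "comb W c $ i = (\<Sum>j<m. W $$ (i,j) * [:c $ j:])"
  using assms by (simp add: comb_def scalar_prod_def lessThan_atLeast0)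

lemma comb_diff:
  assumes "W \<in> carrier_mat k m" "c \<in> carrier_vec m" "c' \<in> carrier_vec m"
  shows "comb W (c - c') = comb W c - comb W c'"
proof (rule eq_vecI)
  fix i assume "i < dim_vec (comb W c - comb W c')"
  then have i: "i < k" using assms by (simp add: comb_def)
  have "comb W (c - c') $ i = (\<Sum>j<m. W $$ (i,j) * [:c $ j:] - W $$ (i,j) * [:c' $ j:])"
    using assms i by (subst comb_index[of _ k m]) (auto simp: smult_diff_left intro!: sum.cong)
  then show "comb W (c - c') $ i = (comb W c - comb W c') $ i"
    using assms i comb_index[of W k m] comb_carrier[of W k m] by (simp add: sum_subtractf)
qed (use assms in \<open>simp add: comb_def\<close>)

lemma comb_smult:
  assumes "W \<in> carrier_mat k m" "c \<in> carrier_vec m"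
  shows "comb W (a \<cdot>\<^sub>v c) = [:a:] \<cdot>\<^sub>v comb W c"
proof (rule eq_vecI)
  fix i assume "i < dim_vec ([:a:] \<cdot>\<^sub>v comb W c)"
  then have i: "i < k" using assms by (simp add: comb_def)
  have "comb W (a \<cdot>\<^sub>v c) $ i = (\<Sum>j<m. [:a:] * (W $$ (i,j) * [:c $ j:]))"
    using assms i by (subst comb_index[of _ k m]) (auto intro!: sum.cong simp: mult.commute)
  then show "comb W (a \<cdot>\<^sub>v c) $ i = ([:a:] \<cdot>\<^sub>v comb W c) $ i"
    using assms i comb_index[of W k m] comb_carrier[of W k m] by (simp only: sum_distrib_left[symmetric]) (auto simp: comb_def)
qed (use assms in \<open>simp add: comb_def\<close>)

lemma mult_mat_unit_vec:
  fixes A :: "'b::comm_ring_1 mat"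
  assumes "A \<in> carrier_mat n m" "j < m"
  shows "A *\<^sub>v unit_vec m j = col A j"
  using assms by (intro eq_vecI) auto

lemma mult_mat_vec_smult:
  fixes A :: "'b::comm_ring_1 mat"
  assumes "A \<in> carrier_mat n m" "v \<in> carrier_vec m"
  shows "A *\<^sub>v (a \<cdot>\<^sub>v v) = a \<cdot>\<^sub>v (A *\<^sub>v v)"
  using assms by (intro eq_vecI) auto

lemma const_unit_vec: "const_vec (unit_vec m j) = unit_vec m j"
  by (intro eq_vecI) (auto simp: unit_vec_def)

context factor_list
begin

definition dg :: nat where "dg = (\<Sum>i<k. degree (ps ! i))"

text \<open>The columns form a basis of \<open>M\<close> over \<open>F\<close>; bijectivity onto the
  reduced vectors expresses independence and spanning at once.\<close>

definition basis :: "'a poly mat \<Rightarrow> bool" where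
  "basis W \<longleftrightarrow> W \<in> carrier_mat k dg \<and> bij_betw (comb W) (carrier_vec dg) M"

lemma zmod_smult:
  assumes v: "v \<in> carrier_vec k" and z: "zmod v"
  shows "zmod (g \<cdot>\<^sub>v v)"
  unfolding zmod_def
proof (intro allI impI)
  fix i assume i: "i < k"
  then have "(g \<cdot>\<^sub>v v) $ i = g * v $ i" using v by simp
  then show "ps ! i dvd (g \<cdot>\<^sub>v v) $ i" using z i by (simp add: zmod_def)
qed

lemma M_iff: "w \<in> M \<longleftrightarrow> w \<in> carrier_vec k \<and> (\<forall>i<k. w $ i mod ps ! i = w $ i)"
  unfolding M_def red_def vec_eq_iff by auto

lemma M_add: "u \<in> M \<Longrightarrow> v \<in> M \<Longrightarrow> u + v \<in> M"
  by (auto simp: M_iff poly_mod_add_left)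

lemma M_smult: "u \<in> M \<Longrightarrow> [:a:] \<cdot>\<^sub>v u \<in> M"
  by (auto simp: M_iff mod_smult_left)

lemma M_eqI: "u \<in> M \<Longrightarrow> v \<in> M \<Longrightarrow> zmod (u - v) \<Longrightarrow> u = v"
  using red_eq_iff[of u v] by (auto simp: M_def)

text \<open>As long as \<open>m < dg\<close>, the \<open>q^m\<close> combinations cannot exhaust the
  \<open>q^dg\<close> elements of \<open>M\<close>, and any reduced vector outside them can be
  appended as a new column.\<close>

lemma ex_partial_basis:
  "m \<le> dg \<Longrightarrow> \<exists>W\<in>carrier_mat k m. inj_on (comb W) (carrier_vec m) \<and> comb W ` carrier_vec m \<subseteq> M"
proof (induction m)
  case 0
  have "comb (0\<^sub>m k 0) c = 0\<^sub>v k" if "c \<in> carrier_vec 0" for c :: "'a vec"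
    using that by (intro eq_vecI) (auto simp: comb_def scalar_prod_def)
  moreover have "0\<^sub>v k \<in> M" by (auto simp: M_iff)
  moreover have "inj_on (comb (0\<^sub>m k 0)) (carrier_vec 0 :: 'a vec set)"
    by (intro inj_onI eq_vecI) auto
  ultimately show ?case by (intro bexI[of _ "0\<^sub>m k 0"]) auto
next
  case (Suc m)
  then obtain W where W: "W \<in> carrier_mat k m" "inj_on (comb W) (carrier_vec m)" "comb W ` carrier_vec m \<subseteq> M"
    by auto
  have q: "1 < CARD('a)" by (rule card_UNIV_gt_1)
  have "card (comb W ` carrier_vec m) = CARD('a) ^ m"
    using card_image[OF W(2)] by (simp add: card_carrier_vec)
  also have "\<dots> < card M"
    unfolding card_M using Suc.prems q by (intro power_strict_increasing) (auto simp: dg_def)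
  finally have "comb W ` carrier_vec m \<noteq> M" by auto
  then obtain w where w: "w \<in> M" "w \<notin> comb W ` carrier_vec m" using W(3) by blast
  have wc: "w \<in> carrier_vec k" using w by (simp add: M_def)
  define W' where "W' = mat k (Suc m) (\<lambda>(i,j). if j < m then W $$ (i,j) else w $ i)"
  have W'c: "W' \<in> carrier_mat k (Suc m)" by (simp add: W'_def)
  have split: "comb W' c = comb W (vec_first c m) + [:c $ m:] \<cdot>\<^sub>v w" if c: "c \<in> carrier_vec (Suc m)" for c
  proof (rule eq_vecI)
    fix i assume "i < dim_vec (comb W (vec_first c m) + [:c $ m:] \<cdot>\<^sub>v w)"
    then have i: "i < k" using wc by simp
    have "comb W' c $ i = (\<Sum>j<Suc m. W' $$ (i,j) * [:c $ j:])"
      by (rule comb_index[OF W'c c i])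
    also have "\<dots> = (\<Sum>j<m. W $$ (i,j) * [:c $ j:]) + w $ i * [:c $ m:]"
      using i by (simp add: W'_def)
    also have "\<dots> = comb W (vec_first c m) $ i + w $ i * [:c $ m:]"
      using comb_index[OF W(1), of "vec_first c m" i] i by (simp add: vec_first_def)
    finally show "comb W' c $ i = (comb W (vec_first c m) + [:c $ m:] \<cdot>\<^sub>v w) $ i"
      using i wc comb_carrier[OF W(1)] by (simp add: mult.commute)
  qed (use W'c wc in \<open>simp add: comb_def\<close>)
  have "comb W' ` carrier_vec (Suc m) \<subseteq> M"
    using split W(3) w(1) M_add M_smult by (auto simp: image_subset_iff)
  moreover have "inj_on (comb W') (carrier_vec (Suc m))"
  proof (rule inj_onI)
    fix c c' assume c: "c \<in> carrier_vec (Suc m)" "c' \<in> carrier_vec (Suc m)" and e: "comb W' c = comb W' c'"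
    let ?a = "c $ m - c' $ m"
    let ?f = "vec_first c m" and ?f' = "vec_first c' m"
    have f: "?f \<in> carrier_vec m" "?f' \<in> carrier_vec m" by auto
    have e': "comb W ?f + [:c $ m:] \<cdot>\<^sub>v w = comb W ?f' + [:c' $ m:] \<cdot>\<^sub>v w"
      using e split c by simp
    have e2: "[:?a:] * w $ i = comb W ?f' $ i - comb W ?f $ i" if "i < k" for i
    proof -
      have "comb W ?f $ i + [:c $ m:] * w $ i = comb W ?f' $ i + [:c' $ m:] * w $ i"
        using arg_cong[OF e', of "\<lambda>v. v $ i"] that wc comb_carrier[OF W(1)] by simp
      moreover have "[:?a:] * w $ i = [:c $ m:] * w $ i - [:c' $ m:] * w $ i"
        by (simp add: smult_diff_left)
      moreover have "D = Y - X" if "X + C = Y + C'" "D = C - C'" for X Y C C' D :: "'a poly"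
        using that by (auto simp: algebra_simps)
      ultimately show ?thesis by blast
    qed
    have "?a = 0"
    proof (rule ccontr)
      assume a: "?a \<noteq> 0"
      have "w = comb W (inverse ?a \<cdot>\<^sub>v (?f' - ?f))"
      proof (rule eq_vecI)
        fix i assume "i < dim_vec (comb W (inverse ?a \<cdot>\<^sub>v (?f' - ?f)))"
        then have i: "i < k" using W by (simp add: comb_def)
        have "comb W (inverse ?a \<cdot>\<^sub>v (?f' - ?f)) $ i = [:inverse ?a:] * (comb W ?f' $ i - comb W ?f $ i)"
          using W(1) f i comb_carrier[OF W(1)] by (subst comb_smult[OF W(1)]) (auto simp: comb_diff[OF W(1)])
        also have "\<dots> = [:inverse ?a:] * [:?a:] * w $ i" by (simp only: e2[OF i] mult.assoc)
        also have "\<dots> = w $ i" using a by simp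
        finally show "w $ i = comb W (inverse ?a \<cdot>\<^sub>v (?f' - ?f)) $ i" ..
      qed (use wc W in \<open>simp add: comb_def\<close>)
      moreover have "inverse ?a \<cdot>\<^sub>v (?f' - ?f) \<in> carrier_vec m" using f by auto
      ultimately have "w \<in> comb W ` carrier_vec m" by (rule image_eqI)
      then show False using w(2) by contradiction
    qed
    moreover from this have "comb W ?f = comb W ?f'"
      using e2 W(1) by (intro eq_vecI) auto
    then have "?f = ?f'" using W(2) f by (auto dest: inj_onD)
    ultimately show "c = c'"
    proof (intro eq_vecI)
      fix i assume "i < dim_vec c'"
      then consider "i < m" | "i = m" using c by force
      then show "c $ i = c' $ i"
        using \<open>?f = ?f'\<close> \<open>?a = 0\<close> by cases (auto simp: vec_first_def vec_eq_iff)
    qed (use c in auto)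
  qed
  ultimately show ?case using W'c by blast
qed

lemma ex_basis: "\<exists>W. basis W"
proof -
  obtain W where W: "W \<in> carrier_mat k dg" "inj_on (comb W) (carrier_vec dg)" "comb W ` carrier_vec dg \<subseteq> M"
    using ex_partial_basis[of dg] by blast
  have "card (comb W ` carrier_vec dg) = card M"
    using card_image[OF W(2)] by (simp add: card_carrier_vec card_M dg_def)
  then have "comb W ` carrier_vec dg = M"
    using card_subset_eq[OF card_M_torsion(1) W(3)] by simp
  then show ?thesis using W by (auto simp: basis_def bij_betw_def)
qed

lemma comb_mult:
  assumes W: "W \<in> carrier_mat k d" and V: "V \<in> carrier_mat d m" and c: "c \<in> carrier_vec m"
  shows "(W * const_mat V) *\<^sub>v const_vec c = comb W (V *\<^sub>v c)"
  using assms by (simp add: comb_def assoc_mult_mat_vec[of _ k d _ m] mult_mat_vec_const)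

lemma basis_mult_col:
  assumes W: "basis W" and V: "V \<in> carrier_mat dg m" and j: "j < m"
  shows "col (W * const_mat V) j = comb W (col V j)"
proof -
  have Wc: "W \<in> carrier_mat k dg" using W by (simp add: basis_def)
  have X: "W * const_mat V \<in> carrier_mat k m" using Wc V by simp
  have "col (W * const_mat V) j = (W * const_mat V) *\<^sub>v unit_vec m j"
    using mult_mat_unit_vec[OF X j] by simp
  also have "\<dots> = comb W (V *\<^sub>v unit_vec m j)"
    using comb_mult[OF Wc V, of "unit_vec m j"] by (simp add: const_unit_vec)
  also have "V *\<^sub>v unit_vec m j = col V j" using mult_mat_unit_vec[OF V j] by simp
  finally show ?thesis .
qed

lemma const_vec_in_lattice_basis:
  assumes W: "basis W" and c: "c \<in> carrier_vec dg" and l: "const_vec c \<in> kernel_lattice ps W"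
  shows "c = 0\<^sub>v dg"
proof -
  have Wc: "W \<in> carrier_mat k dg" using W by (simp add: basis_def)
  have "comb W (0\<^sub>v dg) = 0\<^sub>v k" using Wc by (intro eq_vecI) (auto simp: comb_def scalar_prod_def)
  moreover have "zmod (comb W c)" using l unfolding kernel_lattice_eq[OF Wc] by (simp add: comb_def)
  moreover have M: "comb W c \<in> M" "comb W (0\<^sub>v dg) \<in> M" using W c by (auto simp: basis_def bij_betw_def)
  moreover have "zmod (comb W c - 0\<^sub>v k)"
    using \<open>zmod (comb W c)\<close> M(1) by (auto simp: zmod_def M_def)
  ultimately have "comb W c = comb W (0\<^sub>v dg)" using M_eqI by simp
  then show ?thesis using W c by (auto simp: basis_def bij_betw_def dest!: inj_onD)
qed

lemma redm_eq_self_iff: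
  assumes A: "A \<in> carrier_mat k m"
  shows "redm A = A \<longleftrightarrow> (\<forall>j<m. col A j \<in> M)"
  using A by (auto simp: redm_def M_def red_def mat_eq_iff vec_eq_iff)

lemma redm_basis_mult:
  assumes W: "basis W" and V: "V \<in> carrier_mat dg m"
  shows "redm (W * const_mat V) = W * const_mat V"
proof -
  have "W * const_mat V \<in> carrier_mat k m" using W V by (auto simp: basis_def)
  moreover have "comb W (col V j) \<in> M" for j
  proof -
    have "col V j \<in> carrier_vec dg" using V by (intro carrier_vecI) simp
    then show ?thesis using W by (auto simp: basis_def bij_betw_def)
  qed
  ultimately show ?thesis using basis_mult_col[OF W V] redm_eq_self_iff by simp
qed

lemma onto_basis_mult:
  assumes W: "basis W" and V: "V \<in> surj_mats dg m"
  shows "onto m (W * const_mat V)"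
  unfolding onto_def
proof
  fix w :: "'a poly vec" assume w: "w \<in> carrier_vec k"
  obtain S where Vc: "V \<in> carrier_mat dg m" and S: "S \<in> carrier_mat m dg" "V * S = 1\<^sub>m dg"
    using V by (auto simp: surj_mats_def)
  have Wc: "W \<in> carrier_mat k dg" using W by (simp add: basis_def)
  obtain c where c: "c \<in> carrier_vec dg" "comb W c = red w"
    using W red_in_M[of w] unfolding basis_def bij_betw_def by (metis imageE)
  have Sc: "S *\<^sub>v c \<in> carrier_vec m" using S c by auto
  have "V *\<^sub>v (S *\<^sub>v c) = c"
    using assoc_mult_mat_vec[OF Vc S(1) c(1)] S(2) c(1) by simp
  then have "(W * const_mat V) *\<^sub>v const_vec (S *\<^sub>v c) = red w"
    using comb_mult[OF Wc Vc Sc] c by simp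
  then show "\<exists>u\<in>carrier_vec m. zmod (W * const_mat V *\<^sub>v u - w)"
    using Sc red_cong[OF w] by (intro bexI[of _ "const_vec (S *\<^sub>v c)"]) auto
qed

lemma inj_on_basis_mult:
  assumes W: "basis W"
  shows "inj_on (\<lambda>V. W * const_mat V) (carrier_mat dg m)"
proof (rule inj_onI)
  fix V V' assume V: "V \<in> carrier_mat dg m" "V' \<in> carrier_mat dg m" and e: "W * const_mat V = W * const_mat V'"
  have "col V j = col V' j" if j: "j < m" for j
  proof -
    have "comb W (col V j) = comb W (col V' j)"
      using basis_mult_col[OF W V(1) j] basis_mult_col[OF W V(2) j] e by simp
    moreover have "col V j \<in> carrier_vec dg" "col V' j \<in> carrier_vec dg"
      using V by (auto intro!: carrier_vecI)
    ultimately show ?thesis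
      using W by (auto simp: basis_def bij_betw_def dest!: inj_onD)
  qed
  then show "V = V'" using V by (intro mat_col_eqI) auto
qed

text \<open>The constant coordinates of the columns of \<open>A\<close> in the basis give
  \<open>V\<close>. That \<open>A\<close> is onto only provides polynomial preimages; because its
  kernel is the image of a characteristic matrix, they can be replaced by constant ones, and the
  constant preimages of the basis vectors form a right inverse of \<open>V\<close>.\<close>

lemma lattice_eq_char_image_imp_basis_mult:
  assumes W: "basis W" and A: "A \<in> carrier_mat k k" "redm A = A" "onto k A"
    and B: "B \<in> carrier_mat n k" "k \<le> n" and L: "kernel_lattice ps A = char_image B"
  shows "\<exists>V\<in>surj_mats dg k. A = W * const_mat V"
proof -
  have Wc: "W \<in> carrier_mat k dg" and bij: "bij_betw (comb W) (carrier_vec dg) M" using W by (auto simp: basis_def)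
  have "\<forall>j. \<exists>v. j < k \<longrightarrow> v \<in> carrier_vec dg \<and> comb W v = col A j"
    using redm_eq_self_iff[OF A(1)] A(2) bij unfolding bij_betw_def by (metis (no_types, lifting) imageE)
  then obtain v where v: "\<And>j. j < k \<Longrightarrow> v j \<in> carrier_vec dg" "\<And>j. j < k \<Longrightarrow> comb W (v j) = col A j" by metis
  define V where "V = mat dg k (\<lambda>(i,j). v j $ i)"
  have Vc: "V \<in> carrier_mat dg k" by (simp add: V_def)
  have colV: "col V j = v j" if "j < k" for j using v(1)[OF that] that by (auto simp: V_def intro!: eq_vecI)
  have AV: "A = W * const_mat V"
  proof (rule mat_col_eqI)
    fix j assume "j < dim_col (W * const_mat V)"
    then have j: "j < k" by (simp add: V_def)
    then show "col A j = col (W * const_mat V) j"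
      using basis_mult_col[OF W Vc j] colV v by simp
  qed (use A Wc Vc in auto)
  have "\<forall>i. \<exists>c. i < dg \<longrightarrow> c \<in> carrier_vec k \<and> V *\<^sub>v c = unit_vec dg i"
  proof (intro allI)
    fix i
    let ?w = "comb W (unit_vec dg i)"
    have wM: "?w \<in> M" using bij by (auto simp: bij_betw_def)
    have wc: "?w \<in> carrier_vec k" using comb_carrier[OF Wc] .
    obtain u where u: "u \<in> carrier_vec k" "zmod (A *\<^sub>v u - ?w)"
      using A(3) wc by (auto simp: onto_def)
    obtain c where c: "c \<in> carrier_vec k" "u - const_vec c \<in> char_image B"
      using char_image_const_decomp[OF B u(1)] by blast
    have Au: "A *\<^sub>v u \<in> carrier_vec k" "A *\<^sub>v const_vec c \<in> carrier_vec k" using A u c by auto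
    have "zmod (A *\<^sub>v (u - const_vec c))" using c(2) L kernel_lattice_eq[OF A(1)] by auto
    then have "zmod (A *\<^sub>v u - A *\<^sub>v const_vec c)"
      using A(1) u c by (simp add: mult_minus_distrib_mat_vec[of _ k k])
    then have z: "zmod (A *\<^sub>v const_vec c - ?w)"
      using zmod_minus_commute[OF Au] zmod_trans[OF Au(2,1) wc] u(2) by blast
    have Ac: "A *\<^sub>v const_vec c = comb W (V *\<^sub>v c)"
      unfolding AV by (rule comb_mult[OF Wc Vc c(1)])
    have Vcc: "V *\<^sub>v c \<in> carrier_vec dg" using Vc c by auto
    then have "comb W (V *\<^sub>v c) \<in> M" using bij by (auto simp: bij_betw_def)
    then have "comb W (V *\<^sub>v c) = ?w" using z wM M_eqI unfolding Ac by blast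
    then have "V *\<^sub>v c = unit_vec dg i"
      using bij Vcc by (auto simp: bij_betw_def dest!: inj_onD)
    then show "\<exists>c. i < dg \<longrightarrow> c \<in> carrier_vec k \<and> V *\<^sub>v c = unit_vec dg i" using c by blast
  qed
  then obtain c where c: "\<And>i. i < dg \<Longrightarrow> c i \<in> carrier_vec k" "\<And>i. i < dg \<Longrightarrow> V *\<^sub>v c i = unit_vec dg i" by metis
  define S where "S = mat k dg (\<lambda>(j,i). c i $ j)"
  have Sc: "S \<in> carrier_mat k dg" by (simp add: S_def)
  have "V * S = 1\<^sub>m dg"
  proof (rule mat_col_eqI)
    fix i assume "i < dim_col (1\<^sub>m dg :: 'a mat)"
    then have i: "i < dg" by simp
    have "col S i = c i" using c(1)[OF i] i by (auto simp: S_def)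
    then show "col (V * S) i = col (1\<^sub>m dg) i"
      using col_mult2[OF Vc Sc i] c(2)[OF i] i by simp
  qed (use Vc Sc in auto)
  then have "V \<in> surj_mats dg k" using Vc Sc by (auto simp: surj_mats_def)
  then show ?thesis using AV by blast
qed

end

section \<open>Automorphisms of the module and presentations with a given kernel\<close>

context factor_list
begin

text \<open>Reduced matrices of the automorphisms of \<open>M\<close>: the implication from right to left says that the
  matrix acts on \<open>M\<close>, the other one that the action is injective.\<close>

definition aut_mats :: "'a poly mat set" where
  "aut_mats = {G \<in> carrier_mat k k. redm G = G \<and> (\<forall>v\<in>carrier_vec k. zmod (G *\<^sub>v v) \<longleftrightarrow> zmod v)}"

text \<open>Reduced matrices of the surjections from \<open>F[x]^k\<close> to \<open>M\<close> with kernel \<open>L\<close>.\<close>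

definition presentations :: "'a poly vec set \<Rightarrow> 'a poly mat set" where
  "presentations L = {A \<in> carrier_mat k k. redm A = A \<and> onto k A \<and> kernel_lattice ps A = L}"

lemma aut_mats_cong:
  assumes G: "G \<in> aut_mats" and u: "u \<in> carrier_vec k" "v \<in> carrier_vec k"
  shows "zmod (G *\<^sub>v u - G *\<^sub>v v) \<longleftrightarrow> zmod (u - v)"
proof -
  have Gc: "G \<in> carrier_mat k k" using G by (simp add: aut_mats_def)
  have "G *\<^sub>v u - G *\<^sub>v v = G *\<^sub>v (u - v)"
    using mult_minus_distrib_mat_vec[OF Gc u] by simp
  then show ?thesis using G u by (simp add: aut_mats_def)
qed

text \<open>An injective map of the finite set \<open>M\<close> into itself is surjective.\<close>

lemma aut_mats_onto:
  assumes G: "G \<in> aut_mats"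
  shows "onto k G"
proof -
  have Gc: "G \<in> carrier_mat k k" using G by (simp add: aut_mats_def)
  have "inj_on (\<lambda>w. red (G *\<^sub>v w)) M"
  proof (rule inj_onI)
    fix u v assume uv: "u \<in> M" "v \<in> M" and e: "red (G *\<^sub>v u) = red (G *\<^sub>v v)"
    have c: "u \<in> carrier_vec k" "v \<in> carrier_vec k" using uv by (auto simp: M_def)
    have "zmod (G *\<^sub>v u - G *\<^sub>v v)" using e red_eq_iff Gc c by auto
    then show "u = v" using aut_mats_cong[OF G c] M_eqI uv by blast
  qed
  then have surj: "(\<lambda>w. red (G *\<^sub>v w)) ` M = M"
    using card_M_torsion(1) by (intro endo_inj_surj) auto
  show ?thesis
    unfolding onto_def
  proof
    fix w :: "'a poly vec" assume w: "w \<in> carrier_vec k"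
    have "red w \<in> (\<lambda>w. red (G *\<^sub>v w)) ` M" unfolding surj by simp
    then obtain u where u: "u \<in> M" "red w = red (G *\<^sub>v u)" by blast
    then have "u \<in> carrier_vec k" by (simp add: M_def)
    moreover from this have "zmod (G *\<^sub>v u - w)" using u(2)[symmetric] red_eq_iff Gc w by auto
    ultimately show "\<exists>u\<in>carrier_vec k. zmod (G *\<^sub>v u - w)" by blast
  qed
qed

lemma aut_mats_mult_presentations:
  assumes G: "G \<in> aut_mats" and A: "A \<in> presentations L"
  shows "redm (G * A) \<in> presentations L"
proof -
  have Gc: "G \<in> carrier_mat k k" using G by (simp add: aut_mats_def)
  have Ac: "A \<in> carrier_mat k k" "onto k A" "kernel_lattice ps A = L" using A by (auto simp: presentations_def)
  have GA: "G * A \<in> carrier_mat k k" using Gc Ac by simp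
  have ass: "(G * A) *\<^sub>v u = G *\<^sub>v (A *\<^sub>v u)" if "u \<in> carrier_vec k" for u
    using assoc_mult_mat_vec[OF Gc Ac(1) that] .
  have Au: "A *\<^sub>v u \<in> carrier_vec k" "G *\<^sub>v u \<in> carrier_vec k" if "u \<in> carrier_vec k" for u
    using Ac Gc that by auto
  have "kernel_lattice ps (G * A) = L"
  proof -
    have "zmod ((G * A) *\<^sub>v u) \<longleftrightarrow> zmod (A *\<^sub>v u)" if u: "u \<in> carrier_vec k" for u
      using G Au(1)[OF u] unfolding ass[OF u] by (simp add: aut_mats_def)
    then show ?thesis
      unfolding Ac(3)[symmetric] kernel_lattice_eq[OF Ac(1)] kernel_lattice_eq[OF GA] by blast
  qed
  moreover have "onto k (G * A)"
    unfolding onto_def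
  proof
    fix w :: "'a poly vec" assume w: "w \<in> carrier_vec k"
    obtain v where v: "v \<in> carrier_vec k" "zmod (G *\<^sub>v v - w)"
      using aut_mats_onto[OF G] w by (auto simp: onto_def)
    obtain u where u: "u \<in> carrier_vec k" "zmod (A *\<^sub>v u - v)"
      using Ac(2) v by (auto simp: onto_def)
    have "zmod (G *\<^sub>v (A *\<^sub>v u) - G *\<^sub>v v)" using aut_mats_cong[OF G Au(1)[OF u(1)] v(1)] u by simp
    then have "zmod (G *\<^sub>v (A *\<^sub>v u) - w)"
      using zmod_trans[OF Au(2)[OF Au(1)[OF u(1)]] Au(2)[OF v(1)] w] v(2) by blast
    then show "\<exists>u\<in>carrier_vec k. zmod (G * A *\<^sub>v u - w)" using u ass by auto
  qed
  moreover have "redm (redm (G * A)) = redm (G * A)"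
    using GA by (intro eq_matI) (auto simp: redm_def)
  ultimately show ?thesis
    using redm_carrier[OF GA] kernel_lattice_redm[OF GA] onto_redm[OF GA] by (simp add: presentations_def)
qed

lemma redm_eq_iff:
  assumes "G \<in> carrier_mat k m" "H \<in> carrier_mat k m"
  shows "redm G = redm H \<longleftrightarrow> (\<forall>u\<in>carrier_vec m. zmod (G *\<^sub>v u - H *\<^sub>v u))"
proof
  assume e: "redm G = redm H"
  show "\<forall>u\<in>carrier_vec m. zmod (G *\<^sub>v u - H *\<^sub>v u)"
  proof
    fix u :: "'a poly vec" assume u: "u \<in> carrier_vec m"
    have c: "G *\<^sub>v u \<in> carrier_vec k" "H *\<^sub>v u \<in> carrier_vec k" "redm H *\<^sub>v u \<in> carrier_vec k"
      using assms u redm_carrier[of H m] by auto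
    show "zmod (G *\<^sub>v u - H *\<^sub>v u)"
      using zmod_trans[OF c(1) c(3) c(2)] redm_mult_vec_cong[OF assms(1) u] redm_mult_vec_cong[OF assms(2) u]
        zmod_minus_commute[OF c(3) c(1)] e by simp
  qed
next
  assume z: "\<forall>u\<in>carrier_vec m. zmod (G *\<^sub>v u - H *\<^sub>v u)"
  have "G $$ (i,j) mod ps ! i = H $$ (i,j) mod ps ! i" if "i < k" "j < m" for i j
    using z[rule_format, of "unit_vec m j"] assms that by (auto simp: zmod_def mod_eq_dvd_iff)
  then show "redm G = redm H" using assms unfolding redm_def by (intro eq_matI) auto
qed

text \<open>Sending \<open>G\<close> to \<open>G * A0\<close> and \<open>A\<close> to
  \<open>A * U\<close>, each followed by reduction, gives inverse bijections, where \<open>U\<close>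
  is a right inverse of \<open>A0\<close> up to congruence.\<close>

lemma card_presentations:
  assumes A0: "A0 \<in> presentations L"
  shows "card (presentations L) = card aut_mats"
proof -
  have A0c: "A0 \<in> carrier_mat k k" "redm A0 = A0" "onto k A0" and L: "L = kernel_lattice ps A0"
    using A0 by (auto simp: presentations_def)
  have "\<forall>j. \<exists>u. u \<in> carrier_vec k \<and> zmod (A0 *\<^sub>v u - unit_vec k j)"
    using A0c(3) unfolding onto_def by (metis unit_vec_carrier)
  then obtain u where u: "\<And>j. u j \<in> carrier_vec k" "\<And>j. zmod (A0 *\<^sub>v u j - unit_vec k j)" by metis
  \<comment> \<open>The columns of \<open>U\<close> are preimages of the unit vectors, so
    \<open>A0 * U\<close> acts as the identity on \<open>M\<close>. The product
    \<open>U * A0\<close> differs from the identity only by elements of \<open>L\<close>, which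
    every presentation with kernel \<open>L\<close> annihilates; this is \<open>AUA0\<close>
    below.\<close>
  define U where "U = mat k k (\<lambda>(i,j). u j $ i)"
  have Uc: "U \<in> carrier_mat k k" by (simp add: U_def)
  have colU: "col U j = u j" if "j < k" for j using u(1)[of j] that by (auto simp: U_def)
  have Uv: "U *\<^sub>v v \<in> carrier_vec k" and A0v: "A0 *\<^sub>v v \<in> carrier_vec k" if "v \<in> carrier_vec k" for v
    using Uc A0c that by auto
  have A0U: "zmod (A0 *\<^sub>v (U *\<^sub>v v) - v)" if v: "v \<in> carrier_vec k" for v
  proof -
    have AU: "A0 * U \<in> carrier_mat k k" using A0c Uc by simp
    have "zmod ((A0 * U) *\<^sub>v w - 1\<^sub>m k *\<^sub>v w)" if "w \<in> carrier_vec k" for w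
    proof -
      have "(A0 * U) $$ (i,j) mod ps ! i = (1\<^sub>m k) $$ (i,j) mod ps ! i" if ij: "i < k" "j < k" for i j
      proof -
        have "(A0 * U) $$ (i,j) = (A0 *\<^sub>v u j) $ i"
          using colU[OF ij(2)] A0c Uc ij by simp
        then show ?thesis using u(2)[of j] ij by (auto simp: zmod_def mod_eq_dvd_iff)
      qed
      then have "redm (A0 * U) = redm (1\<^sub>m k)"
        using AU unfolding redm_def by (intro eq_matI) auto
      then show ?thesis using redm_eq_iff[OF AU one_carrier_mat] that by blast
    qed
    from this[OF v] show ?thesis using v assoc_mult_mat_vec[OF A0c(1) Uc v] by simp
  qed
  have "bij_betw (\<lambda>G. redm (G * A0)) aut_mats (presentations L)"
  proof (rule bij_betwI[where g = "\<lambda>A. redm (A * U)"])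
    show "(\<lambda>G. redm (G * A0)) \<in> aut_mats \<rightarrow> presentations L"
      using aut_mats_mult_presentations[OF _ A0] by blast
    have AUA0: "zmod (A *\<^sub>v (U *\<^sub>v (A0 *\<^sub>v v)) - A *\<^sub>v v)" if A: "A \<in> presentations L" and v: "v \<in> carrier_vec k" for A v
    proof -
      have Ac: "A \<in> carrier_mat k k" "kernel_lattice ps A = kernel_lattice ps A0" using A L by (auto simp: presentations_def)
      have c: "U *\<^sub>v (A0 *\<^sub>v v) \<in> carrier_vec k" using Uv A0v v by blast
      have "zmod (A0 *\<^sub>v (U *\<^sub>v (A0 *\<^sub>v v) - v))"
        using mult_minus_distrib_mat_vec[OF A0c(1) c v] A0U[OF A0v[OF v]] by simp
      then have "U *\<^sub>v (A0 *\<^sub>v v) - v \<in> kernel_lattice ps A"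
        unfolding Ac(2) kernel_lattice_eq[OF A0c(1)] using c v by auto
      then show ?thesis
        using mult_minus_distrib_mat_vec[OF Ac(1) c v] kernel_lattice_eq[OF Ac(1)] by auto
    qed
    show "(\<lambda>A. redm (A * U)) \<in> presentations L \<rightarrow> aut_mats"
    proof
      fix A assume A: "A \<in> presentations L"
      then have Ac: "A \<in> carrier_mat k k" "kernel_lattice ps A = kernel_lattice ps A0" using L by (auto simp: presentations_def)
      have AU: "A * U \<in> carrier_mat k k" using Ac Uc by simp
      have "zmod (redm (A * U) *\<^sub>v v) \<longleftrightarrow> zmod v" if v: "v \<in> carrier_vec k" for v
      proof -
        have "zmod (redm (A * U) *\<^sub>v v) \<longleftrightarrow> zmod ((A * U) *\<^sub>v v)"
          using zmod_cong_iff[OF _ _ redm_mult_vec_cong[OF AU v]] redm_carrier[OF AU] AU v by auto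
        also have "(A * U) *\<^sub>v v = A *\<^sub>v (U *\<^sub>v v)" using assoc_mult_mat_vec[OF Ac(1) Uc v] .
        also have "zmod (A *\<^sub>v (U *\<^sub>v v)) \<longleftrightarrow> zmod (A0 *\<^sub>v (U *\<^sub>v v))"
          using Ac(2) Uv[OF v] unfolding kernel_lattice_eq[OF Ac(1)] kernel_lattice_eq[OF A0c(1)] by blast
        also have "\<dots> \<longleftrightarrow> zmod v"
          using zmod_cong_iff[OF A0v[OF Uv[OF v]] v A0U[OF v]] .
        finally show ?thesis .
      qed
      moreover have "redm (redm (A * U)) = redm (A * U)"
        using AU by (intro eq_matI) (auto simp: redm_def)
      ultimately show "redm (A * U) \<in> aut_mats"
        using redm_carrier[OF AU] by (simp add: aut_mats_def)
    qed
    show "redm (redm (G * A0) * U) = G" if G: "G \<in> aut_mats" for G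
    proof -
      have Gc: "G \<in> carrier_mat k k" "redm G = G" using G by (auto simp: aut_mats_def)
      have GA: "G * A0 \<in> carrier_mat k k" using Gc A0c by simp
      have RU: "redm (G * A0) * U \<in> carrier_mat k k" using redm_carrier[OF GA] Uc by simp
      have "zmod ((redm (G * A0) * U) *\<^sub>v v - G *\<^sub>v v)" if v: "v \<in> carrier_vec k" for v
      proof -
        have c: "redm (G * A0) *\<^sub>v (U *\<^sub>v v) \<in> carrier_vec k" "(G * A0) *\<^sub>v (U *\<^sub>v v) \<in> carrier_vec k" "G *\<^sub>v v \<in> carrier_vec k"
          using redm_carrier[OF GA] GA Uv[OF v] Gc v by auto
        have "(redm (G * A0) * U) *\<^sub>v v = redm (G * A0) *\<^sub>v (U *\<^sub>v v)"
          using assoc_mult_mat_vec[OF redm_carrier[OF GA] Uc v] .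
        moreover have "(G * A0) *\<^sub>v (U *\<^sub>v v) = G *\<^sub>v (A0 *\<^sub>v (U *\<^sub>v v))"
          using assoc_mult_mat_vec[OF Gc(1) A0c(1) Uv[OF v]] .
        moreover have "zmod (G *\<^sub>v (A0 *\<^sub>v (U *\<^sub>v v)) - G *\<^sub>v v)"
          using aut_mats_cong[OF G A0v[OF Uv[OF v]] v] A0U[OF v] by simp
        ultimately show ?thesis
          using zmod_trans[OF c] redm_mult_vec_cong[OF GA Uv[OF v]] by simp
      qed
      then have "redm (redm (G * A0) * U) = redm G" using redm_eq_iff[OF RU Gc(1)] by blast
      then show ?thesis using Gc by simp
    qed
    show "redm (redm (A * U) * A0) = A" if A: "A \<in> presentations L" for A
    proof -
      have Ac: "A \<in> carrier_mat k k" "redm A = A" using A by (auto simp: presentations_def)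
      have AU: "A * U \<in> carrier_mat k k" using Ac Uc by simp
      have RA: "redm (A * U) * A0 \<in> carrier_mat k k" using redm_carrier[OF AU] A0c by simp
      have "zmod ((redm (A * U) * A0) *\<^sub>v v - A *\<^sub>v v)" if v: "v \<in> carrier_vec k" for v
      proof -
        have c: "redm (A * U) *\<^sub>v (A0 *\<^sub>v v) \<in> carrier_vec k" "(A * U) *\<^sub>v (A0 *\<^sub>v v) \<in> carrier_vec k" "A *\<^sub>v v \<in> carrier_vec k"
          using redm_carrier[OF AU] AU A0v[OF v] Ac v by auto
        have "(redm (A * U) * A0) *\<^sub>v v = redm (A * U) *\<^sub>v (A0 *\<^sub>v v)"
          using assoc_mult_mat_vec[OF redm_carrier[OF AU] A0c(1) v] .
        moreover have "(A * U) *\<^sub>v (A0 *\<^sub>v v) = A *\<^sub>v (U *\<^sub>v (A0 *\<^sub>v v))"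
          using assoc_mult_mat_vec[OF Ac(1) Uc A0v[OF v]] .
        ultimately show ?thesis
          using zmod_trans[OF c] redm_mult_vec_cong[OF AU A0v[OF v]] AUA0[OF A v] by simp
      qed
      then have "redm (redm (A * U) * A0) = redm A" using redm_eq_iff[OF RA Ac(1)] by blast
      then show ?thesis using Ac by simp
    qed
  qed
  then show ?thesis using bij_betw_same_card by metis
qed

text \<open>The left-hand side is the size of the \<open>g\<close>-torsion of the quotient by
  \<open>L\<close>, and by \<open>red_mult_eq_iff\<close> it depends on \<open>L\<close> alone; the
  right-hand side is a datum of \<open>ps\<close>. Letting \<open>g\<close> vary shows that
  \<open>L\<close> determines a divisibility chain \<open>ps\<close> of monic polynomials.\<close>

lemma card_quotient_torsion:
  assumes A: "A \<in> presentations L"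
  shows "card ((\<lambda>u. red (A *\<^sub>v u)) ` {u \<in> carrier_vec k. g \<cdot>\<^sub>v u \<in> L})
    = CARD('a) ^ (\<Sum>i<k. degree (gcd g (ps ! i)))"
proof -
  have Ac: "A \<in> carrier_mat k k" "onto k A" "L = kernel_lattice ps A" using A by (auto simp: presentations_def)
  have L: "g \<cdot>\<^sub>v u \<in> L \<longleftrightarrow> zmod (g \<cdot>\<^sub>v red (A *\<^sub>v u))" if u: "u \<in> carrier_vec k" for u
  proof -
    have Au: "A *\<^sub>v u \<in> carrier_vec k" using Ac u by auto
    have "g \<cdot>\<^sub>v u \<in> L \<longleftrightarrow> zmod (g \<cdot>\<^sub>v (A *\<^sub>v u))"
      unfolding Ac(3) kernel_lattice_eq[OF Ac(1)] using u mult_mat_vec_smult[OF Ac(1) u] by simp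
    also have "\<dots> \<longleftrightarrow> zmod (g \<cdot>\<^sub>v red (A *\<^sub>v u))"
    proof -
      have "g \<cdot>\<^sub>v red (A *\<^sub>v u) - g \<cdot>\<^sub>v (A *\<^sub>v u) = g \<cdot>\<^sub>v (red (A *\<^sub>v u) - A *\<^sub>v u)"
        using Au Ac(1) by (intro eq_vecI) (auto simp: right_diff_distrib red_def)
      moreover have "zmod (g \<cdot>\<^sub>v (red (A *\<^sub>v u) - A *\<^sub>v u))"
        using red_cong[OF Au] Au by (intro zmod_smult) auto
      ultimately show ?thesis
        using zmod_cong_iff[of "g \<cdot>\<^sub>v red (A *\<^sub>v u)" "g \<cdot>\<^sub>v (A *\<^sub>v u)"] Au by simp
    qed
    finally show ?thesis .
  qed
  have "(\<lambda>u. red (A *\<^sub>v u)) ` {u \<in> carrier_vec k. g \<cdot>\<^sub>v u \<in> L} = {w \<in> M. zmod (g \<cdot>\<^sub>v w)}"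
  proof (intro equalityI subsetI)
    fix w assume w: "w \<in> {w \<in> M. zmod (g \<cdot>\<^sub>v w)}"
    then have wc: "w \<in> carrier_vec k" "red w = w" by (auto simp: M_def)
    obtain u where u: "u \<in> carrier_vec k" "zmod (A *\<^sub>v u - w)"
      using Ac(2) wc by (auto simp: onto_def)
    then have "red (A *\<^sub>v u) = w" using red_eq_iff[of "A *\<^sub>v u" w] wc Ac by auto
    then show "w \<in> (\<lambda>u. red (A *\<^sub>v u)) ` {u \<in> carrier_vec k. g \<cdot>\<^sub>v u \<in> L}"
      using L[OF u(1)] u w by force
  qed (use L in auto)
  then show ?thesis using card_M_torsion(2) by simp
qed

lemma red_mult_eq_iff:
  assumes A: "A \<in> presentations L" and u: "u \<in> carrier_vec k" "v \<in> carrier_vec k"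
  shows "red (A *\<^sub>v u) = red (A *\<^sub>v v) \<longleftrightarrow> u - v \<in> L"
proof -
  have Ac: "A \<in> carrier_mat k k" "L = kernel_lattice ps A" using A by (auto simp: presentations_def)
  have "red (A *\<^sub>v u) = red (A *\<^sub>v v) \<longleftrightarrow> zmod (A *\<^sub>v u - A *\<^sub>v v)"
    using red_eq_iff Ac u by auto
  also have "A *\<^sub>v u - A *\<^sub>v v = A *\<^sub>v (u - v)"
    using mult_minus_distrib_mat_vec[OF Ac(1) u] by simp
  also have "zmod (A *\<^sub>v (u - v)) \<longleftrightarrow> u - v \<in> L"
    unfolding Ac(2) kernel_lattice_eq[OF Ac(1)] using u by simp
  finally show ?thesis .
qed

end

text \<open>Both images are the quotient of \<open>Q\<close> by the same equivalence
  relation.\<close>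

lemma card_image_eq_if_same_kernel:
  assumes "\<And>u v. u \<in> Q \<Longrightarrow> v \<in> Q \<Longrightarrow> f u = f v \<longleftrightarrow> g u = g v"
  shows "card (f ` Q) = card (g ` Q)"
proof -
  define h where "h = (\<lambda>y. g (SOME u. u \<in> Q \<and> f u = y))"
  have h: "h (f u) = g u" if u: "u \<in> Q" for u
  proof -
    have "(SOME v. v \<in> Q \<and> f v = f u) \<in> Q \<and> f (SOME v. v \<in> Q \<and> f v = f u) = f u"
      by (rule someI[of _ u]) (use u in simp)
    then show ?thesis using assms u unfolding h_def by blast
  qed
  have "bij_betw h (f ` Q) (g ` Q)"
    unfolding bij_betw_def inj_on_def image_image using h assms by (auto simp: image_iff)
  then show ?thesis by (rule bij_betw_same_card)
qed

text \<open>Test with \<open>g = p i\<close>. If the earlier terms agree, the terms of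
  \<open>p\<close> from \<open>i\<close> on contribute \<open>(k - i) * degree (p i)\<close>, the
  largest possible value; the same total for \<open>p'\<close> forces \<open>p i\<close> to divide
  \<open>p' i\<close>. Exchanging the chains gives the converse.\<close>

lemma chain_eq_if_gcd_degrees_eq:
  fixes p p' :: "nat \<Rightarrow> 'a::field_gcd poly"
  assumes monic: "\<And>i. i < k \<Longrightarrow> lead_coeff (p i) = 1" "\<And>i. i < k \<Longrightarrow> lead_coeff (p' i) = 1"
    and chain: "\<And>i. Suc i < k \<Longrightarrow> p i dvd p (Suc i)" "\<And>i. Suc i < k \<Longrightarrow> p' i dvd p' (Suc i)"
    and deg: "\<And>g. (\<Sum>i<k. degree (gcd g (p i))) = (\<Sum>i<k. degree (gcd g (p' i)))"
  shows "i < k \<Longrightarrow> p i = p' i"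
proof (induction i rule: less_induct)
  case (less i)
  have key: "p i dvd p' i"
    if monic: "\<And>i. i < k \<Longrightarrow> lead_coeff (p i) = 1"
    and chain: "\<And>i. Suc i < k \<Longrightarrow> p i dvd p (Suc i)"
    and deg: "\<And>g. (\<Sum>i<k. degree (gcd g (p i))) = (\<Sum>i<k. degree (gcd g (p' i)))"
    and eq: "\<And>j. j < i \<Longrightarrow> p j = p' j" for p p' :: "nat \<Rightarrow> 'a poly"
  proof -
    have pi0: "p i \<noteq> 0" using monic[OF less.prems] by auto
    have split: "(\<Sum>j<k. f j) = (\<Sum>j<i. f j) + (\<Sum>j=i..<k. f j)" for f :: "nat \<Rightarrow> nat"
      using less.prems by (simp add: lessThan_atLeast0 sum.atLeastLessThan_concat)
    have "(\<Sum>j=i..<k. degree (gcd (p i) (p j))) = (\<Sum>j=i..<k. degree (gcd (p i) (p' j)))"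
      using deg[of "p i"] eq by (simp add: split)
    moreover have "degree (gcd (p i) (p j)) = degree (p i)" if "j \<in> {i..<k}" for j
    proof -
      have "p i dvd p j" using chain_dvd[of k p i j] chain that by auto
      then show ?thesis by (simp add: gcd_proj1_if_dvd degree_normalize_poly)
    qed
    ultimately have sum: "(\<Sum>j=i..<k. degree (gcd (p i) (p' j))) = (\<Sum>j=i..<k. degree (p i))" by simp
    have le: "degree (gcd (p i) (p' j)) \<le> degree (p i)" for j
      using pi0 by (intro dvd_imp_degree_le) auto
    have "degree (gcd (p i) (p' i)) = degree (p i)"
    proof (rule ccontr)
      assume "degree (gcd (p i) (p' i)) \<noteq> degree (p i)"
      then have "(\<Sum>j=i..<k. degree (gcd (p i) (p' j))) < (\<Sum>j=i..<k. degree (p i))"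
        using le le_neq_implies_less[OF le, of i] less.prems by (intro sum_strict_mono_ex1) (auto intro!: bexI[of _ i])
      then show False using sum by simp
    qed
    moreover obtain r where r: "p i = gcd (p i) (p' i) * r" using gcd_dvd1 by (metis dvdE)
    ultimately have "degree r = 0"
      using pi0 by (metis add_cancel_left_right degree_mult_eq mult_zero_left mult_zero_right)
    moreover have "r \<noteq> 0" using r pi0 by auto
    ultimately have "is_unit r" by (simp add: is_unit_iff_degree)
    then have "p i dvd gcd (p i) (p' i)" using r by (metis dvd_refl mult_unit_dvd_iff)
    then show ?thesis by simp
  qed
  have "p i dvd p' i" by (rule key[of p p']) (use monic chain deg less in auto)
  moreover have "p' i dvd p i" by (rule key[of p' p]) (use monic chain deg less in auto)
  ultimately have "normalize (p i) = normalize (p' i)" by (rule associatedI)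
  then show ?case using monic less.prems normalize_monic by metis
qed

lemma presentations_unique:
  fixes ps ps' :: "'a::{field_gcd,finite} poly list"
  assumes ps: "is_inv_factor_tuple ps" "length ps = k" and ps': "is_inv_factor_tuple ps'" "length ps' = k"
    and A: "A \<in> factor_list.presentations ps k L" and A': "A' \<in> factor_list.presentations ps' k L"
  shows "ps = ps'"
proof -
  have m: "lead_coeff (ps ! i) = 1" "lead_coeff (ps' ! i) = 1" if "i < k" for i
    using ps ps' that by (auto simp: is_inv_factor_tuple_def)
  interpret P: factor_list ps k
    by unfold_locales (use ps m in force)+
  interpret P': factor_list ps' k
    by unfold_locales (use ps' m in force)+
  have q: "1 < CARD('a)" by (rule card_UNIV_gt_1)
  have "(\<Sum>i<k. degree (gcd g (ps ! i))) = (\<Sum>i<k. degree (gcd g (ps' ! i)))" for g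
  proof -
    have "card ((\<lambda>u. P.red (A *\<^sub>v u)) ` {u \<in> carrier_vec k. g \<cdot>\<^sub>v u \<in> L})
        = card ((\<lambda>u. P'.red (A' *\<^sub>v u)) ` {u \<in> carrier_vec k. g \<cdot>\<^sub>v u \<in> L})"
      using P.red_mult_eq_iff[OF A] P'.red_mult_eq_iff[OF A'] by (intro card_image_eq_if_same_kernel) auto
    then show ?thesis
      unfolding P.card_quotient_torsion[OF A] P'.card_quotient_torsion[OF A'] using q by simp
  qed
  then have "ps ! i = ps' ! i" if "i < k" for i
    using chain_eq_if_gcd_degrees_eq[of k "(!) ps" "(!) ps'" i] that m ps ps'
    by (auto simp: is_inv_factor_tuple_def)
  then show ?thesis using ps ps' by (intro nth_equalityI) auto
qed

section \<open>The number of matrices with a given lattice\<close>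

lemma transpose_mult_eq_one:
  fixes P :: "'a::comm_ring_1 mat"
  assumes "P \<in> carrier_mat k k" "Q \<in> carrier_mat k k" "P * Q = 1\<^sub>m k"
  shows "transpose_mat Q * transpose_mat P = 1\<^sub>m k"
  using transpose_mult[OF assms(1,2)] assms(3) by (metis transpose_one)

text \<open>\<open>A\<close> is the matrix of multiplication by \<open>x\<close> on
  \<open>M\<close>: row \<open>i\<close> holds the coordinates of \<open>x\<close> times the
  \<open>i\<close>-th basis vector. Its characteristic matrix consists of relations between the
  basis vectors, and modulo these every relation becomes constant, hence zero.\<close>

lemma (in factor_list) lattice_basis_eq_char_image:
  assumes W: "basis W"
  shows "\<exists>A\<in>carrier_mat dg dg. char_image A = kernel_lattice ps W"
proof -
  have Wc: "W \<in> carrier_mat k dg" and bij: "bij_betw (comb W) (carrier_vec dg) M" using W by (auto simp: basis_def)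
  have "\<forall>i. \<exists>c. c \<in> carrier_vec dg \<and> comb W c = red ([:0,1:] \<cdot>\<^sub>v col W i)"
    using bij red_in_M unfolding bij_betw_def by (metis imageE)
  then obtain c where c: "\<And>i. c i \<in> carrier_vec dg" "\<And>i. comb W (c i) = red ([:0,1:] \<cdot>\<^sub>v col W i)" by metis
  define A where "A = mat dg dg (\<lambda>(i,j). c i $ j)"
  have Ac: "A \<in> carrier_mat dg dg" by (simp add: A_def)
  have E: "transpose_mat (charmat A) \<in> carrier_mat dg dg" using Ac by simp
  have sub: "char_image A \<subseteq> kernel_lattice ps W"
  proof
    fix u assume "u \<in> char_image A"
    then obtain y where y: "y \<in> carrier_vec dg" "u = transpose_mat (charmat A) *\<^sub>v y" using char_imageE Ac by blast
    have "col (transpose_mat (charmat A)) i \<in> kernel_lattice ps W" if i: "i < dg" for i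
    proof -
      have "col (transpose_mat (charmat A)) i = [:0,1:] \<cdot>\<^sub>v unit_vec dg i - const_vec (c i)"
        using Ac i c(1)[of i] by (intro eq_vecI) (auto simp: charmat_def A_def)
      moreover have "W *\<^sub>v ([:0,1:] \<cdot>\<^sub>v unit_vec dg i - const_vec (c i)) = [:0,1:] \<cdot>\<^sub>v col W i - red ([:0,1:] \<cdot>\<^sub>v col W i)"
      proof -
        have "W *\<^sub>v ([:0,1:] \<cdot>\<^sub>v unit_vec dg i - const_vec (c i)) = W *\<^sub>v ([:0,1:] \<cdot>\<^sub>v unit_vec dg i) - W *\<^sub>v const_vec (c i)"
          using c(1)[of i] by (intro mult_minus_distrib_mat_vec[OF Wc]) auto
        moreover have "W *\<^sub>v ([:0,1:] \<cdot>\<^sub>v unit_vec dg i) = [:0,1:] \<cdot>\<^sub>v col W i"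
          using mult_mat_vec_smult[OF Wc, of "unit_vec dg i" "[:0,1:]"] mult_mat_unit_vec[OF Wc i] by simp
        ultimately show ?thesis using c(2)[of i] by (simp add: comb_def)
      qed
      moreover have "zmod ([:0,1:] \<cdot>\<^sub>v col W i - red ([:0,1:] \<cdot>\<^sub>v col W i))"
      proof -
        have "[:0,1:] \<cdot>\<^sub>v col W i \<in> carrier_vec k" using Wc by (intro carrier_vecI) simp
        then show ?thesis using zmod_minus_commute[OF red_carrier _ red_cong] by blast
      qed
      moreover have "[:0,1:] \<cdot>\<^sub>v unit_vec dg i - const_vec (c i) \<in> carrier_vec dg"
        using c(1)[of i] by simp
      ultimately show ?thesis
        unfolding kernel_lattice_eq[OF Wc] by (simp only: mem_Collect_eq)
    qed
    then show "u \<in> kernel_lattice ps W" unfolding y(2) by (rule kernel_lattice_mult_mat_vec[OF Wc E y(1)])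
  qed
  moreover have "kernel_lattice ps W \<subseteq> char_image A"
  proof
    fix u assume u: "u \<in> kernel_lattice ps W"
    then have uc: "u \<in> carrier_vec dg" unfolding kernel_lattice_eq[OF Wc] by simp
    obtain b where b: "b \<in> carrier_vec dg" "u - const_vec b \<in> char_image A"
      using char_image_const_decomp[OF Ac order_refl uc] by blast
    have "u - (u - const_vec b) \<in> kernel_lattice ps W"
      using kernel_lattice_diff[OF u] b(2) sub by blast
    moreover have "u - (u - const_vec b) = const_vec b" using uc b(1) by (intro eq_vecI) auto
    ultimately have "const_vec b \<in> kernel_lattice ps W" by simp
    then have "b = 0\<^sub>v dg" using const_vec_in_lattice_basis[OF W b(1)] by simp
    moreover have "u - const_vec (0\<^sub>v dg) = u" using uc by (intro eq_vecI) auto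
    ultimately show "u \<in> char_image A" using b(2) by simp
  qed
  ultimately show ?thesis using Ac by blast
qed

text \<open>Multiplication by \<open>T\<close> turns \<open>V\<close> into the projection onto the
  first \<open>dg\<close> coordinates. The lattice of \<open>W * const_mat V\<close> thus becomes
  the product of the lattice of \<open>W\<close> and a free module, to which
  \<open>card_block_lattice\<close> applies.\<close>

lemma (in factor_list) card_char_image_eq_lattice:
  assumes W: "basis W" and V: "V \<in> surj_mats dg k" and kn: "k \<le> n"
  shows "card {B \<in> carrier_mat n k. char_image B = kernel_lattice ps (W * const_mat V)}
    = CARD('a) ^ (dg * (k - dg)) * simple_count TYPE('a) (n - dg) (k - dg)"
proof -
  have Wc: "W \<in> carrier_mat k dg" using W by (simp add: basis_def)
  have Vc: "V \<in> carrier_mat dg k" using V by (simp add: surj_mats_def)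
  have ind: "indep_list k (rows V)" using surj_mats_iff_indep[OF Vc] V by simp
  have dk: "dg \<le> k" using indep_list_length_le[OF ind] Vc by simp
  obtain T where T: "unimodular k T" and VT: "V * T = mat dg k (\<lambda>(i,j). if i = j then 1 else 0)"
    using indep_rows_decomp[OF Vc ind] by blast
  obtain T' where Tc: "T \<in> carrier_mat k k" "T' \<in> carrier_mat k k" "T * T' = 1\<^sub>m k" "T' * T = 1\<^sub>m k"
    using T unfolding unimodular_def by blast
  \<comment> \<open>\<open>base_change\<close> acts on \<open>B\<close>, while the lattice is the
    image of the transposed characteristic matrix; hence the transposes.\<close>
  define S where "S = transpose_mat T"
  define S' where "S' = transpose_mat T'"
  have Sc: "S \<in> carrier_mat k k" "S' \<in> carrier_mat k k" "S * S' = 1\<^sub>m k" "S' * S = 1\<^sub>m k"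
    using Tc transpose_mult_eq_one[OF Tc(2,1,4)] transpose_mult_eq_one[OF Tc(1,2,3)] by (auto simp: S_def S'_def)
  let ?t = "const_mat T" and ?t' = "const_mat T'"
  have tc: "?t \<in> carrier_mat k k" "?t' \<in> carrier_mat k k" using Tc by auto
  have tt: "?t * ?t' = 1\<^sub>m k" "?t' * ?t = 1\<^sub>m k"
    using const_poly_hom.mat_hom_mult[OF Tc(1,2)] const_poly_hom.mat_hom_mult[OF Tc(2,1)] Tc
    by (auto simp: const_poly_hom.mat_hom_one)
  have can: "?t' *\<^sub>v (?t *\<^sub>v v) = v" "?t *\<^sub>v (?t' *\<^sub>v v) = v" if "v \<in> carrier_vec k" for v
    using assoc_mult_mat_vec[OF tc(2,1) that] assoc_mult_mat_vec[OF tc(1,2) that] tt that by auto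
  let ?L = "kernel_lattice ps (W * const_mat V)"
  let ?L1 = "kernel_lattice ps W"
  let ?N = "{l @\<^sub>v r | l r. l \<in> ?L1 \<and> r \<in> carrier_vec (k - dg)}"
  have WV: "W * const_mat V \<in> carrier_mat k k" using Wc Vc by simp
  have L1c: "?L1 \<subseteq> carrier_vec dg" unfolding kernel_lattice_eq[OF Wc] by blast
  have tL: "?t *\<^sub>v v \<in> ?L \<longleftrightarrow> v \<in> ?N" if v: "v \<in> carrier_vec k" for v
  proof -
    have cT: "const_mat (V * T) = const_mat V * ?t" using const_poly_hom.mat_hom_mult[OF Vc Tc(1)] .
    have cVT: "const_mat (V * T) \<in> carrier_mat dg k" using Vc Tc by simp
    have "(W * const_mat V) *\<^sub>v (?t *\<^sub>v v) = W *\<^sub>v (const_mat V *\<^sub>v (?t *\<^sub>v v))"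
      using Wc Vc tc v by (intro assoc_mult_mat_vec) auto
    also have "const_mat V *\<^sub>v (?t *\<^sub>v v) = const_mat (V * T) *\<^sub>v v"
      unfolding cT using Vc tc v by (intro assoc_mult_mat_vec[symmetric]) auto
    also have "\<dots> = vec_first v dg"
    proof (rule eq_vecI)
      fix i assume "i < dim_vec (vec_first v dg)"
      then have i: "i < dg" by (simp add: vec_first_def)
      have "(const_mat (V * T) *\<^sub>v v) $ i = (\<Sum>j=0..<k. (if i = j then 1 else 0) * v $ j)"
        unfolding VT using i v by (auto simp: scalar_prod_def intro!: sum.cong)
      also have "\<dots> = v $ i"
        using i dk by (simp add: if_distrib[of "\<lambda>x. x * _"] sum.delta' cong: if_cong)
      finally show "(const_mat (V * T) *\<^sub>v v) $ i = vec_first v dg $ i" using i by (simp add: vec_first_def)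
    qed (use Vc Tc in \<open>simp add: vec_first_def\<close>)
    finally have e: "(W * const_mat V) *\<^sub>v (?t *\<^sub>v v) = W *\<^sub>v vec_first v dg" .
    have "?t *\<^sub>v v \<in> ?L \<longleftrightarrow> vec_first v dg \<in> ?L1"
      unfolding kernel_lattice_eq[OF WV] kernel_lattice_eq[OF Wc] using e tc v by auto
    also have "\<dots> \<longleftrightarrow> v \<in> ?N"
    proof
      assume a: "vec_first v dg \<in> ?L1"
      have "v = vec_first v dg @\<^sub>v vec_last v (k - dg)"
        using v dk by (metis le_add_diff_inverse vec_first_last_append)
      moreover have "vec_last v (k - dg) \<in> carrier_vec (k - dg)" by simp
      ultimately show "v \<in> ?N" using a by blast
    next
      assume "v \<in> ?N"
      then obtain l r where lr: "v = l @\<^sub>v r" "l \<in> ?L1" "r \<in> carrier_vec (k - dg)" by blast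
      then have "vec_first v dg = l" using L1c by (intro eq_vecI) (auto simp: vec_first_def)
      then show "vec_first v dg \<in> ?L1" using lr by simp
    qed
    finally show ?thesis .
  qed
  have Nc: "?N \<subseteq> carrier_vec k"
  proof
    fix v assume "v \<in> ?N"
    then obtain l r where "v = l @\<^sub>v r" "l \<in> carrier_vec dg" "r \<in> carrier_vec (k - dg)" using L1c by blast
    then show "v \<in> carrier_vec k" using dk append_carrier_vec[of l dg r "k - dg"] by simp
  qed
  have Lc: "?L \<subseteq> carrier_vec k" unfolding kernel_lattice_eq[OF WV] by blast
  have LN: "(\<lambda>v. ?t' *\<^sub>v v) ` ?L = ?N"
  proof (intro equalityI subsetI)
    fix v assume "v \<in> (\<lambda>v. ?t' *\<^sub>v v) ` ?L"
    then obtain u where u: "u \<in> ?L" "v = ?t' *\<^sub>v u" by blast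
    then have uc: "u \<in> carrier_vec k" using Lc by blast
    have vc: "v \<in> carrier_vec k" using u tc uc by auto
    have "?t *\<^sub>v v \<in> ?L" using u can(2)[OF uc] by simp
    then show "v \<in> ?N" using tL[OF vc] by blast
  next
    fix v assume v: "v \<in> ?N"
    then have vc: "v \<in> carrier_vec k" using Nc by blast
    have "?t *\<^sub>v v \<in> ?L" using tL[OF vc] v by blast
    then show "v \<in> (\<lambda>v. ?t' *\<^sub>v v) ` ?L" using can(1)[OF vc] by (intro image_eqI[of _ _ "?t *\<^sub>v v"]) auto
  qed
  then have NL: "(\<lambda>v. ?t *\<^sub>v v) ` ?N = ?L"
  proof -
    have "(\<lambda>v. ?t *\<^sub>v v) ` ((\<lambda>v. ?t' *\<^sub>v v) ` ?L) = (\<lambda>v. v) ` ?L"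
      unfolding image_image using can(2) Lc by (intro image_cong) auto
    then show ?thesis unfolding LN by simp
  qed
  have ts: "transpose_mat (const_mat S') = ?t'" "transpose_mat (const_mat S) = ?t"
    by (auto simp: S'_def S_def intro!: eq_matI)
  have "bij_betw (base_change n k S S') {B \<in> carrier_mat n k. char_image B = ?L} {B \<in> carrier_mat n k. char_image B = ?N}"
  proof (rule bij_betwI[where g = "base_change n k S' S"])
    show "base_change n k S S' \<in> {B \<in> carrier_mat n k. char_image B = ?L} \<rightarrow> {B \<in> carrier_mat n k. char_image B = ?N}"
      using char_image_base_change[OF _ kn Sc] base_change_carrier[OF _ kn Sc(1,2)] LN ts by auto
    show "base_change n k S' S \<in> {B \<in> carrier_mat n k. char_image B = ?N} \<rightarrow> {B \<in> carrier_mat n k. char_image B = ?L}"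
      using char_image_base_change[OF _ kn Sc(2,1,4,3)] base_change_carrier[OF _ kn Sc(2,1)] NL ts by auto
  qed (use base_change_inverse[OF _ kn Sc] base_change_inverse[OF _ kn Sc(2,1,4,3)] in auto)
  then have "card {B \<in> carrier_mat n k. char_image B = ?L} = card {B \<in> carrier_mat n k. char_image B = ?N}"
    by (rule bij_betw_same_card)
  moreover obtain A where A: "A \<in> carrier_mat dg dg" "char_image A = ?L1"
    using lattice_basis_eq_char_image[OF W] by blast
  have "card {B \<in> carrier_mat n k. char_image B = ?N} = CARD('a) ^ (dg * (k - dg)) * simple_count TYPE('a) (n - dg) (k - dg)"
  proof (rule card_block_lattice[OF A])
    show "c = 0\<^sub>v dg" if "c \<in> carrier_vec dg" "const_vec c \<in> ?L1" for c
      using const_vec_in_lattice_basis[OF W that] .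
    show "u - v \<in> ?L1" if "u \<in> ?L1" "v \<in> ?L1" for u v using kernel_lattice_diff that by blast
  qed (use dk kn in auto)
  ultimately show ?thesis by simp
qed

section \<open>Every matrix presents the module of its own invariant factors\<close>

lemma infinite_poly_UNIV: "\<not> finite (UNIV :: 'a::comm_semiring_1 poly set)"
proof -
  have "inj (\<lambda>n. monom (1::'a) n)" by (auto simp: inj_def monom_eq_iff')
  then show ?thesis using range_inj_infinite infinite_super subset_UNIV by metis
qed

text \<open>If \<open>D = P * X * Q\<close> is the Smith form of the characteristic matrix
  \<open>X\<close>, then the transpose of \<open>Q\<close> carries the lattice of \<open>B\<close>
  to the product of the ideals generated by the diagonal entries of \<open>D\<close>. Reduced modulo
  these entries it is a presentation.\<close>

lemma ex_presentation:
  fixes B :: "'a::{field_gcd,finite} mat"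
  assumes B: "B \<in> carrier_mat n k" and kn: "k \<le> n"
  shows "is_inv_factor_tuple (inv_factors (charmat B) k) \<and> length (inv_factors (charmat B) k) = k \<and>
    factor_list.presentations (inv_factors (charmat B) k) k (char_image B) \<noteq> {}"
proof -
  let ?X = "charmat B"
  have Xc: "?X \<in> carrier_mat n k" using B by simp
  obtain D where eqv: "mat_equiv n k ?X D" and snf: "snf_form n k D" using snf_exists[OF Xc] by blast
  obtain P Q where PQ: "unimodular n P" "unimodular k Q" "D = P * ?X * Q"
    using eqv unfolding mat_equiv_def by blast
  obtain P' where P: "P \<in> carrier_mat n n" "P' \<in> carrier_mat n n" "P * P' = 1\<^sub>m n" "P' * P = 1\<^sub>m n"
    using PQ(1) unfolding unimodular_def by blast
  obtain Q' where Q: "Q \<in> carrier_mat k k" "Q' \<in> carrier_mat k k" "Q * Q' = 1\<^sub>m k" "Q' * Q = 1\<^sub>m k"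
    using PQ(2) unfolding unimodular_def by blast
  have Dc: "D \<in> carrier_mat n k" using snf by (simp add: snf_form_def)
  define A where "A = transpose_mat Q"
  define A' where "A' = transpose_mat Q'"
  define E where "E = transpose_mat ?X"
  define F where "F = transpose_mat P"
  define F' where "F' = transpose_mat P'"
  define G where "G = transpose_mat D"
  have c: "A \<in> carrier_mat k k" "A' \<in> carrier_mat k k" "E \<in> carrier_mat k n" "F \<in> carrier_mat n n"
      "F' \<in> carrier_mat n n" "G \<in> carrier_mat k n"
    using P Q Xc Dc by (auto simp: A_def A'_def E_def F_def F'_def G_def)
  have AA: "A * A' = 1\<^sub>m k" "A' * A = 1\<^sub>m k"
    using transpose_mult_eq_one[OF Q(2,1,4)] transpose_mult_eq_one[OF Q(1,2,3)] by (auto simp: A_def A'_def)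
  have FF: "F * F' = 1\<^sub>m n" "F' * F = 1\<^sub>m n"
    using transpose_mult_eq_one[OF P(2,1,4)] transpose_mult_eq_one[OF P(1,2,3)] by (auto simp: F_def F'_def)
  have PX: "P * ?X \<in> carrier_mat n k" using P Xc by simp
  have G: "G = A * (E * F)"
    unfolding G_def PQ(3) using transpose_mult[OF PX Q(1)] transpose_mult[OF P(1) Xc]
    by (simp only: A_def E_def F_def)
  have Gv: "G *\<^sub>v z = A *\<^sub>v (E *\<^sub>v (F *\<^sub>v z))" if z: "z \<in> carrier_vec n" for z
  proof -
    have EF: "E * F \<in> carrier_mat k n" using c by simp
    show ?thesis unfolding G assoc_mult_mat_vec[OF c(1) EF z] assoc_mult_mat_vec[OF c(3,4) z] ..
  qed
  have canA: "A *\<^sub>v (A' *\<^sub>v v) = v" "A' *\<^sub>v (A *\<^sub>v v) = v" if "v \<in> carrier_vec k" for v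
    using assoc_mult_mat_vec[OF c(1,2) that] assoc_mult_mat_vec[OF c(2,1) that] AA that by auto
  have canF: "F *\<^sub>v (F' *\<^sub>v v) = v" if "v \<in> carrier_vec n" for v
    using assoc_mult_mat_vec[OF c(4,5) that] FF that by auto
  have Gi: "(G *\<^sub>v z) $ i = D $$ (i,i) * z $ i" if z: "z \<in> carrier_vec n" and i: "i < k" for z i
  proof -
    have "(G *\<^sub>v z) $ i = (\<Sum>j=0..<n. D $$ (j,i) * z $ j)"
      using Dc z i by (auto simp: G_def scalar_prod_def intro!: sum.cong)
    also have "\<dots> = (\<Sum>j=0..<n. if j = i then D $$ (i,i) * z $ i else 0)"
      using snf i by (intro sum.cong) (auto simp: snf_form_def)
    also have "\<dots> = D $$ (i,i) * z $ i" using i kn by simp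
    finally show ?thesis .
  qed
  have L: "u \<in> char_image B \<longleftrightarrow> (\<forall>i<k. D $$ (i,i) dvd (A *\<^sub>v u) $ i)" if u: "u \<in> carrier_vec k" for u
  proof
    assume "u \<in> char_image B"
    then obtain y where y: "y \<in> carrier_vec n" "u = E *\<^sub>v y" using char_imageE B by (metis E_def)
    have F'y: "F' *\<^sub>v y \<in> carrier_vec n" using c y by auto
    have "A *\<^sub>v u = G *\<^sub>v (F' *\<^sub>v y)" using Gv[OF F'y] canF[OF y(1)] y(2) by simp
    then show "\<forall>i<k. D $$ (i,i) dvd (A *\<^sub>v u) $ i" using Gi[OF F'y] by simp
  next
    assume d: "\<forall>i<k. D $$ (i,i) dvd (A *\<^sub>v u) $ i"
    define z where "z = vec n (\<lambda>i. if i < k then (A *\<^sub>v u) $ i div D $$ (i,i) else 0)"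
    have zc: "z \<in> carrier_vec n" by (simp add: z_def)
    have "G *\<^sub>v z = A *\<^sub>v u"
    proof (rule eq_vecI)
      fix i assume "i < dim_vec (A *\<^sub>v u)"
      then have i: "i < k" using c by simp
      then show "(G *\<^sub>v z) $ i = (A *\<^sub>v u) $ i" using Gi[OF zc i] d kn by (simp add: z_def)
    qed (use c in auto)
    then have "A' *\<^sub>v (A *\<^sub>v (E *\<^sub>v (F *\<^sub>v z))) = A' *\<^sub>v (A *\<^sub>v u)" using Gv[OF zc] by simp
    moreover have Fz: "F *\<^sub>v z \<in> carrier_vec n" using c zc by auto
    moreover have "E *\<^sub>v (F *\<^sub>v z) \<in> carrier_vec k" using c Fz by auto
    ultimately have "u = E *\<^sub>v (F *\<^sub>v z)" using canA(2) u by metis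
    then show "u \<in> char_image B" using char_imageI[OF B Fz] by (simp add: E_def)
  qed
  \<comment> \<open>Modulo the lattice every vector is congruent to one of finitely many constant
    vectors. If \<open>D $$ (i,i)\<close> were zero, coordinate \<open>i\<close> after applying
    \<open>A\<close> would depend only on the class of the vector, yet it takes every polynomial as
    a value.\<close>
  have nz: "D $$ (i,i) \<noteq> 0" if i: "i < k" for i
  proof
    assume 0: "D $$ (i,i) = 0"
    have "t \<in> (\<lambda>c. (A *\<^sub>v const_vec c) $ i) ` carrier_vec k" for t
    proof -
      let ?v = "t \<cdot>\<^sub>v unit_vec k i"
      have vc: "?v \<in> carrier_vec k" by simp
      have u: "A' *\<^sub>v ?v \<in> carrier_vec k" using c vc by auto
      obtain b where b: "b \<in> carrier_vec k" "A' *\<^sub>v ?v - const_vec b \<in> char_image B"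
        using char_image_const_decomp[OF B kn u] by blast
      have cb: "const_vec b \<in> carrier_vec k" using b by simp
      have "A' *\<^sub>v ?v - const_vec b \<in> carrier_vec k" using u cb by auto
      then have "(A *\<^sub>v (A' *\<^sub>v ?v - const_vec b)) $ i = 0" using L b(2) 0 i by auto
      moreover have "A *\<^sub>v (A' *\<^sub>v ?v - const_vec b) = ?v - A *\<^sub>v const_vec b"
        using mult_minus_distrib_mat_vec[OF c(1) u cb] canA(1)[OF vc] by simp
      ultimately have "t - (A *\<^sub>v const_vec b) $ i = 0" using i c by simp
      then show ?thesis using b(1) by auto
    qed
    then have "(UNIV :: 'a poly set) \<subseteq> (\<lambda>c. (A *\<^sub>v const_vec c) $ i) ` carrier_vec k" by blast
    moreover have "finite ((\<lambda>c. (A *\<^sub>v const_vec c) $ i) ` carrier_vec k)"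
      using finite_carrier_vec[where 'a='a] by simp
    ultimately show False using infinite_poly_UNIV finite_subset by blast
  qed
  define ps where "ps = inv_factors ?X k"
  have ps: "ps = map (\<lambda>j. normalize (D $$ (j,j))) [0..<k]"
    unfolding ps_def by (rule inv_factors_snf[OF eqv snf kn nz])
  have len: "length ps = k" by (simp add: ps)
  have psi: "ps ! i = normalize (D $$ (i,i))" if "i < k" for i using that by (simp add: ps)
  have tup: "is_inv_factor_tuple ps"
    unfolding is_inv_factor_tuple_def
  proof (intro conjI ballI allI impI)
    fix p assume "p \<in> set ps"
    then obtain j where "j < k" "p = normalize (D $$ (j,j))" by (auto simp: ps)
    then show "lead_coeff p = 1" using lead_coeff_normalize_poly[OF nz[of j]] by (simp only:)
  next
    fix i assume "Suc i < length ps"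
    then show "ps ! i dvd ps ! Suc i" using snf kn len psi by (auto simp: snf_form_def)
  qed
  interpret factor_list ps k
    by unfold_locales (use len psi nz in auto)
  have latA: "kernel_lattice ps A = char_image B"
  proof -
    have "zmod (A *\<^sub>v u) \<longleftrightarrow> u \<in> char_image B" if "u \<in> carrier_vec k" for u
      using L[OF that] psi by (simp add: zmod_def)
    then show ?thesis unfolding kernel_lattice_eq[OF c(1)] using char_image_subset[OF B] by blast
  qed
  have "onto k A"
    unfolding onto_def
  proof
    fix w :: "'a poly vec" assume w: "w \<in> carrier_vec k"
    have "A' *\<^sub>v w \<in> carrier_vec k" using c w by auto
    moreover have "zmod (A *\<^sub>v (A' *\<^sub>v w) - w)" using canA(1)[OF w] w by (simp add: zmod_def)
    ultimately show "\<exists>u\<in>carrier_vec k. zmod (A *\<^sub>v u - w)" by blast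
  qed
  moreover have "redm (redm A) = redm A" using c(1) by (intro eq_matI) (auto simp: redm_def)
  ultimately have "redm A \<in> presentations (char_image B)"
    using redm_carrier[OF c(1)] onto_redm[OF c(1)] kernel_lattice_redm[OF c(1)] latA by (simp add: presentations_def)
  then show ?thesis using tup len unfolding ps_def[symmetric] by blast
qed

section \<open>The double count of matrices and surjections\<close>

lemma degree_prod_list_sum:
  fixes ps :: "'a::idom poly list"
  shows "(\<And>p. p \<in> set ps \<Longrightarrow> p \<noteq> 0) \<Longrightarrow> degree (prod_list ps) = (\<Sum>i<length ps. degree (ps ! i))"
proof (induction ps)
  case (Cons p ps)
  then have "prod_list ps \<noteq> 0" by (auto simp: prod_list_zero_iff)
  then show ?case using Cons by (simp add: degree_mult_eq sum.lessThan_Suc_shift del: sum.lessThan_Suc)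
qed simp

lemma (in factor_list) card_surj_mats_lattice:
  assumes W: "basis W" and B: "B \<in> carrier_mat n k" and kn: "k \<le> n"
  shows "card {V \<in> surj_mats dg k. kernel_lattice ps (W * const_mat V) = char_image B} = card (presentations (char_image B))"
proof -
  have Wc: "W \<in> carrier_mat k dg" using W by (simp add: basis_def)
  have img: "(\<lambda>V. W * const_mat V) ` {V \<in> surj_mats dg k. kernel_lattice ps (W * const_mat V) = char_image B} = presentations (char_image B)"
    (is "?f ` ?S = ?R")
  proof (intro equalityI subsetI)
    fix A assume "A \<in> ?f ` ?S"
    then obtain V where V: "V \<in> surj_mats dg k" "kernel_lattice ps (W * const_mat V) = char_image B" "A = W * const_mat V" by blast
    then have "V \<in> carrier_mat dg k" by (simp add: surj_mats_def)
    then show "A \<in> ?R"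
      using V onto_basis_mult[OF W V(1)] redm_basis_mult[OF W] Wc by (simp add: presentations_def)
  next
    fix A assume "A \<in> ?R"
    then have A: "A \<in> carrier_mat k k" "redm A = A" "onto k A" "kernel_lattice ps A = char_image B" by (auto simp: presentations_def)
    then show "A \<in> ?f ` ?S"
      using lattice_eq_char_image_imp_basis_mult[OF W A(1-3) B kn A(4)] by auto
  qed
  have "inj_on ?f ?S"
    by (rule inj_on_subset[OF inj_on_basis_mult[OF W, of k]]) (auto simp: surj_mats_def)
  from card_image[OF this] show ?thesis unfolding img by (rule sym)
qed

lemma N_count_mult_card_aut_mats:
  fixes ps :: "'a::{field_gcd,finite} poly list"
  assumes ps: "is_inv_factor_tuple ps" "length ps = k" and d: "d = degree (prod_list ps)" and kn: "k \<le> n"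
  shows "N_count n k ps * card (factor_list.aut_mats ps k)
    = card (surj_mats d k :: 'a mat set) * (CARD('a) ^ (d * (k - d)) * simple_count TYPE('a) (n - d) (k - d))"
proof -
  have m: "lead_coeff (ps ! i) = 1" if "i < k" for i
    using ps that by (auto simp: is_inv_factor_tuple_def)
  interpret factor_list ps k
    by unfold_locales (use ps m in force)+
  have dg: "dg = d"
    unfolding d dg_def using ps by (subst degree_prod_list_sum) (auto simp: is_inv_factor_tuple_def)
  obtain W where W: "basis W" using ex_basis by blast
  let ?C = "carrier_mat n k :: 'a mat set" and ?S = "surj_mats d k :: 'a mat set"
  \<comment> \<open>The surjection \<open>W * const_mat V\<close> is represented by
    \<open>V\<close>, so both members of a pair are matrices over \<open>F\<close>.\<close>
  let ?R = "\<lambda>B V. kernel_lattice ps (W * const_mat V) = char_image B"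
  have fin: "finite ?C" "finite ?S"
    using finite_carrier_mat[where 'a='a] by (auto simp: surj_mats_def intro: finite_subset)
  have "(\<Sum>B\<in>?C. card {V\<in>?S. ?R B V}) = (\<Sum>V\<in>?S. card {B\<in>?C. ?R B V})"
  proof -
    have "(\<Sum>B\<in>?C. card {V\<in>?S. ?R B V}) = (\<Sum>B\<in>?C. \<Sum>V\<in>?S. if ?R B V then 1 else 0)"
      using fin by (simp add: sum.If_cases Int_def)
    also have "\<dots> = (\<Sum>V\<in>?S. \<Sum>B\<in>?C. if ?R B V then 1 else 0)" by (rule sum.swap)
    also have "\<dots> = (\<Sum>V\<in>?S. card {B\<in>?C. ?R B V})"
      using fin by (simp add: sum.If_cases Int_def)
    finally show ?thesis .
  qed
  moreover have "card {B\<in>?C. ?R B V} = CARD('a) ^ (d * (k - d)) * simple_count TYPE('a) (n - d) (k - d)" if "V \<in> ?S" for V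
  proof -
    have "{B\<in>?C. ?R B V} = {B\<in>?C. char_image B = kernel_lattice ps (W * const_mat V)}" by auto
    then show ?thesis using card_char_image_eq_lattice[OF W _ kn, of V] that dg by simp
  qed
  moreover have "card {V\<in>?S. ?R B V} = (if inv_factors (charmat B) k = ps then card aut_mats else 0)" if B: "B \<in> ?C" for B
  proof -
    have e: "card {V\<in>?S. ?R B V} = card (presentations (char_image B))"
      using card_surj_mats_lattice[OF W B kn] dg by simp
    show ?thesis
    \<comment> \<open>Without a presentation for \<open>ps\<close> the invariant factors of
      \<open>B\<close> differ from \<open>ps\<close>, since \<open>ex_presentation\<close> provides
      one for them; with a presentation, \<open>presentations_unique\<close> identifies them as
      \<open>ps\<close>.\<close>
    proof (cases "presentations (char_image B) = {}")
      case True
      then show ?thesis using e ex_presentation[OF B kn] by auto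
    next
      case False
      then obtain A where A: "A \<in> presentations (char_image B)" by blast
      have "inv_factors (charmat B) k = ps"
        using presentations_unique[OF _ _ ps _ A] ex_presentation[OF B kn] by blast
      then show ?thesis using e card_presentations[OF A] by simp
    qed
  qed
  ultimately have "(\<Sum>B\<in>?C. if inv_factors (charmat B) k = ps then card aut_mats else 0)
     = card ?S * (CARD('a) ^ (d * (k - d)) * simple_count TYPE('a) (n - d) (k - d))"
    by simp
  moreover have "(\<Sum>B\<in>?C. if inv_factors (charmat B) k = ps then card aut_mats else 0) = N_count n k ps * card aut_mats"
    using fin by (simp add: sum.If_cases N_count_def Int_def)
  ultimately show ?thesis by simp
qed

section \<open>Counting automorphisms\<close>

lemma poly_chinese_remainder:
  fixes a b :: "'a::field_gcd poly"
  assumes "coprime a b"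
  shows "\<exists>x. x mod a = u mod a \<and> x mod b = v mod b"
proof -
  obtain s t where st: "s * a + t * b = 1"
    using bezout_coefficients_fst_snd[of a b] assms by (metis coprime_imp_gcd_eq_1)
  have "u * (t * b) + v * (s * a) - u = (v - u) * (s * a)"
  proof -
    have "u = u * (s * a + t * b)" using st by simp
    then show ?thesis by (simp add: algebra_simps)
  qed
  moreover have "u * (t * b) + v * (s * a) - v = (u - v) * (t * b)"
  proof -
    have "v = v * (s * a + t * b)" using st by simp
    then show ?thesis by (simp add: algebra_simps)
  qed
  ultimately show ?thesis
    by (intro exI[of _ "u * (t * b) + v * (s * a)"]) (simp add: mod_eq_dvd_iff)
qed

text \<open>The Chinese remainder theorem, applied in row \<open>i\<close> modulo
  \<open>as ! i\<close> and \<open>bs ! i\<close>, splits a reduced matrix into a pair of reduced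
  matrices. The matrix is an automorphism iff both parts are.\<close>

lemma card_aut_mats_mult:
  fixes as bs :: "'a::{field_gcd,finite} poly list"
  assumes la: "length as = k" and lb: "length bs = k"
    and nza: "\<And>i. i < k \<Longrightarrow> as ! i \<noteq> 0" and nzb: "\<And>i. i < k \<Longrightarrow> bs ! i \<noteq> 0"
    and cop: "\<And>i j. i < k \<Longrightarrow> j < k \<Longrightarrow> coprime (as ! i) (bs ! j)"
    and ps: "length ps = k" "\<And>i. i < k \<Longrightarrow> ps ! i = as ! i * bs ! i"
  shows "card (factor_list.aut_mats ps k) = card (factor_list.aut_mats as k) * card (factor_list.aut_mats bs k)"
proof -
  interpret A: factor_list as k by unfold_locales (use la nza in auto)
  interpret B: factor_list bs k by unfold_locales (use lb nzb in auto)
  interpret P: factor_list ps k by unfold_locales (use ps nza nzb in auto)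
  have zmod: "P.zmod v \<longleftrightarrow> A.zmod v \<and> B.zmod v" for v
    unfolding P.zmod_def A.zmod_def B.zmod_def using ps(2) cop
    by (metis divides_mult dvd_mult_left dvd_mult_right)
  have Pa: "G \<in> carrier_mat k k \<Longrightarrow> (\<forall>v\<in>carrier_vec k. P.zmod (G *\<^sub>v v) \<longleftrightarrow> P.zmod v) \<longleftrightarrow>
     (\<forall>v\<in>carrier_vec k. A.zmod (G *\<^sub>v v) \<longleftrightarrow> A.zmod v) \<and> (\<forall>v\<in>carrier_vec k. B.zmod (G *\<^sub>v v) \<longleftrightarrow> B.zmod v)" for G
  proof -
    assume G: "G \<in> carrier_mat k k"
    \<comment> \<open>Scalars that separate the two parts: \<beta> annihilates everything modulo
      \<open>bs\<close> and is invertible modulo each \<open>as ! i\<close>, and conversely for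
      \<alpha>. Testing with \<beta> times \<open>v\<close> isolates the condition modulo
      \<open>as\<close>.\<close>
    define \<alpha> where "\<alpha> = prod_list as"
    define \<beta> where "\<beta> = prod_list bs"
    have ca: "coprime (as ! i) \<beta>" if "i < k" for i
      unfolding \<beta>_def using cop that lb by (intro prod_list_coprime_right) (auto simp: in_set_conv_nth)
    have cb: "coprime (bs ! i) \<alpha>" if "i < k" for i
      unfolding \<alpha>_def using cop that la
      by (intro prod_list_coprime_right) (auto simp: in_set_conv_nth coprime_commute)
    have da: "as ! i dvd \<alpha>" if "i < k" for i unfolding \<alpha>_def using that la by (intro prod_list_dvd) auto
    have db: "bs ! i dvd \<beta>" if "i < k" for i unfolding \<beta>_def using that lb by (intro prod_list_dvd) auto
    have Gc: "G *\<^sub>v v \<in> carrier_vec k" if "v \<in> carrier_vec k" for v using G that by auto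
    have sA: "A.zmod (\<beta> \<cdot>\<^sub>v v) \<longleftrightarrow> A.zmod v" "B.zmod (\<beta> \<cdot>\<^sub>v v)" if "v \<in> carrier_vec k" for v
      unfolding A.zmod_def B.zmod_def using ca db that by (auto simp: coprime_dvd_mult_right_iff)
    have sB: "B.zmod (\<alpha> \<cdot>\<^sub>v v) \<longleftrightarrow> B.zmod v" "A.zmod (\<alpha> \<cdot>\<^sub>v v)" if "v \<in> carrier_vec k" for v
      unfolding A.zmod_def B.zmod_def using cb da that by (auto simp: coprime_dvd_mult_right_iff)
    have "(A.zmod (G *\<^sub>v v) \<longleftrightarrow> A.zmod v) \<and> (B.zmod (G *\<^sub>v v) \<longleftrightarrow> B.zmod v)"
      if P: "\<forall>v\<in>carrier_vec k. P.zmod (G *\<^sub>v v) \<longleftrightarrow> P.zmod v" and v: "v \<in> carrier_vec k" for v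
    proof
      have "P.zmod (G *\<^sub>v (\<beta> \<cdot>\<^sub>v v)) \<longleftrightarrow> P.zmod (\<beta> \<cdot>\<^sub>v v)" using P v by simp
      then show "A.zmod (G *\<^sub>v v) \<longleftrightarrow> A.zmod v"
        unfolding zmod mult_mat_vec_smult[OF G v] using sA[OF v] sA[OF Gc[OF v]] by blast
      have "P.zmod (G *\<^sub>v (\<alpha> \<cdot>\<^sub>v v)) \<longleftrightarrow> P.zmod (\<alpha> \<cdot>\<^sub>v v)" using P v by simp
      then show "B.zmod (G *\<^sub>v v) \<longleftrightarrow> B.zmod v"
        unfolding zmod mult_mat_vec_smult[OF G v] using sB[OF v] sB[OF Gc[OF v]] by blast
    qed
    then show ?thesis unfolding zmod by blast
  qed
  have redA: "A.zmod (A.redm G *\<^sub>v v) \<longleftrightarrow> A.zmod (G *\<^sub>v v)" if "G \<in> carrier_mat k k" "v \<in> carrier_vec k" for G v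
    using A.zmod_cong_iff[OF _ _ A.redm_mult_vec_cong[OF that]] that A.redm_carrier[OF that(1)] by auto
  have redB: "B.zmod (B.redm G *\<^sub>v v) \<longleftrightarrow> B.zmod (G *\<^sub>v v)" if "G \<in> carrier_mat k k" "v \<in> carrier_vec k" for G v
    using B.zmod_cong_iff[OF _ _ B.redm_mult_vec_cong[OF that]] that B.redm_carrier[OF that(1)] by auto
  have "bij_betw (\<lambda>G. (A.redm G, B.redm G)) P.aut_mats (A.aut_mats \<times> B.aut_mats)"
  proof (rule bij_betw_imageI)
    show "inj_on (\<lambda>G. (A.redm G, B.redm G)) P.aut_mats"
    proof (rule inj_onI)
      fix G H assume GH: "G \<in> P.aut_mats" "H \<in> P.aut_mats" and e: "(A.redm G, B.redm G) = (A.redm H, B.redm H)"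
      have c: "G \<in> carrier_mat k k" "H \<in> carrier_mat k k" "P.redm G = G" "P.redm H = H"
        using GH by (auto simp: P.aut_mats_def)
      have "P.zmod (G *\<^sub>v u - H *\<^sub>v u)" if "u \<in> carrier_vec k" for u
        unfolding zmod using A.redm_eq_iff[OF c(1,2)] B.redm_eq_iff[OF c(1,2)] e that by simp
      then have "P.redm G = P.redm H" using P.redm_eq_iff[OF c(1,2)] by blast
      then show "G = H" using c by simp
    qed
    show "(\<lambda>G. (A.redm G, B.redm G)) ` P.aut_mats = A.aut_mats \<times> B.aut_mats"
    proof (intro equalityI subsetI)
      fix x assume "x \<in> (\<lambda>G. (A.redm G, B.redm G)) ` P.aut_mats"
      then obtain G where G: "G \<in> P.aut_mats" "x = (A.redm G, B.redm G)" by blast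
      have Gc: "G \<in> carrier_mat k k" using G by (simp add: P.aut_mats_def)
      have "A.redm (A.redm G) = A.redm G" "B.redm (B.redm G) = B.redm G"
        using Gc by (auto intro!: eq_matI simp: A.redm_def B.redm_def)
      then show "x \<in> A.aut_mats \<times> B.aut_mats"
        using G Pa[OF Gc] redA[OF Gc] redB[OF Gc] A.redm_carrier[OF Gc] B.redm_carrier[OF Gc]
        by (simp add: A.aut_mats_def B.aut_mats_def P.aut_mats_def)
    next
      fix x assume "x \<in> A.aut_mats \<times> B.aut_mats"
      then obtain G H where x: "x = (G, H)" and G: "G \<in> A.aut_mats" and H: "H \<in> B.aut_mats" by blast
      have c: "G \<in> carrier_mat k k" "H \<in> carrier_mat k k" "A.redm G = G" "B.redm H = H"
        using G H by (auto simp: A.aut_mats_def B.aut_mats_def)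
      have "\<forall>i j. \<exists>z. i < k \<longrightarrow> j < k \<longrightarrow> z mod as ! i = G $$ (i,j) mod as ! i \<and> z mod bs ! i = H $$ (i,j) mod bs ! i"
        using poly_chinese_remainder cop by meson
      then obtain z where z: "\<And>i j. i < k \<Longrightarrow> j < k \<Longrightarrow> z i j mod as ! i = G $$ (i,j) mod as ! i"
        "\<And>i j. i < k \<Longrightarrow> j < k \<Longrightarrow> z i j mod bs ! i = H $$ (i,j) mod bs ! i" by metis
      define K where "K = mat k k (\<lambda>(i,j). z i j mod ps ! i)"
      have Kc: "K \<in> carrier_mat k k" by (simp add: K_def)
      have KA: "A.redm K = G"
      proof -
        have "A.redm K = A.redm G"
          using c(1) z(1) ps(2) by (intro eq_matI) (auto simp: A.redm_def K_def mod_mod_cancel)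
        then show ?thesis using c by simp
      qed
      have KB: "B.redm K = H"
      proof -
        have "B.redm K = B.redm H"
          using c(2) z(2) ps(2) by (intro eq_matI) (auto simp: B.redm_def K_def mod_mod_cancel)
        then show ?thesis using c by simp
      qed
      have "P.redm K = K" by (intro eq_matI) (auto simp: P.redm_def K_def)
      moreover have "\<forall>v\<in>carrier_vec k. P.zmod (K *\<^sub>v v) \<longleftrightarrow> P.zmod v"
        unfolding Pa[OF Kc] using redA[OF Kc] redB[OF Kc] G H unfolding KA KB
        by (auto simp: A.aut_mats_def B.aut_mats_def)
      ultimately have "K \<in> P.aut_mats" using Kc by (simp add: P.aut_mats_def)
      then show "x \<in> (\<lambda>G. (A.redm G, B.redm G)) ` P.aut_mats"
        using x KA KB by (intro image_eqI[of _ _ K]) auto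
    qed
  qed
  then show ?thesis using bij_betw_same_card by (simp add: card_cartesian_product bij_betw_same_card)
qed

section \<open>Automorphisms of a primary module\<close>

lemma lin_comb_add:
  assumes "c \<in> carrier_vec (length vs)" "c' \<in> carrier_vec (length vs)"
  shows "lin_comb k vs (c + c') = lin_comb k vs c + lin_comb k vs c'"
  using assms by (intro eq_vecI) (auto simp: lin_comb_def sum.distrib distrib_right)

lemma dim_lin_comb[simp]: "dim_vec (lin_comb k vs c) = k"
  by (simp add: lin_comb_def)

text \<open>The partition is written in increasing order and padded with zeros to length
  \<open>k\<close>, in accordance with the order of invariant factors.\<close>

locale prime_power_list =
  fixes f :: "'a::{field_gcd,finite} poly" and lam :: "nat list" and k :: nat
  assumes irr: "irreducible f" and lenlam: "length lam = k" and sorted: "sorted lam"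
begin

lemma f0: "f \<noteq> 0"
  using irr by auto

sublocale factor_list "map (\<lambda>l. f ^ l) lam" k
  by unfold_locales (use f0 lenlam in auto)

lemma nth_ps: "i < k \<Longrightarrow> map (\<lambda>l. f ^ l) lam ! i = f ^ (lam ! i)"
  using lenlam by simp

text \<open>The length of the \<open>f^a\<close>-torsion of \<open>M\<close>; it is the number
  \<open>h_a\<close> of the partition, see \<open>h_part_eq_sum_min\<close>.\<close>

definition hsum :: "nat \<Rightarrow> nat" where
  "hsum a = (\<Sum>i<k. min a (lam ! i))"

definition T :: "nat \<Rightarrow> 'a poly vec set" where
  "T a = {g \<in> M. zmod (f ^ a \<cdot>\<^sub>v g)}"

lemma T_carrier: "g \<in> T a \<Longrightarrow> g \<in> carrier_vec k"
  by (simp add: T_def M_def)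

lemma finite_T: "finite (T a)"
  using card_M_torsion(1) by (simp add: T_def)

lemma degree_gcd_powers: "degree (gcd (f ^ a) (f ^ b)) = degree f * min a b"
proof (cases "a \<le> b")
  case True
  then show ?thesis
    using f0 by (simp add: gcd_proj1_if_dvd le_imp_power_dvd degree_normalize_poly degree_power_eq mult.commute)
next
  case False
  then show ?thesis
    using f0 by (simp add: gcd_proj2_if_dvd le_imp_power_dvd degree_normalize_poly degree_power_eq mult.commute)
qed

lemma card_T: "card (T a) = CARD('a) ^ (degree f * hsum a)"
  unfolding T_def card_M_torsion(2)
  by (simp add: nth_ps degree_gcd_powers hsum_def sum_distrib_left)

text \<open>The possible last \<open>m\<close> columns of an automorphism; \<open>good gs l\<close> are the columns that can be put in
  front of \<open>gs\<close>.\<close>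

definition tails :: "nat \<Rightarrow> 'a poly vec list set" where
  "tails m = {gs. length gs = m \<and> (\<forall>t<m. gs ! t \<in> T (lam ! (k - m + t))) \<and>
     (\<forall>c\<in>carrier_vec m. zmod (lin_comb k gs c) \<longrightarrow> (\<forall>t<m. f ^ (lam ! (k - m + t)) dvd c $ t))}"

definition good :: "'a poly vec list \<Rightarrow> nat \<Rightarrow> 'a poly vec set" where
  "good gs l = {g \<in> T l. \<forall>a. \<forall>c\<in>carrier_vec (length gs).
     zmod (a \<cdot>\<^sub>v g + lin_comb k gs c) \<longrightarrow> f ^ l dvd a}"

lemma zmod_T_smult:
  assumes g: "g \<in> T l" and a: "f ^ l dvd a"
  shows "zmod (a \<cdot>\<^sub>v g)"
proof -
  obtain b where b: "a = f ^ l * b" using a by blast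
  have gc: "g \<in> carrier_vec k" using T_carrier g by blast
  have "zmod (b \<cdot>\<^sub>v (f ^ l \<cdot>\<^sub>v g))" using g gc zmod_smult[of "f ^ l \<cdot>\<^sub>v g" b] by (simp add: T_def)
  also have "b \<cdot>\<^sub>v (f ^ l \<cdot>\<^sub>v g) = a \<cdot>\<^sub>v g" using gc by (intro eq_vecI) (auto simp: b)
  finally show ?thesis .
qed

lemma lin_comb_zmod:
  assumes gs: "\<And>t. t < length gs \<Longrightarrow> gs ! t \<in> T (u t)" and c: "\<And>t. t < length gs \<Longrightarrow> f ^ u t dvd c $ t"
  shows "zmod (lin_comb k gs c)"
  unfolding zmod_def
proof (intro allI impI)
  fix i assume i: "i < k"
  have "map (\<lambda>l. f ^ l) lam ! i dvd c $ t * gs ! t $ i" if t: "t < length gs" for t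
    using zmod_T_smult[OF gs[OF t] c[OF t]] T_carrier[OF gs[OF t]] i by (auto simp: zmod_def)
  then show "map (\<lambda>l. f ^ l) lam ! i dvd lin_comb k gs c $ i"
    using i by (auto simp: lin_comb_def intro!: dvd_sum)
qed

lemma tails_Suc:
  assumes m: "m < k"
  shows "tails (Suc m) = (\<lambda>(gs, g). g # gs) ` (SIGMA gs:tails m. good gs (lam ! (k - Suc m)))"
    (is "_ = ?R")
proof -
  let ?l = "lam ! (k - Suc m)"
  have idx: "k - Suc m + Suc t = k - m + t" for t using m by simp
  show ?thesis
  proof (intro equalityI subsetI)
    fix hs assume hs: "hs \<in> tails (Suc m)"
    then obtain g gs where hs_eq: "hs = g # gs" by (cases hs) (auto simp: tails_def)
    have len: "length gs = m" using hs by (simp add: tails_def hs_eq)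
    have hT: "hs ! t \<in> T (lam ! (k - Suc m + t))" if "t < Suc m" for t using hs that by (simp add: tails_def)
    have gT: "g \<in> T ?l" using hT[of 0] by (simp add: hs_eq)
    have gsT: "gs ! t \<in> T (lam ! (k - m + t))" if "t < m" for t
      using hT[of "Suc t"] that unfolding idx by (simp add: hs_eq)
    have gc: "g \<in> carrier_vec k" using T_carrier gT by blast
    have div: "f ^ (lam ! (k - Suc m + t)) dvd c $ t" if "c \<in> carrier_vec (Suc m)" "zmod (lin_comb k hs c)" "t < Suc m" for c t
      using hs that unfolding tails_def by blast
    have "gs \<in> tails m"
    proof -
      have "f ^ (lam ! (k - m + t)) dvd c $ t" if c: "c \<in> carrier_vec m" "zmod (lin_comb k gs c)" "t < m" for c t
      proof -
        have "0 \<cdot>\<^sub>v g + lin_comb k gs c = lin_comb k gs c" using gc by (intro eq_vecI) (auto simp: lin_comb_def)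
        then have "zmod (lin_comb k hs (vCons 0 c))"
          unfolding hs_eq lin_comb_Cons[OF gc] using c by simp
        from div[OF _ this, of "Suc t", unfolded idx] show ?thesis using c by simp
      qed
      then show ?thesis using len gsT by (auto simp: tails_def)
    qed
    moreover have "g \<in> good gs ?l"
    proof -
      have "f ^ ?l dvd a" if "c \<in> carrier_vec m" "zmod (a \<cdot>\<^sub>v g + lin_comb k gs c)" for a c
        using div[of "vCons a c" 0] that unfolding hs_eq lin_comb_Cons[OF gc] by simp
      then show ?thesis using gT len by (auto simp: good_def)
    qed
    ultimately show "hs \<in> ?R" using hs_eq by force
  next
    fix hs assume "hs \<in> ?R"
    then obtain gs g where hs_eq: "hs = g # gs" and gs: "gs \<in> tails m" and g: "g \<in> good gs ?l" by auto
    have len: "length gs = m" using gs by (simp add: tails_def)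
    have gsT: "gs ! t \<in> T (lam ! (k - m + t))" if "t < m" for t using gs that by (simp add: tails_def)
    have gT: "g \<in> T ?l" using g by (simp add: good_def)
    have gc: "g \<in> carrier_vec k" using T_carrier gT by blast
    have "hs ! t \<in> T (lam ! (k - Suc m + t))" if "t < Suc m" for t
    proof (cases t)
      case 0
      then show ?thesis using gT by (simp add: hs_eq)
    next
      case (Suc t')
      then show ?thesis using gsT[of t'] that unfolding Suc idx by (simp add: hs_eq)
    qed
    moreover have "f ^ (lam ! (k - Suc m + t)) dvd c $ t"
      if c: "c \<in> carrier_vec (Suc m)" "zmod (lin_comb k hs c)" "t < Suc m" for c t
    proof -
      obtain a b where ab: "c = vCons a b" "b \<in> carrier_vec m" using c(1) by (cases c) auto
      have z: "zmod (a \<cdot>\<^sub>v g + lin_comb k gs b)" using c(2) unfolding hs_eq ab lin_comb_Cons[OF gc] .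
      \<comment> \<open>Goodness of \<open>g\<close> makes the term with coefficient
        \<open>a\<close> vanish, which leaves a relation between the vectors of \<open>gs\<close>
        alone.\<close>
      then have a: "f ^ ?l dvd a" using g ab len by (auto simp: good_def)
      have "zmod ((a \<cdot>\<^sub>v g + lin_comb k gs b) - a \<cdot>\<^sub>v g)"
        using z zmod_T_smult[OF gT a] gc by (intro zmod_diff) auto
      also have "(a \<cdot>\<^sub>v g + lin_comb k gs b) - a \<cdot>\<^sub>v g = lin_comb k gs b"
        using gc by (intro eq_vecI) (auto simp: lin_comb_def)
      finally have "\<forall>t<m. f ^ (lam ! (k - m + t)) dvd b $ t" using gs ab by (auto simp: tails_def)
      then show ?thesis
      proof (cases t)
        case 0
        then show ?thesis using a by (simp add: ab)
      next
        case (Suc t')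
        then show ?thesis using \<open>\<forall>t<m. _ t\<close> c(3) unfolding Suc idx by (simp add: ab)
      qed
    qed
    ultimately show "hs \<in> tails (Suc m)" using len by (auto simp: tails_def hs_eq)
  qed
qed

text \<open>Only zero is killed by \<open>f^0 = 1\<close>, and it satisfies the condition trivially;
  this is the value 1 in \<open>col_count\<close>.\<close>

lemma card_good_0: "card (good gs 0) = 1"
proof -
  have "good gs 0 = {0\<^sub>v k}"
  proof (intro equalityI subsetI)
    fix g assume g: "g \<in> good gs 0"
    then have gM: "g \<in> M" "zmod (1 \<cdot>\<^sub>v g)" by (auto simp: good_def T_def)
    have zM: "0\<^sub>v k \<in> M" by (auto simp: M_iff)
    have "1 \<cdot>\<^sub>v g = g - 0\<^sub>v k" using gM(1) by (intro eq_vecI) (auto simp: M_iff)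
    then show "g \<in> {0\<^sub>v k}" using M_eqI[OF gM(1) zM] gM by simp
  qed (auto simp: good_def T_def M_iff zmod_def)
  then show ?thesis by simp
qed

text \<open>A column \<open>g\<close> cannot be put in front of \<open>gs\<close> exactly if \<open>f^(l-1) g\<close> lies in the part of the
  \<open>f\<close>-socle spanned by \<open>gs\<close>, the set \<open>V\<close> below.\<close>

lemma card_good_pos:
  assumes gs: "gs \<in> tails m" and m: "m < k" and l: "l = lam ! (k - Suc m)" "0 < l"
  shows "card (good gs l) = CARD('a) ^ (degree f * hsum l) - CARD('a) ^ (degree f * (m + hsum (l - 1)))"
proof -
  define u where "u = (\<lambda>t. lam ! (k - m + t))"
  have len: "length gs = m" using gs by (simp add: tails_def)
  have gsT: "gs ! t \<in> T (u t)" if "t < m" for t using gs that by (simp add: tails_def u_def)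
  have indep: "f ^ u t dvd c $ t" if "c \<in> carrier_vec m" "zmod (lin_comb k gs c)" "t < m" for c t
    using gs that by (auto simp: tails_def u_def)
  \<comment> \<open>Here the order of the columns matters: those already chosen have exponents at
    least \<open>l\<close>, so the socle elements they yield are of the form
    \<open>f^(l-1) g\<close> with \<open>g\<close> in \<open>T l\<close>, as \<open>VT\<close>
    shows.\<close>
  have lu: "l \<le> u t" if "t < m" for t
    unfolding l u_def using sorted lenlam m that by (intro sorted_nth_mono) auto
  let ?lc = "lin_comb k gs"
  have lcc: "?lc c \<in> carrier_vec k" for c by simp
  have lc0: "zmod (?lc c)" if "\<And>t. t < m \<Longrightarrow> f ^ u t dvd c $ t" for c
    using lin_comb_zmod[of gs u c] gsT that len by simp
  define s where "s = (\<lambda>g. red (f ^ (l - 1) \<cdot>\<^sub>v g))"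
  \<comment> \<open>A socle element spanned by \<open>gs\<close> has coefficients
    \<open>f^(u t - 1) * b $ t\<close>, and \<open>b\<close> matters only modulo \<open>f\<close>.
    \<open>R\<close> collects these residues, and \<open>cf\<close> attaches the powers of
    \<open>f\<close>.\<close>
  define R where "R = {b \<in> carrier_vec m. \<forall>t<m. b $ t mod f = b $ t}"
  define cf where "cf = (\<lambda>b. vec m (\<lambda>t. f ^ (u t - 1) * b $ t))"
  define V where "V = (\<lambda>b. red (?lc (cf b))) ` R"
  have cfc: "cf b \<in> carrier_vec m" for b by (simp add: cf_def)
  have cardR: "card R = CARD('a) ^ (degree f * m)" and finR: "finite R"
  proof -
    interpret F: factor_list "replicate m f" m by unfold_locales (use f0 in auto)
    have "F.M = R" by (auto simp: F.M_iff R_def)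
    then show "card R = CARD('a) ^ (degree f * m)" "finite R"
      using F.card_M F.card_M_torsion(1) by (auto simp: mult.commute)
  qed
  have cardV: "card V = CARD('a) ^ (degree f * m)"
  proof -
    have "inj_on (\<lambda>b. red (?lc (cf b))) R"
    proof (rule inj_onI)
      fix b b' assume b: "b \<in> R" "b' \<in> R" and e: "red (?lc (cf b)) = red (?lc (cf b'))"
      have "zmod (?lc (cf b) - ?lc (cf b'))" using e red_eq_iff lcc by blast
      then have z: "zmod (?lc (cf b - cf b'))" using lin_comb_diff cfc len by metis
      have "b $ t = b' $ t" if t: "t < m" for t
      proof -
        have "f ^ u t dvd (cf b - cf b') $ t"
          using indep[OF _ z t] cfc by auto
        then have "f * f ^ (u t - 1) dvd (b $ t - b' $ t) * f ^ (u t - 1)"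
          using t lu[OF t] l(2) by (simp add: cf_def power_eq_if[of f "u t"] algebra_simps)
        then have "f dvd b $ t - b' $ t" using f0 by simp
        then show ?thesis using b t by (auto simp: R_def simp flip: mod_eq_dvd_iff)
      qed
      then show "b = b'" using b by (intro eq_vecI) (auto simp: R_def)
    qed
    then show ?thesis unfolding V_def using cardR by (simp add: card_image)
  qed
  have VT: "V \<subseteq> s ` T l"
  proof
    fix y assume "y \<in> V"
    then obtain b where b: "b \<in> R" "y = red (?lc (cf b))" by (auto simp: V_def)
    \<comment> \<open>The coefficients \<open>cf b\<close> divided by \<open>f^(l-1)\<close>, which
      \<open>lu\<close> permits; they give a preimage under \<open>s\<close>.\<close>
    define c where "c = vec m (\<lambda>t. f ^ (u t - l) * b $ t)"
    have cc: "c \<in> carrier_vec m" by (simp add: c_def)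
    define g where "g = red (?lc c)"
    have gz: "zmod (g - ?lc c)" using red_cong[OF lcc] by (simp add: g_def)
    have gM: "g \<in> M" "g \<in> carrier_vec k" by (auto simp: g_def)
    have fg: "zmod (x \<cdot>\<^sub>v g - ?lc (x \<cdot>\<^sub>v c))" for x
    proof -
      have "x \<cdot>\<^sub>v g - ?lc (x \<cdot>\<^sub>v c) = x \<cdot>\<^sub>v (g - ?lc c)"
        using gM lin_comb_smult[of c gs k x] cc len by (intro eq_vecI) (auto simp: right_diff_distrib)
      then show ?thesis using zmod_smult[OF _ gz] gM by simp
    qed
    have "f ^ (l - 1) \<cdot>\<^sub>v c = cf b"
    proof (rule eq_vecI)
      fix t assume "t < dim_vec (cf b)"
      then have t: "t < m" by (simp add: cf_def)
      have "u t - 1 = (l - 1) + (u t - l)" using lu[OF t] l(2) by simp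
      then have "f ^ (u t - 1) = f ^ (l - 1) * f ^ (u t - l)" by (metis power_add)
      then show "(f ^ (l - 1) \<cdot>\<^sub>v c) $ t = cf b $ t" using t by (simp add: c_def cf_def mult.assoc)
    qed (simp add: c_def cf_def)
    then have "s g = y"
      unfolding s_def b(2) using fg[of "f ^ (l - 1)"] gM by (subst red_eq_iff) auto
    moreover have "g \<in> T l"
    proof -
      have "f ^ u t dvd (f ^ l \<cdot>\<^sub>v c) $ t" if t: "t < m" for t
      proof -
        have "f ^ l * f ^ (u t - l) = f ^ u t" using lu[OF t] by (simp flip: power_add)
        then show ?thesis using t by (simp add: c_def flip: mult.assoc)
      qed
      then have "zmod (?lc (f ^ l \<cdot>\<^sub>v c))" by (rule lc0)
      then have "zmod (f ^ l \<cdot>\<^sub>v g)"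
        using zmod_cong_iff[OF _ _ fg[of "f ^ l"]] gM by simp
      then show ?thesis using gM by (simp add: T_def)
    qed
    ultimately show "y \<in> s ` T l" by blast
  qed
  have bad: "g \<notin> good gs l \<longleftrightarrow> s g \<in> V" if g: "g \<in> T l" for g
  proof
    have gc: "g \<in> carrier_vec k" using T_carrier g by blast
    assume "g \<notin> good gs l"
    then obtain a c where c: "c \<in> carrier_vec m" and z: "zmod (a \<cdot>\<^sub>v g + ?lc c)" and nd: "\<not> f ^ l dvd a"
      using g len by (auto simp: good_def)
    have a0: "a \<noteq> 0" using nd by auto
    obtain a' where a': "a = f ^ multiplicity f a * a'" "\<not> f dvd a'"
      using multiplicity_decompose'[of a f] a0 irr by (metis irreducible_not_unit)
    define i where "i = multiplicity f a"
    have il: "i < l"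
    proof (rule ccontr)
      assume "\<not> i < l"
      then have "f ^ l dvd f ^ i" by (intro le_imp_power_dvd) simp
      then show False using nd a'(1) by (metis dvd_mult2 i_def)
    qed
    have "coprime a' f"
      using irr a'(2) by (metis coprime_commute irreducible_imp_prime_elem prime_elem_imp_coprime)
    then obtain r w where rw: "r * a' + w * f = 1"
      using bezout_coefficients_fst_snd[of a' f] by (metis coprime_imp_gcd_eq_1)
    \<comment> \<open>Now \<open>a = f^i * a'\<close> with \<open>i < l\<close>, and
      \<open>r\<close> inverts \<open>a'\<close> modulo \<open>f\<close>. The multiple
      \<open>x * a\<close> is congruent to \<open>f^(l-1)\<close> modulo \<open>f^l\<close>, so the
      coefficient of \<open>g\<close> in the relation can be normalized to
      \<open>f^(l-1)\<close>.\<close>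
    define x where "x = r * f ^ (l - 1 - i)"
    have "x * a = f ^ (l - 1) - w * f ^ l"
    proof -
      have "x * a = r * a' * (f ^ (l - 1 - i) * f ^ i)"
        using a'(1) by (simp add: x_def i_def mult_ac)
      also have "f ^ (l - 1 - i) * f ^ i = f ^ (l - 1)" using il by (simp flip: power_add)
      also have "r * a' = 1 - w * f" using rw by (simp add: algebra_simps)
      also have "(1 - w * f) * f ^ (l - 1) = f ^ (l - 1) - w * f ^ l"
        using l(2) by (simp add: algebra_simps power_eq_if[of f l])
      finally show ?thesis .
    qed
    then have xa: "x * a + w * f ^ l = f ^ (l - 1)" by simp
    define d where "d = x \<cdot>\<^sub>v c"
    have dc: "d \<in> carrier_vec m" using c by (simp add: d_def)
    have z1: "zmod (f ^ (l - 1) \<cdot>\<^sub>v g + ?lc d)"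
    proof -
      have "zmod (x \<cdot>\<^sub>v (a \<cdot>\<^sub>v g + ?lc c) + (w * f ^ l) \<cdot>\<^sub>v g)"
        using zmod_smult[OF _ z, of x] zmod_T_smult[OF g, of "w * f ^ l"] gc by (intro zmod_add) auto
      also have "x \<cdot>\<^sub>v (a \<cdot>\<^sub>v g + ?lc c) + (w * f ^ l) \<cdot>\<^sub>v g = f ^ (l - 1) \<cdot>\<^sub>v g + ?lc d"
        unfolding d_def using gc c len xa[symmetric] lin_comb_smult[of c gs k x]
        by (intro eq_vecI) (auto simp: algebra_simps)
      finally show ?thesis .
    qed
    \<comment> \<open>Multiplication by \<open>f\<close> kills the term of \<open>g\<close>, as
      \<open>g\<close> lies in \<open>T l\<close>. What is left is a relation between the vectors of
      \<open>gs\<close>, which forces \<open>f^(u t - 1)\<close> to divide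
      \<open>d $ t\<close>.\<close>
    have z2: "zmod (?lc (f \<cdot>\<^sub>v d))"
    proof -
      have "zmod (f \<cdot>\<^sub>v (f ^ (l - 1) \<cdot>\<^sub>v g + ?lc d) - f ^ l \<cdot>\<^sub>v g)"
        using zmod_smult[OF _ z1, of f] g gc by (intro zmod_diff) (auto simp: T_def)
      also have "f \<cdot>\<^sub>v (f ^ (l - 1) \<cdot>\<^sub>v g + ?lc d) - f ^ l \<cdot>\<^sub>v g = ?lc (f \<cdot>\<^sub>v d)"
        using gc dc len l(2) lin_comb_smult[of d gs k f]
        by (intro eq_vecI) (auto simp: algebra_simps power_eq_if[of f l])
      finally show ?thesis .
    qed
    have "\<exists>v. d $ t = f ^ (u t - 1) * v" if t: "t < m" for t
    proof -
      have "f ^ u t dvd f * d $ t" using indep[OF _ z2 t] dc t by simp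
      then have "f * f ^ (u t - 1) dvd f * d $ t"
        using lu[OF t] l(2) by (simp add: power_eq_if[of f "u t"])
      then have "f ^ (u t - 1) dvd d $ t" using f0 by simp
      then show ?thesis by blast
    qed
    then obtain v where v: "\<And>t. t < m \<Longrightarrow> d $ t = f ^ (u t - 1) * v t" by metis
    \<comment> \<open>The residues of \<open>- v t\<close> modulo \<open>f\<close> make
      \<open>d + cf b\<close> divisible by the full powers \<open>f^(u t)\<close>, so that
      \<open>f^(l-1) g\<close> is congruent to the combination of \<open>gs\<close> with
      coefficients \<open>cf b\<close>.\<close>
    define b where "b = vec m (\<lambda>t. (- v t) mod f)"
    have bR: "b \<in> R" by (simp add: b_def R_def)
    have z3: "zmod (?lc (d + cf b))"
    proof (rule lc0)
      fix t assume t: "t < m"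
      have "f dvd v t + (- v t) mod f"
      proof -
        have "f dvd (- v t) mod f - (- v t)" by (simp flip: mod_eq_dvd_iff)
        then show ?thesis by (simp add: add.commute)
      qed
      then have "f ^ (u t - 1) * f dvd f ^ (u t - 1) * (v t + (- v t) mod f)" by (rule mult_dvd_mono[OF dvd_refl])
      moreover have "(d + cf b) $ t = f ^ (u t - 1) * (v t + (- v t) mod f)"
        using t v[OF t] dc by (simp add: cf_def b_def distrib_left right_diff_distrib)
      moreover have "f ^ (u t - 1) * f = f ^ u t"
        using lu[OF t] l(2) by (simp add: power_eq_if[of f "u t"] mult.commute)
      ultimately show "f ^ u t dvd (d + cf b) $ t" by (simp only:)
    qed
    have "zmod (f ^ (l - 1) \<cdot>\<^sub>v g - ?lc (cf b))"
    proof -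
      have "zmod ((f ^ (l - 1) \<cdot>\<^sub>v g + ?lc d) - ?lc (d + cf b))"
        using z1 z3 gc by (intro zmod_diff) auto
      also have "(f ^ (l - 1) \<cdot>\<^sub>v g + ?lc d) - ?lc (d + cf b) = f ^ (l - 1) \<cdot>\<^sub>v g - ?lc (cf b)"
        using gc lin_comb_add[of d gs "cf b" k] dc cfc len by (intro eq_vecI) auto
      finally show ?thesis .
    qed
    then have "s g = red (?lc (cf b))" unfolding s_def using gc by (subst red_eq_iff) auto
    then show "s g \<in> V" using bR by (auto simp: V_def)
  next
    have gc: "g \<in> carrier_vec k" using T_carrier g by blast
    assume "s g \<in> V"
    then obtain b where b: "s g = red (?lc (cf b))" by (auto simp: V_def)
    then have z: "zmod (f ^ (l - 1) \<cdot>\<^sub>v g - ?lc (cf b))"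
      unfolding s_def using gc by (subst (asm) red_eq_iff) auto
    have "f ^ (l - 1) \<cdot>\<^sub>v g - ?lc (cf b) = f ^ (l - 1) \<cdot>\<^sub>v g + ?lc (- 1 \<cdot>\<^sub>v cf b)"
      using gc lin_comb_smult[of "cf b" gs k "- 1"] cfc len by (intro eq_vecI) auto
    then have "zmod (f ^ (l - 1) \<cdot>\<^sub>v g + ?lc (- 1 \<cdot>\<^sub>v cf b))" using z by simp
    moreover have "\<not> f ^ l dvd f ^ (l - 1)"
    proof
      assume "f ^ l dvd f ^ (l - 1)"
      then have "f ^ (l - 1) * f dvd f ^ (l - 1) * 1"
        using l(2) by (simp add: power_eq_if[of f l] mult.commute)
      then have "f dvd 1" using f0 by (metis dvd_times_left_cancel_iff power_not_zero)
      then show False using irr by (metis irreducible_not_unit)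
    qed
    moreover have "- 1 \<cdot>\<^sub>v cf b \<in> carrier_vec (length gs)" using cfc len by simp
    ultimately show "g \<notin> good gs l" unfolding good_def by blast
  qed
  \<comment> \<open>The fibres of \<open>s\<close> on \<open>T l\<close> are cosets of its kernel,
    the elements killed by \<open>f^(l-1)\<close>.\<close>
  have fibre: "card {g \<in> T l. s g = y} = card (T (l - 1))" if y: "y \<in> V" for y
  proof -
    obtain g0 where g0: "g0 \<in> T l" "y = s g0" using VT y by blast
    have g0c: "g0 \<in> carrier_vec k" "g0 \<in> M" using T_carrier g0 by (auto simp: T_def)
    have "bij_betw (\<lambda>h. h + g0) (T (l - 1)) {g \<in> T l. s g = y}"
    proof (rule bij_betwI[where g = "\<lambda>g. g - g0"])
      show "(\<lambda>h. h + g0) \<in> T (l - 1) \<rightarrow> {g \<in> T l. s g = y}"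
      proof
        fix h assume h: "h \<in> T (l - 1)"
        then have hc: "h \<in> carrier_vec k" "h \<in> M" "zmod (f ^ (l - 1) \<cdot>\<^sub>v h)" using T_carrier by (auto simp: T_def)
        have "zmod (f ^ l \<cdot>\<^sub>v h + f ^ l \<cdot>\<^sub>v g0)"
          using zmod_T_smult[OF h, of "f ^ l"] g0 hc g0c by (intro zmod_add) (auto simp: T_def le_imp_power_dvd)
        also have "f ^ l \<cdot>\<^sub>v h + f ^ l \<cdot>\<^sub>v g0 = f ^ l \<cdot>\<^sub>v (h + g0)"
          using hc g0c by (intro eq_vecI) (auto simp: distrib_left)
        finally have "h + g0 \<in> T l" using M_add hc g0c by (simp add: T_def)
        moreover have "s (h + g0) = y"
        proof -
          have "f ^ (l - 1) \<cdot>\<^sub>v (h + g0) - f ^ (l - 1) \<cdot>\<^sub>v g0 = f ^ (l - 1) \<cdot>\<^sub>v h"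
            using hc g0c by (intro eq_vecI) (auto simp: distrib_left)
          then show ?thesis unfolding g0(2) s_def using hc g0c by (subst red_eq_iff) auto
        qed
        ultimately show "h + g0 \<in> {g \<in> T l. s g = y}" by simp
      qed
      show "(\<lambda>g. g - g0) \<in> {g \<in> T l. s g = y} \<rightarrow> T (l - 1)"
      proof
        fix g assume "g \<in> {g \<in> T l. s g = y}"
        then have g: "g \<in> T l" "s g = s g0" using g0 by auto
        have gc: "g \<in> carrier_vec k" "g \<in> M" using T_carrier g by (auto simp: T_def)
        have "zmod (f ^ (l - 1) \<cdot>\<^sub>v g - f ^ (l - 1) \<cdot>\<^sub>v g0)"
          using g(2) gc g0c unfolding s_def by (subst (asm) red_eq_iff) auto
        also have "f ^ (l - 1) \<cdot>\<^sub>v g - f ^ (l - 1) \<cdot>\<^sub>v g0 = f ^ (l - 1) \<cdot>\<^sub>v (g - g0)"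
          using gc g0c by (intro eq_vecI) (auto simp: right_diff_distrib)
        finally have "zmod (f ^ (l - 1) \<cdot>\<^sub>v (g - g0))" .
        moreover have "g - g0 \<in> M"
          using gc g0c by (auto simp: M_iff poly_mod_diff_left)
        ultimately show "g - g0 \<in> T (l - 1)" by (simp add: T_def)
      qed
      show "h + g0 - g0 = h" if "h \<in> T (l - 1)" for h
        using T_carrier[OF that] g0c by (intro eq_vecI) auto
      show "g - g0 + g0 = g" if "g \<in> {g \<in> T l. s g = y}" for g
        using T_carrier[of g l] that g0c by (intro eq_vecI) auto
    qed
    then show ?thesis by (rule bij_betw_same_card[symmetric])
  qed
  let ?Bad = "{g \<in> T l. s g \<in> V}"
  have finV: "finite V" using finR by (simp add: V_def)
  have "card ?Bad = (\<Sum>y\<in>V. card {g \<in> T l. s g = y})"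
  proof -
    have "(\<Sum>y\<in>V. \<Sum>g\<in>{g \<in> ?Bad. s g = y}. 1) = (\<Sum>g\<in>?Bad. (1::nat))"
      using finite_T finV by (intro sum.group) auto
    moreover have "{g \<in> ?Bad. s g = y} = {g \<in> T l. s g = y}" if "y \<in> V" for y using that by auto
    ultimately show ?thesis by simp
  qed
  also have "\<dots> = CARD('a) ^ (degree f * (m + hsum (l - 1)))"
    using fibre cardV by (simp add: card_T distrib_left power_add)
  finally have cb: "card ?Bad = CARD('a) ^ (degree f * (m + hsum (l - 1)))" .
  have "good gs l = T l - ?Bad"
    using bad by (auto simp: good_def)
  then have "card (good gs l) = card (T l) - card ?Bad"
    using finite_T by (simp add: card_Diff_subset)
  then show ?thesis using cb by (simp add: card_T)
qed

text \<open>After column \<open>j\<close> there stand \<open>k - Suc j\<close> columns, so this is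
  the size of \<open>good\<close> for \<open>m = k - Suc j\<close> and
  \<open>l = lam ! j\<close>.\<close>

definition col_count :: "nat \<Rightarrow> nat" where
  "col_count j = (if lam ! j = 0 then 1 else
     CARD('a) ^ (degree f * hsum (lam ! j)) - CARD('a) ^ (degree f * (k - Suc j + hsum (lam ! j - 1))))"

lemma card_tails:
  "m \<le> k \<Longrightarrow> finite (tails m) \<and> card (tails m) = (\<Prod>i<m. col_count (k - Suc i))"
proof (induction m)
  case 0
  have "tails 0 = {[]}" by (auto simp: tails_def)
  then show ?case by simp
next
  case (Suc m)
  let ?l = "lam ! (k - Suc m)"
  have IH: "finite (tails m)" "card (tails m) = (\<Prod>i<m. col_count (k - Suc i))" using Suc by auto
  have fing: "finite (good gs ?l)" for gs using finite_T by (auto simp: good_def intro: finite_subset)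
  have c: "card (good gs ?l) = col_count (k - Suc m)" if "gs \<in> tails m" for gs
    using card_good_pos[OF that, of ?l] card_good_0[of gs] Suc.prems by (cases "?l = 0") (auto simp: col_count_def)
  have "inj_on (\<lambda>(gs, g). g # gs) (SIGMA gs:tails m. good gs ?l)" by (auto simp: inj_on_def)
  then have "card (tails (Suc m)) = card (SIGMA gs:tails m. good gs ?l)"
    using tails_Suc[of m] Suc.prems by (simp add: card_image)
  also have "\<dots> = (\<Prod>i<Suc m. col_count (k - Suc i))"
    using IH fing c by (subst card_SigmaI) auto
  finally show ?case
    using tails_Suc[of m] Suc.prems IH fing by auto
qed

text \<open>A matrix acts on \<open>M\<close> iff column \<open>t\<close> is killed by
  \<open>f^(lam ! t)\<close>, which annihilates generator \<open>t\<close>, and the action is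
  injective iff the columns satisfy only the trivial relations. These are the two conditions of
  \<open>tails k\<close>.\<close>

lemma card_aut_mats_prime_power: "card aut_mats = (\<Prod>j<k. col_count j)"
proof -
  have lc: "lin_comb k (cols G) c = G *\<^sub>v c" if "G \<in> carrier_mat k k" "c \<in> carrier_vec k" for G and c :: "'a poly vec"
    using that by (intro eq_vecI) (auto simp: lin_comb_def scalar_prod_def lessThan_atLeast0 mult.commute intro!: sum.cong)
  have iff: "G \<in> aut_mats \<longleftrightarrow> cols G \<in> tails k" if G: "G \<in> carrier_mat k k" for G
  proof
    assume a: "G \<in> aut_mats"
    then have r: "redm G = G" and z: "\<And>v. v \<in> carrier_vec k \<Longrightarrow> zmod (G *\<^sub>v v) \<longleftrightarrow> zmod v" by (auto simp: aut_mats_def)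
    have "col G t \<in> T (lam ! t)" if t: "t < k" for t
    proof -
      have "zmod (f ^ (lam ! t) \<cdot>\<^sub>v unit_vec k t)" using t by (auto simp: zmod_def nth_ps unit_vec_def)
      then have "zmod (G *\<^sub>v (f ^ (lam ! t) \<cdot>\<^sub>v unit_vec k t))" using z by simp
      then have "zmod (f ^ (lam ! t) \<cdot>\<^sub>v col G t)"
        using mult_mat_vec_smult[OF G, of "unit_vec k t"] mult_mat_unit_vec[OF G t] by simp
      then show ?thesis using r redm_eq_self_iff[OF G] t by (simp add: T_def)
    qed
    moreover have "f ^ (lam ! t) dvd c $ t" if "c \<in> carrier_vec k" "zmod (G *\<^sub>v c)" "t < k" for c t
      using z[OF that(1)] that by (auto simp: zmod_def nth_ps)
    ultimately show "cols G \<in> tails k" using G lc by (auto simp: tails_def)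
  next
    assume t: "cols G \<in> tails k"
    have colT: "col G t \<in> T (lam ! t)" if "t < k" for t
      using t that G by (auto simp: tails_def)
    have "zmod (G *\<^sub>v v) \<longleftrightarrow> zmod v" if v: "v \<in> carrier_vec k" for v
    proof
      assume "zmod (G *\<^sub>v v)"
      then show "zmod v" using t v G lc[OF G v] by (auto simp: tails_def zmod_def nth_ps)
    next
      assume zv: "zmod v"
      have "zmod (lin_comb k (cols G) v)"
        using colT zv G by (intro lin_comb_zmod[where u = "\<lambda>t. lam ! t"]) (auto simp: zmod_def nth_ps)
      then show "zmod (G *\<^sub>v v)" using lc[OF G v] by simp
    qed
    moreover have "redm G = G" using redm_eq_self_iff[OF G] colT by (auto simp: T_def)
    ultimately show "G \<in> aut_mats" using G by (simp add: aut_mats_def)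
  qed
  have "bij_betw cols aut_mats (tails k)"
  proof (rule bij_betwI[where g = "mat_of_cols k"])
    show "cols \<in> aut_mats \<rightarrow> tails k" using iff by (auto simp: aut_mats_def)
    have gsc: "set gs \<subseteq> carrier_vec k" "length gs = k" if "gs \<in> tails k" for gs
    proof -
      show l: "length gs = k" using that by (simp add: tails_def)
      have "gs ! t \<in> carrier_vec k" if "t < k" for t
        using \<open>gs \<in> tails k\<close> that T_carrier unfolding tails_def by blast
      then show "set gs \<subseteq> carrier_vec k" using l by (metis in_set_conv_nth subsetI)
    qed
    then show "mat_of_cols k \<in> tails k \<rightarrow> aut_mats"
      using iff by (metis cols_mat_of_cols funcsetI mat_of_cols_carrier(1))
    show "mat_of_cols k (cols G) = G" if "G \<in> aut_mats" for G
      using that by (auto simp: aut_mats_def)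
    show "cols (mat_of_cols k gs) = gs" if "gs \<in> tails k" for gs
      using gsc[OF that] by simp
  qed
  then have "card aut_mats = card (tails k)" by (rule bij_betw_same_card)
  also have "\<dots> = (\<Prod>i<k. col_count (k - Suc i))" using card_tails[of k] by simp
  also have "\<dots> = (\<Prod>j<k. col_count j)" by (rule prod.nat_diff_reindex)
  finally show ?thesis .
qed

end

section \<open>The centralizer factors\<close>

text \<open>Both sides count the cells in the first \<open>i\<close> columns of the diagram, by
  columns and by rows.\<close>

lemma h_part_eq_sum_min:
  "h_part lam i = (\<Sum>t<length lam. min i (lam ! t))"
proof -
  have "h_part lam i = (\<Sum>j=1..i. \<Sum>t<length lam. if j \<le> lam ! t then 1 else 0)"
  proof -
    have "conj_part lam j = (\<Sum>t<length lam. if j \<le> lam ! t then 1 else 0)" for j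
    proof -
      have "{t. t < length lam \<and> j \<le> lam ! t} = {..<length lam} \<inter> {t. j \<le> lam ! t}" by auto
      then show ?thesis unfolding conj_part_def by (simp add: sum.If_cases)
    qed
    then show ?thesis unfolding h_part_def by simp
  qed
  also have "\<dots> = (\<Sum>t<length lam. \<Sum>j=1..i. if j \<le> lam ! t then 1 else 0)" by (rule sum.swap)
  also have "\<dots> = (\<Sum>t<length lam. min i (lam ! t))"
  proof (rule sum.cong[OF refl])
    fix t
    have "{1..i} \<inter> {j. j \<le> lam ! t} = {1..min i (lam ! t)}" by auto
    then show "(\<Sum>j=1..i. if j \<le> lam ! t then 1 else 0) = min i (lam ! t)" by (simp add: sum.If_cases)
  qed
  finally show ?thesis .
qed

lemma conj_part_rev_filter:
  assumes "1 \<le> i"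
  shows "conj_part (rev (filter (\<lambda>l. 0 < l) lam)) i = card {t. t < length lam \<and> i \<le> lam ! t}"
proof -
  have c: "conj_part mu i = length (filter (\<lambda>l. i \<le> l) mu)" for mu
    unfolding conj_part_def by (simp add: length_filter_conv_card)
  have "conj_part (rev (filter (\<lambda>l. 0 < l) lam)) i = length (filter (\<lambda>l. i \<le> l) (filter (\<lambda>l. 0 < l) lam))"
    unfolding c by (simp add: rev_filter[symmetric])
  also have "filter (\<lambda>l. i \<le> l) (filter (\<lambda>l. 0 < l) lam) = filter (\<lambda>l. i \<le> l) lam"
    using assms by (auto simp: intro!: filter_cong)
  finally show ?thesis by (simp add: length_filter_conv_card)
qed

lemma h_part_rev_filter:
  "h_part (rev (filter (\<lambda>l. 0 < l) lam)) i = (\<Sum>t<length lam. min i (lam ! t))"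
proof -
  have "h_part (rev (filter (\<lambda>l. 0 < l) lam)) i = h_part lam i"
    unfolding h_part_def by (intro sum.cong) (auto simp: conj_part_rev_filter conj_part_def[of lam])
  then show ?thesis by (simp add: h_part_eq_sum_min)
qed

lemma sorted_ge_set:
  assumes "sorted lam" "length lam = k"
  shows "{t. t < k \<and> i \<le> lam ! t} = {k - card {t. t < k \<and> i \<le> lam ! t}..<k}"
proof -
  let ?A = "{t. t < k \<and> i \<le> lam ! t}"
  define a where "a = (LEAST t. t = k \<or> t \<in> ?A)"
  have a: "a = k \<or> a \<in> ?A" unfolding a_def by (rule LeastI[of _ k]) simp
  have least: "a \<le> t" if "t \<in> ?A" for t unfolding a_def using that by (intro Least_le) simp
  have ak: "a \<le> k" unfolding a_def by (rule Least_le) simp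
  have "?A = {a..<k}"
  proof (intro equalityI subsetI)
    fix t assume t: "t \<in> {a..<k}"
    then have "a \<in> ?A" using a by auto
    then have "i \<le> lam ! a" by simp
    also have "lam ! a \<le> lam ! t" using t assms by (intro sorted_nth_mono) auto
    finally show "t \<in> ?A" using t by simp
  qed (use least in auto)
  then show ?thesis using ak by simp
qed

text \<open>The positions \<open>j\<close> with \<open>lam ! j = i\<close> form an interval of
  length \<open>m_i\<close>. Since \<open>h_i\<close> exceeds \<open>h_(i-1)\<close> by the number
  of parts that are at least \<open>i\<close>, the quantity \<open>k - Suc j + h (i - 1)\<close>
  runs on this interval through \<open>h_i - 1, ..., h_i - m_i\<close>, so the factors match one by
  one.\<close>

lemma c_fun_eq_prod:
  assumes sorted: "sorted lam" and len: "length lam = k" and q: "0 < q"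
  defines "h \<equiv> \<lambda>a. \<Sum>t<k. min a (lam ! t)"
  shows "c_fun q e (rev (filter (\<lambda>l. 0 < l) lam)) =
    (\<Prod>j<k. if lam ! j = 0 then 1 else real q ^ (e * h (lam ! j)) - real q ^ (e * (k - Suc j + h (lam ! j - 1))))"
proof -
  let ?mu = "rev (filter (\<lambda>l. 0 < l) lam)"
  let ?F = "\<lambda>j. real q ^ (e * h (lam ! j)) - real q ^ (e * (k - Suc j + h (lam ! j - 1)))"
  let ?N = "Max (insert 0 (set ?mu))"
  let ?c = "\<lambda>i. card {t. t < k \<and> i \<le> lam ! t}"
  have le: "lam ! j \<le> ?N" if "j < k" for j
    using that len by (cases "lam ! j = 0") (auto intro!: Max_ge)
  have block: "(\<Prod>j\<in>{j. j < k \<and> lam ! j = i}. ?F j)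
      = (\<Prod>j=1..m_part ?mu i. real q ^ (e * h_part ?mu i) - real q ^ (e * (h_part ?mu i - j)))"
    if i: "1 \<le> i" for i
  proof -
    have c1: "conj_part ?mu i = ?c i" "conj_part ?mu (i + 1) = ?c (i + 1)"
      using conj_part_rev_filter[of i lam] conj_part_rev_filter[of "i + 1" lam] i len by auto
    have hp: "h_part ?mu i = h i" unfolding h_part_rev_filter h_def len ..
    have hs: "h i = h (i - 1) + ?c i"
    proof -
      have "h_part ?mu i = h_part ?mu (i - 1) + conj_part ?mu i"
        using i unfolding h_part_def by (cases i) auto
      then show ?thesis unfolding h_part_rev_filter c1 h_def len .
    qed
    have ck: "?c i \<le> k"
      using card_mono[of "{..<k}" "{t. t < k \<and> i \<le> lam ! t}"] by auto
    have sub: "?c (i + 1) \<le> ?c i" by (intro card_mono) auto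
    have "{j. j < k \<and> lam ! j = i} = {t. t < k \<and> i \<le> lam ! t} - {t. t < k \<and> i + 1 \<le> lam ! t}" by auto
    also have "\<dots> = {k - ?c i..<k} - {k - ?c (i + 1)..<k}"
      using sorted_ge_set[OF sorted len, of i] sorted_ge_set[OF sorted len, of "i + 1"] by simp
    also have "\<dots> = {k - ?c i..<k - ?c (i + 1)}" using sub ck by auto
    finally have set: "{j. j < k \<and> lam ! j = i} = {k - ?c i..<k - ?c (i + 1)}" .
    have "(\<Prod>j\<in>{j. j < k \<and> lam ! j = i}. ?F j)
        = (\<Prod>j=1..m_part ?mu i. real q ^ (e * h i) - real q ^ (e * (h i - j)))"
    proof (rule prod.reindex_bij_witness[where i = "\<lambda>j. k - ?c i + j - 1" and j = "\<lambda>j. j + 1 - (k - ?c i)"])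
      fix j assume j: "j \<in> {j. j < k \<and> lam ! j = i}"
      then have jr: "k - ?c i \<le> j" "j < k - ?c (i + 1)" unfolding set by auto
      show "k - ?c i + (j + 1 - (k - ?c i)) - 1 = j" using jr by simp
      show "j + 1 - (k - ?c i) \<in> {1..m_part ?mu i}" unfolding m_part_def c1 using jr sub ck by auto
      have "h i - (j + 1 - (k - ?c i)) = k - Suc j + h (i - 1)" using hs jr ck by simp
      then show "real q ^ (e * h i) - real q ^ (e * (h i - (j + 1 - (k - ?c i)))) = ?F j" using j by simp
    next
      fix j assume j: "j \<in> {1..m_part ?mu i}"
      then have jr: "1 \<le> j" "j \<le> ?c i - ?c (i + 1)" unfolding m_part_def c1 by auto
      show "k - ?c i + j - 1 + 1 - (k - ?c i) = j" using jr by simp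
      show "k - ?c i + j - 1 \<in> {j. j < k \<and> lam ! j = i}" unfolding set using jr ck sub by auto
    qed
    then show ?thesis unfolding hp .
  qed
  have "(\<Prod>j<k. if lam ! j = 0 then 1 else ?F j) = (\<Prod>j\<in>{j. j < k \<and> lam ! j \<noteq> 0}. ?F j)"
  proof -
    have "{..<k} \<inter> - {j. lam ! j = 0} = {j. j < k \<and> lam ! j \<noteq> 0}" by auto
    then show ?thesis by (simp add: prod.If_cases)
  qed
  also have "\<dots> = (\<Prod>i\<in>{1..?N}. \<Prod>j\<in>{j\<in>{j. j < k \<and> lam ! j \<noteq> 0}. lam ! j = i}. ?F j)"
    using le by (intro prod.group[symmetric]) auto
  also have "\<dots> = (\<Prod>i\<in>{1..?N}. \<Prod>j\<in>{j. j < k \<and> lam ! j = i}. ?F j)"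
    by (intro prod.cong) auto
  also have "\<dots> = c_fun q e ?mu"
    unfolding c_fun_def
  proof (rule prod.cong[OF refl])
    fix i assume "i \<in> {1..?N}"
    then have "1 \<le> i" by simp
    then show "(\<Prod>j\<in>{j. j < k \<and> lam ! j = i}. ?F j)
      = (\<Prod>j=1..m_part ?mu i. real q ^ (e * h_part ?mu i) - real q ^ (e * (h_part ?mu i - j)))"
      by (rule block)
  qed
  finally show ?thesis ..
qed

section \<open>From prime powers to arbitrary tuples of invariant factors\<close>

lemma prime_monic_iff:
  fixes f :: "'a::field_gcd poly"
  shows "lead_coeff f = 1 \<and> irreducible f \<longleftrightarrow> prime f"
proof
  assume "lead_coeff f = 1 \<and> irreducible f"
  then show "prime f"
    using normalize_monic[of f] irreducible_imp_prime_elem[of f] by (auto simp: prime_def)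
next
  assume p: "prime f"
  then have "f \<noteq> 0" "normalize f = f" by (auto simp: prime_def)
  then show "lead_coeff f = 1 \<and> irreducible f"
    using lead_coeff_normalize_poly[of f] p by (simp add: prime_elem_imp_irreducible)
qed

lemma inv_factor_tuple_nonzero:
  assumes "is_inv_factor_tuple ps" "p \<in> set ps"
  shows "p \<noteq> 0"
  using assms by (auto simp: is_inv_factor_tuple_def)

lemma S_set_eq_prime_factors:
  assumes "is_inv_factor_tuple ps"
  shows "S_set ps = prime_factors (prod_list ps)"
proof -
  have "prod_list ps \<noteq> 0" using inv_factor_tuple_nonzero[OF assms] by (auto simp: prod_list_zero_iff)
  then show ?thesis
    unfolding S_set_def prime_factors_dvd[OF \<open>prod_list ps \<noteq> 0\<close>] using prime_monic_iff by blast
qed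

lemma prime_dvd_prod_listE:
  assumes "prime f" "f dvd prod_list ps"
  shows "\<exists>p\<in>set ps. f dvd p"
  using assms by (induction ps) (auto simp: prime_dvd_mult_iff not_prime_unit)

lemma multiplicity_sorted:
  assumes ps: "is_inv_factor_tuple ps"
  shows "sorted (map (multiplicity f) ps)"
  unfolding sorted_iff_nth_mono_less
proof (intro allI impI)
  fix i j assume ij: "i < j" "j < length (map (multiplicity f) ps)"
  have "ps ! i dvd ps ! j"
    using chain_dvd[of "length ps" "(!) ps" i j] ps ij by (auto simp: is_inv_factor_tuple_def)
  then show "map (multiplicity f) ps ! i \<le> map (multiplicity f) ps ! j"
    using ij inv_factor_tuple_nonzero[OF ps, of "ps ! j"] by (auto intro!: dvd_imp_multiplicity_le)
qed

text \<open>Along a divisibility chain the multiplicities increase, so the positive ones are those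
  from index \<open>r\<close> on; \<open>f \<in> S_set ps\<close> ensures that the index sought by
  \<open>LEAST\<close> exists. In this form it is visible that factors 1 at the front have no
  effect.\<close>

lemma Phi_eq_filter:
  assumes ps: "is_inv_factor_tuple ps" and f: "f \<in> S_set ps"
  shows "Phi ps f = rev (filter (\<lambda>l. 0 < l) (map (multiplicity f) ps))"
proof -
  let ?k = "length ps" and ?lam = "map (multiplicity f) ps"
  let ?P = "\<lambda>i. 1 \<le> i \<and> i \<le> ?k \<and> multiplicity f (ps ! (i - 1)) > 0"
  have pf: "prime f" "f dvd prod_list ps" using f prime_monic_iff by (auto simp: S_set_def)
  then obtain p where p: "p \<in> set ps" "f dvd p" using prime_dvd_prod_listE by blast
  then obtain i where i: "i < ?k" "ps ! i = p" by (auto simp: in_set_conv_nth)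
  have "\<not> is_unit f" using pf(1) not_prime_unit by blast
  then have "0 < multiplicity f p"
    using p inv_factor_tuple_nonzero[OF ps p(1)] by (simp add: multiplicity_gt_zero_iff)
  then have "?P (Suc i)" using i by simp
  define r where "r = (LEAST i. ?P i)"
  have r: "?P r" unfolding r_def by (rule LeastI[of ?P, OF \<open>?P (Suc i)\<close>])
  have least: "\<not> ?P i" if "i < r" for i using not_less_Least that unfolding r_def by blast
  obtain s where s: "r = Suc s" using r by (cases r) auto
  have sk: "s < ?k" "0 < ?lam ! s" using r s by auto
  have "filter (\<lambda>l. 0 < l) ?lam = filter (\<lambda>l. 0 < l) (take s ?lam) @ filter (\<lambda>l. 0 < l) (drop s ?lam)"
    by (metis append_take_drop_id filter_append)
  also have "filter (\<lambda>l. 0 < l) (take s ?lam) = []"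
  proof -
    have "take s ?lam ! i = 0" if "i < s" for i using least[of "Suc i"] that s sk by auto
    then show ?thesis using sk by (auto simp: filter_empty_conv in_set_conv_nth)
  qed
  also have "filter (\<lambda>l. 0 < l) (drop s ?lam) = drop s ?lam"
  proof -
    have "0 < drop s ?lam ! i" if "i < ?k - s" for i
    proof -
      have "?lam ! s \<le> ?lam ! (s + i)"
        using that by (intro sorted_nth_mono[OF multiplicity_sorted[OF ps]]) auto
      with sk(2) have "0 < ?lam ! (s + i)" by (rule order.strict_trans2)
      then show ?thesis using that sk by simp
    qed
    then show ?thesis by (auto simp: filter_id_conv in_set_conv_nth)
  qed
  also have "drop s ?lam = map (\<lambda>i. multiplicity f (ps ! (i - 1))) [r..<?k + 1]"
    unfolding s using sk by (intro nth_equalityI) (auto simp del: upt_Suc)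
  finally show ?thesis unfolding Phi_def Let_def r_def by simp
qed

definition num_aut :: "'a::{field_gcd,finite} poly list \<Rightarrow> nat" where
  "num_aut ps = card (factor_list.aut_mats ps (length ps))"

text \<open>Modulo 1 every matrix reduces to the zero matrix, which then represents the identity of
  the zero module.\<close>

lemma num_aut_ones: "num_aut (map (\<lambda>_. 1) ps :: 'a::{field_gcd,finite} poly list) = 1"
proof -
  let ?qs = "map (\<lambda>_. 1) ps :: 'a poly list" and ?k = "length ps"
  interpret factor_list ?qs ?k by unfold_locales auto
  have "aut_mats = {0\<^sub>m ?k ?k}"
  proof (intro equalityI subsetI)
    fix G assume G: "G \<in> aut_mats"
    then have Gc: "G \<in> carrier_mat ?k ?k" "redm G = G" by (auto simp: aut_mats_def)
    have "redm G = 0\<^sub>m ?k ?k" using Gc(1) unfolding redm_def by (intro eq_matI) auto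
    then show "G \<in> {0\<^sub>m ?k ?k}" using Gc by simp
  next
    fix G :: "'a poly mat" assume "G \<in> {0\<^sub>m ?k ?k}"
    then have G: "G = 0\<^sub>m ?k ?k" by simp
    have "redm G = G" unfolding G redm_def by (intro eq_matI) auto
    moreover have "zmod v" for v by (simp add: zmod_def)
    ultimately show "G \<in> aut_mats" by (simp add: aut_mats_def G)
  qed
  then show ?thesis by (simp add: num_aut_def)
qed

text \<open>\<open>xs\<close> merely indexes the factors and the exponents are arbitrary, so one
  prime at a time can be split off while the length of the lists stays fixed.\<close>

lemma num_aut_prime_powers:
  fixes u :: "'a::{field_gcd,finite} poly \<Rightarrow> 'b \<Rightarrow> nat"
  assumes "finite S" "\<And>f. f \<in> S \<Longrightarrow> prime f"
  shows "num_aut (map (\<lambda>p. \<Prod>f\<in>S. f ^ u f p) xs) = (\<Prod>f\<in>S. num_aut (map (\<lambda>p. f ^ u f p) xs))"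
  using assms
proof (induction S rule: finite_induct)
  case empty
  then show ?case using num_aut_ones[of xs] by simp
next
  case (insert f S)
  let ?k = "length xs"
  let ?as = "map (\<lambda>p. f ^ u f p) xs" and ?bs = "map (\<lambda>p. \<Prod>g\<in>S. g ^ u g p) xs"
  have f: "prime f" using insert by simp
  have f0: "g \<noteq> 0" if "g \<in> insert f S" for g using insert.prems[OF that] by auto
  have cop: "coprime (f ^ a) (\<Prod>g\<in>S. g ^ v g)" for a v
  proof (intro prod_coprime_right)
    fix g assume g: "g \<in> S"
    then have "coprime f g" using f insert primes_coprime[of f g] by auto
    then show "coprime (f ^ a) (g ^ v g)" by simp
  qed
  have "card (factor_list.aut_mats (map (\<lambda>p. \<Prod>g\<in>insert f S. g ^ u g p) xs) ?k)
     = card (factor_list.aut_mats ?as ?k) * card (factor_list.aut_mats ?bs ?k)"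
    using cop f0 insert(1,2) by (intro card_aut_mats_mult) auto
  then show ?case using insert by (simp add: num_aut_def)
qed

lemma num_aut_prime_power:
  fixes f :: "'a::{field_gcd,finite} poly"
  assumes f: "prime f" and sorted: "sorted lam"
  shows "real (num_aut (map (\<lambda>l. f ^ l) lam)) = c_fun CARD('a) (degree f) (rev (filter (\<lambda>l. 0 < l) lam))"
    and "0 < num_aut (map (\<lambda>l. f ^ l) lam)"
proof -
  let ?k = "length lam"
  have irr: "irreducible f" using f prime_monic_iff by blast
  interpret prime_power_list f lam ?k
    by unfold_locales (use irr sorted in auto)
  have q: "1 < CARD('a)" by (rule card_UNIV_gt_1)
  have e: "0 < degree f"
    using irr by (metis gr0I irreducible_not_unit is_unit_iff_degree f0)
  \<comment> \<open>All parts from position \<open>j\<close> on are at least \<open>lam ! j\<close>,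
    so passing from \<open>lam ! j - 1\<close> to \<open>lam ! j\<close> increases
    \<open>hsum\<close> by at least \<open>?k - j\<close>. The strict inequality makes the
    natural-number difference in \<open>col_count\<close> positive.\<close>
  have lt: "?k - Suc j + hsum (lam ! j - 1) < hsum (lam ! j)" if j: "j < ?k" "lam ! j \<noteq> 0" for j
  proof -
    let ?l = "lam ! j"
    have "hsum ?l = (\<Sum>i<?k. min (?l - 1) (lam ! i) + (if ?l \<le> lam ! i then 1 else 0))"
      unfolding hsum_def using j by (intro sum.cong) auto
    also have "\<dots> = hsum (?l - 1) + card ({..<?k} \<inter> {i. ?l \<le> lam ! i})"
      unfolding hsum_def by (simp add: sum.distrib sum.If_cases)
    finally have h: "hsum ?l = hsum (?l - 1) + card ({..<?k} \<inter> {i. ?l \<le> lam ! i})" .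
    have "{j..<?k} \<subseteq> {..<?k} \<inter> {i. ?l \<le> lam ! i}"
      using sorted by (auto intro: sorted_nth_mono)
    then have "card {j..<?k} \<le> card ({..<?k} \<inter> {i. ?l \<le> lam ! i})" by (intro card_mono) auto
    then show ?thesis using h j by simp
  qed
  have cc: "real (col_count j) = (if lam ! j = 0 then 1 else
     real CARD('a) ^ (degree f * hsum (lam ! j)) - real CARD('a) ^ (degree f * (?k - Suc j + hsum (lam ! j - 1))))"
    "0 < col_count j" if j: "j < ?k" for j
  proof -
    have *: "CARD('a) ^ (degree f * (?k - Suc j + hsum (lam ! j - 1))) < CARD('a) ^ (degree f * hsum (lam ! j))" if "lam ! j \<noteq> 0"
      using lt[OF j that] q e by (intro power_strict_increasing) auto
    then show "0 < col_count j" by (simp add: col_count_def)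
    show "real (col_count j) = (if lam ! j = 0 then 1 else
     real CARD('a) ^ (degree f * hsum (lam ! j)) - real CARD('a) ^ (degree f * (?k - Suc j + hsum (lam ! j - 1))))"
      using * by (simp add: col_count_def of_nat_diff less_imp_le)
  qed
  have n: "num_aut (map (\<lambda>l. f ^ l) lam) = (\<Prod>j<?k. col_count j)"
    unfolding num_aut_def using card_aut_mats_prime_power by simp
  show "0 < num_aut (map (\<lambda>l. f ^ l) lam)" unfolding n using cc(2) by (intro prod_pos) auto
  show "real (num_aut (map (\<lambda>l. f ^ l) lam)) = c_fun CARD('a) (degree f) (rev (filter (\<lambda>l. 0 < l) lam))"
  proof -
    have "real (num_aut (map (\<lambda>l. f ^ l) lam)) = (\<Prod>j<?k. if lam ! j = 0 then 1 else
     real CARD('a) ^ (degree f * hsum (lam ! j)) - real CARD('a) ^ (degree f * (?k - Suc j + hsum (lam ! j - 1))))"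
      unfolding n of_nat_prod using cc(1) by (intro prod.cong) auto
    also have "\<dots> = c_fun CARD('a) (degree f) (rev (filter (\<lambda>l. 0 < l) lam))"
      unfolding hsum_def using q by (intro c_fun_eq_prod[OF sorted refl, symmetric]) simp
    finally show ?thesis .
  qed
qed

text \<open>All factors are decomposed over the same set of primes, with exponent 0 where a prime
  does not divide; so every primary part is a list of the full length.\<close>

lemma num_aut_eq:
  fixes ps :: "'a::{field_gcd,finite} poly list"
  assumes ps: "is_inv_factor_tuple ps"
  shows "real (num_aut ps) = (\<Prod>f\<in>S_set ps. c_fun CARD('a) (degree f) (Phi ps f))" and "0 < num_aut ps"
proof -
  let ?S = "S_set ps"
  have fin: "finite ?S" unfolding S_set_eq_prime_factors[OF ps] by simp
  have pr: "prime f" if "f \<in> ?S" for f using that prime_monic_iff by (auto simp: S_set_def)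
  have P0: "prod_list ps \<noteq> 0" using inv_factor_tuple_nonzero[OF ps] by (auto simp: prod_list_zero_iff)
  have "(\<Prod>f\<in>?S. f ^ multiplicity f p) = p" if p: "p \<in> set ps" for p
  proof -
    have p0: "p \<noteq> 0" using inv_factor_tuple_nonzero[OF ps p] .
    have "p dvd prod_list ps" using p by (simp add: prod_list_dvd)
    then have sub: "prime_factors p \<subseteq> ?S"
      unfolding S_set_eq_prime_factors[OF ps] using P0 p0 by (simp add: dvd_prime_factors)
    have "(\<Prod>f\<in>?S. f ^ multiplicity f p) = (\<Prod>f\<in>prime_factors p. f ^ multiplicity f p)"
    proof (rule prod.mono_neutral_right[OF fin sub], intro ballI)
      fix f assume f: "f \<in> ?S - prime_factors p"
      then have "\<not> f dvd p" using pr p0 by (auto simp: in_prime_factors_iff)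
      then show "f ^ multiplicity f p = 1" by (simp add: not_dvd_imp_multiplicity_0)
    qed
    also have "\<dots> = normalize p" using p0 by (rule prod_prime_factors)
    also have "\<dots> = p" using ps p by (intro normalize_monic) (auto simp: is_inv_factor_tuple_def)
    finally show ?thesis .
  qed
  then have "map (\<lambda>p. \<Prod>f\<in>?S. f ^ multiplicity f p) ps = ps" by (simp add: map_idI)
  then have eq: "num_aut ps = (\<Prod>f\<in>?S. num_aut (map (\<lambda>p. f ^ multiplicity f p) ps))"
    using num_aut_prime_powers[OF fin pr, of "\<lambda>f p. multiplicity f p" ps] by simp
  have m: "map (\<lambda>p. f ^ multiplicity f p) ps = map (\<lambda>l. f ^ l) (map (multiplicity f) ps)" for f by simp
  show "0 < num_aut ps"
    unfolding eq m using num_aut_prime_power(2)[OF pr multiplicity_sorted[OF ps]] by (intro prod_pos) auto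
  show "real (num_aut ps) = (\<Prod>f\<in>?S. c_fun CARD('a) (degree f) (Phi ps f))"
    unfolding eq m of_nat_prod
  proof (intro prod.cong[OF refl])
    fix f assume f: "f \<in> ?S"
    show "real (num_aut (map (\<lambda>l. f ^ l) (map (multiplicity f) ps))) = c_fun CARD('a) (degree f) (Phi ps f)"
      using num_aut_prime_power(1)[OF pr[OF f] multiplicity_sorted[OF ps, of f]] Phi_eq_filter[OF ps f] by simp
  qed
qed

text \<open>The explicit formula settles this: factors 1 change neither the set of primes nor the
  positive multiplicities.\<close>

lemma num_aut_replicate_append:
  fixes ps :: "'a::{field_gcd,finite} poly list"
  assumes ps: "is_inv_factor_tuple ps" and ps': "is_inv_factor_tuple (replicate m 1 @ ps)"
  shows "num_aut (replicate m 1 @ ps) = num_aut ps"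
proof -
  have S: "S_set (replicate m 1 @ ps) = S_set ps" by (simp add: S_set_def)
  have "Phi (replicate m 1 @ ps) f = Phi ps f" if "f \<in> S_set ps" for f
    using Phi_eq_filter[OF ps' that[folded S]] Phi_eq_filter[OF ps that] by simp
  then have "real (num_aut (replicate m 1 @ ps)) = real (num_aut ps)"
    unfolding num_aut_eq(1)[OF ps] num_aut_eq(1)[OF ps'] S by simp
  then show ?thesis by simp
qed

section \<open>The count of simple matrices\<close>

lemma qbinom_0: "qbinom q k 0 = 1"
  by (simp add: qbinom_def)

lemma qbinom_Suc_self: "qbinom q k (Suc k) = 0"
  by (simp add: qbinom_def)

text \<open>One of the two q-analogues of Pascal's rule.\<close>

lemma qbinom_Suc_Suc:
  assumes q: "1 < q" and d: "d \<le> k"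
  shows "qbinom q (Suc k) (Suc d) = qbinom q k (Suc d) + real q ^ (k - d) * qbinom q k d"
proof -
  have nz: "real q ^ (i + 1) - 1 \<noteq> 0" for i
    using one_less_power[of "real q" "i + 1"] q by simp
  have 1: "qbinom q k (Suc d) = qbinom q k d * ((real q ^ (k - d) - 1) / (real q ^ (d + 1) - 1))"
    by (simp add: qbinom_def)
  have "qbinom q (Suc k) (Suc d) = (\<Prod>i<Suc d. real q ^ (Suc k - i) - 1) / (\<Prod>i<Suc d. real q ^ (i + 1) - 1)"
    by (simp only: qbinom_def prod_dividef)
  also have "(\<Prod>i<Suc d. real q ^ (Suc k - i) - 1) = (real q ^ (k + 1) - 1) * (\<Prod>i<d. real q ^ (k - i) - 1)"
    by (subst prod.lessThan_Suc_shift) simp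
  also have "(\<Prod>i<Suc d. real q ^ (i + 1) - 1) = (real q ^ (d + 1) - 1) * (\<Prod>i<d. real q ^ (i + 1) - 1)"
    by simp
  also have "((real q ^ (k + 1) - 1) * (\<Prod>i<d. real q ^ (k - i) - 1)) / ((real q ^ (d + 1) - 1) * (\<Prod>i<d. real q ^ (i + 1) - 1))
      = qbinom q k d * ((real q ^ (k + 1) - 1) / (real q ^ (d + 1) - 1))"
  proof -
    have "(a * b) / (c * e) = (b / e) * (a / c)" for a b c e :: real by (simp add: mult_ac)
    then show ?thesis by (simp only: qbinom_def prod_dividef)
  qed
  finally have 2: "qbinom q (Suc k) (Suc d) = qbinom q k d * ((real q ^ (k + 1) - 1) / (real q ^ (d + 1) - 1))" .
  have "real q ^ (k + 1) = real q ^ (k - d) * real q ^ (d + 1)"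
    using d by (simp flip: power_add)
  then have "(real q ^ (k + 1) - 1) / (real q ^ (d + 1) - 1) = (real q ^ (k - d) - 1) / (real q ^ (d + 1) - 1) + real q ^ (k - d)"
    using nz[of d] by (simp add: field_simps)
  then show ?thesis unfolding 1 2 by (simp add: algebra_simps)
qed

text \<open>Pascal's rule splits the sum for \<open>Suc k\<close> into \<open>x - q^(k+1)\<close>
  times the sum for \<open>k\<close> and a multiple of the sum for \<open>k\<close> at
  \<open>x / q\<close>; hence the induction over all \<open>x\<close>. It closes with
  \<open>(x - q^(k+1)) x^k + q^(k+1) x^k = x^(k+1)\<close>.\<close>

lemma sum_qbinom_prod:
  assumes q: "1 < q"
  shows "(\<Sum>d\<le>k. qbinom q k d * real q ^ (d * d) * (\<Prod>i=d+1..k. (x - real q ^ i))) = x ^ k"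
proof (induction k arbitrary: x)
  case 0
  then show ?case by (simp add: qbinom_def)
next
  case (Suc k)
  define A where "A = (\<lambda>d. real q ^ (d * d) * (\<Prod>i=d+1..Suc k. (x - real q ^ i)))"
  have q0: "real q \<noteq> 0" using q by simp
  have "(\<Sum>d\<le>Suc k. qbinom q (Suc k) d * A d) = A 0 + (\<Sum>d\<le>k. qbinom q (Suc k) (Suc d) * A (Suc d))"
    by (subst sum.atMost_Suc_shift) (simp add: qbinom_0)
  also have "(\<Sum>d\<le>k. qbinom q (Suc k) (Suc d) * A (Suc d))
      = (\<Sum>d\<le>k. qbinom q k (Suc d) * A (Suc d)) + (\<Sum>d\<le>k. real q ^ (k - d) * qbinom q k d * A (Suc d))"
    using q by (simp add: qbinom_Suc_Suc distrib_right sum.distrib)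
  also have "A 0 + ((\<Sum>d\<le>k. qbinom q k (Suc d) * A (Suc d)) + (\<Sum>d\<le>k. real q ^ (k - d) * qbinom q k d * A (Suc d)))
      = (\<Sum>d\<le>Suc k. qbinom q k d * A d) + (\<Sum>d\<le>k. real q ^ (k - d) * qbinom q k d * A (Suc d))"
    by (subst sum.atMost_Suc_shift) (simp add: qbinom_0)
  also have "(\<Sum>d\<le>Suc k. qbinom q k d * A d) = (\<Sum>d\<le>k. qbinom q k d * A d)"
    by (simp add: qbinom_Suc_self)
  also have "\<dots> = (\<Sum>d\<le>k. (x - real q ^ Suc k) * (qbinom q k d * real q ^ (d * d) * (\<Prod>i=d+1..k. (x - real q ^ i))))"
    by (intro sum.cong) (auto simp: A_def mult_ac)
  also have "\<dots> = (x - real q ^ Suc k) * x ^ k"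
    by (simp only: sum_distrib_left[symmetric] Suc.IH)
  \<comment> \<open>Taking \<open>q\<close> out of each of the \<open>k - d\<close> factors replaces
    \<open>x\<close> by \<open>x / q\<close>. Together with the power from Pascal's rule the
    exponents of \<open>q\<close> add up to \<open>2 k + 1 + d^2\<close>, so that
    \<open>q^(2 k + 1)\<close> comes out of the sum.\<close>
  also have "(\<Sum>d\<le>k. real q ^ (k - d) * qbinom q k d * A (Suc d))
     = (\<Sum>d\<le>k. real q ^ (2 * k + 1) * (qbinom q k d * real q ^ (d * d) * (\<Prod>i=d+1..k. (x / real q - real q ^ i))))"
  proof (rule sum.cong[OF refl])
    fix d assume "d \<in> {..k}"
    then have d: "d \<le> k" by simp
    have "(\<Prod>i=Suc d+1..Suc k. (x - real q ^ i)) = (\<Prod>i=d+1..k. (x - real q ^ Suc i))"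
      using prod.shift_bounds_cl_Suc_ivl[of "\<lambda>i. x - real q ^ i" "d + 1" k] by simp
    also have "\<dots> = (\<Prod>i=d+1..k. real q * (x / real q - real q ^ i))"
      using q0 by (intro prod.cong) (auto simp: right_diff_distrib)
    also have "\<dots> = real q ^ (k - d) * (\<Prod>i=d+1..k. (x / real q - real q ^ i))"
      by (simp add: prod.distrib)
    finally have A: "A (Suc d) = real q ^ (Suc d * Suc d) * (real q ^ (k - d) * (\<Prod>i=d+1..k. (x / real q - real q ^ i)))"
      unfolding A_def by simp
    have q3: "real q ^ (k - d) * (real q ^ (Suc d * Suc d) * real q ^ (k - d)) = real q ^ (2 * k + 1) * real q ^ (d * d)"
    proof -
      have "(k - d) + (Suc d * Suc d + (k - d)) = (2 * k + 1) + d * d" using d by simp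
      then show ?thesis by (metis power_add)
    qed
    have "K * b * (S * (K * P)) = C * (b * D * P)" if "K * (S * K) = C * D" for K b S P C D :: real
    proof -
      have "K * b * (S * (K * P)) = (K * (S * K)) * (b * P)" by (simp add: mult_ac)
      then show ?thesis unfolding that by (simp add: mult_ac)
    qed
    from this[OF q3] show "real q ^ (k - d) * qbinom q k d * A (Suc d)
        = real q ^ (2 * k + 1) * (qbinom q k d * real q ^ (d * d) * (\<Prod>i=d+1..k. (x / real q - real q ^ i)))"
      unfolding A .
  qed
  also have "\<dots> = real q ^ (2 * k + 1) * (x / real q) ^ k"
    by (simp only: sum_distrib_left[symmetric] Suc.IH)
  also have "\<dots> = real q ^ Suc k * x ^ k"
    using q0 by (simp add: power_divide mult_2 power_add)
  finally show ?case by (simp add: A_def algebra_simps)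
qed

text \<open>A matrix of full row rank amounts to its row space together with a basis of it. In the
  computation the powers \<open>q^i\<close> taken out of the factors are the same on both
  sides.\<close>

lemma qbinom_mult_surj:
  assumes q: "1 < q" and d: "d \<le> k"
  shows "qbinom q k d * (\<Prod>i<d. real q ^ d - real q ^ i) = (\<Prod>i<d. real q ^ k - real q ^ i)"
proof -
  have nz: "(\<Prod>i<d. real q ^ (i + 1) - 1) \<noteq> 0"
  proof -
    have "real q ^ (i + 1) - 1 \<noteq> 0" for i
      using one_less_power[of "real q" "i + 1"] q by simp
    then show ?thesis unfolding prod_zero_iff[OF finite_lessThan] by blast
  qed
  have e: "(\<Prod>i<d. real q ^ m - real q ^ i) = (\<Prod>i<d. real q ^ i) * (\<Prod>i<d. real q ^ (m - i) - 1)" if "d \<le> m" for m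
  proof -
    have "real q ^ m - real q ^ i = real q ^ i * (real q ^ (m - i) - 1)" if "i < d" for i
    proof -
      have "real q ^ m = real q ^ i * real q ^ (m - i)"
        using that \<open>d \<le> m\<close> by (simp flip: power_add)
      then show ?thesis by (simp add: right_diff_distrib)
    qed
    then show ?thesis by (simp add: prod.distrib[symmetric])
  qed
  have "(\<Prod>i<d. real q ^ (d - i) - 1) = (\<Prod>i<d. real q ^ (i + 1) - 1)"
  proof -
    have "(\<Prod>i<d. real q ^ (d - i) - 1) = (\<Prod>i<d. real q ^ (Suc (d - Suc i)) - 1)"
      by (intro prod.cong) (auto simp: Suc_diff_Suc)
    also have "\<dots> = (\<Prod>i<d. real q ^ Suc i - 1)"
      by (rule prod.nat_diff_reindex)
    finally show ?thesis by simp
  qed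
  then show ?thesis
    unfolding e[OF d] e[OF order_refl] using nz by (simp add: qbinom_def prod_dividef)
qed

section \<open>The total over all types\<close>

lemma real_card_surj_mats:
  assumes "d \<le> k"
  shows "real (card (surj_mats d k :: 'a::{field,finite} mat set)) = (\<Prod>i<d. real CARD('a) ^ k - real CARD('a) ^ i)"
proof -
  have "0 < CARD('a)" by (simp add: card_gt_0_iff)
  then have "CARD('a) ^ i \<le> CARD('a) ^ k" if "i < d" for i
    using assms that by (intro power_increasing) auto
  then show ?thesis unfolding card_surj_mats by (simp add: of_nat_diff)
qed

definition tuples :: "nat \<Rightarrow> nat \<Rightarrow> 'a::{field_gcd,finite} poly list set" where
  "tuples k d = {ps. is_inv_factor_tuple ps \<and> length ps = k \<and> degree (prod_list ps) = d}"

lemma degree_nth_le_prod_list: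
  assumes ps: "is_inv_factor_tuple ps" and p: "p \<in> set ps"
  shows "degree p \<le> degree (prod_list ps)"
proof -
  have "prod_list ps \<noteq> 0" using inv_factor_tuple_nonzero[OF ps] by (auto simp: prod_list_zero_iff)
  then show ?thesis using p by (intro dvd_imp_degree_le) (auto intro: prod_list_dvd)
qed

lemma finite_tuples: "finite (tuples k d :: 'a::{field_gcd,finite} poly list set)"
proof (rule finite_subset)
  let ?m = "monom 1 (Suc d) :: 'a poly"
  have m: "?m \<noteq> 0" "degree ?m = Suc d" by (auto simp: degree_monom_eq)
  let ?P = "{p. p mod ?m = p}"
  show "tuples k d \<subseteq> {ps. set ps \<subseteq> ?P \<and> length ps = k}"
  proof
    fix ps :: "'a poly list" assume ps: "ps \<in> tuples k d"
    have "p mod ?m = p" if "p \<in> set ps" for p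
      using degree_nth_le_prod_list[of ps p] that ps by (intro mod_poly_less) (auto simp: tuples_def m)
    then show "ps \<in> {ps. set ps \<subseteq> ?P \<and> length ps = k}" using ps by (auto simp: tuples_def)
  qed
  show "finite {ps. set ps \<subseteq> ?P \<and> length ps = k}"
    using card_residues(1)[OF m(1)] by (rule finite_lists_length_eq)
qed

lemma real_N_count:
  fixes ps :: "'a::{field_gcd,finite} poly list"
  assumes ps: "ps \<in> tuples k d" and kn: "k \<le> n"
  shows "real (N_count n k ps) = real (card (surj_mats d k :: 'a mat set)) *
    (real CARD('a) ^ (d * (k - d)) * real (simple_count TYPE('a) (n - d) (k - d))) / real (num_aut ps)"
proof -
  have t: "is_inv_factor_tuple ps" "length ps = k" "d = degree (prod_list ps)" using ps by (auto simp: tuples_def)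
  have "real (N_count n k ps) * real (num_aut ps) = real (card (surj_mats d k :: 'a mat set)) *
    (real CARD('a) ^ (d * (k - d)) * real (simple_count TYPE('a) (n - d) (k - d)))"
    using arg_cong[OF N_count_mult_card_aut_mats[OF t kn], of real] t by (simp add: num_aut_def)
  then show ?thesis using num_aut_eq(2)[OF t(1)] by (simp add: field_simps)
qed

lemma sum_N_count:
  assumes kn: "k \<le> n"
  shows "(\<Sum>d\<le>k. \<Sum>ps\<in>tuples k d. N_count n k (ps :: 'a::{field_gcd,finite} poly list)) = CARD('a) ^ (n * k)"
proof -
  let ?C = "carrier_mat n k :: 'a mat set"
  let ?T = "\<Union>d\<le>k. tuples k d :: 'a poly list set"
  let ?g = "\<lambda>B :: 'a mat. inv_factors (charmat B) k"
  have fin: "finite ?C" by (rule finite_carrier_mat)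
  have sub: "?g ` ?C \<subseteq> ?T"
  proof
    fix ps assume "ps \<in> ?g ` ?C"
    then obtain B where B: "B \<in> ?C" "ps = ?g B" by blast
    have t: "is_inv_factor_tuple ps" "length ps = k" using ex_presentation[OF B(1) kn] B(2) by auto
    let ?d = "degree (prod_list ps)"
    have ps: "ps \<in> tuples k ?d" using t by (simp add: tuples_def)
    have "?d \<le> k"
    proof (rule ccontr)
      assume "\<not> ?d \<le> k"
      \<comment> \<open>The factor with \<open>i = k\<close> vanishes: a module of dimension above
        \<open>k\<close> cannot be spanned over \<open>F\<close> by \<open>k\<close> elements, so it
        does not occur.\<close>
      then have "card (surj_mats ?d k :: 'a mat set) = 0" unfolding card_surj_mats by (auto intro!: bexI[of _ k])
      then have "N_count n k ps = 0" using real_N_count[OF ps kn] by simp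
      moreover have "B \<in> {B \<in> ?C. ?g B = ps}" using B by simp
      ultimately show False using fin by (auto simp: N_count_def)
    qed
    then show "ps \<in> ?T" using ps by blast
  qed
  have "(\<Sum>ps\<in>?T. N_count n k ps) = (\<Sum>ps\<in>?T. \<Sum>B\<in>{B\<in>?C. ?g B = ps}. 1)"
    by (simp add: N_count_def)
  also have "\<dots> = (\<Sum>B\<in>?C. 1)"
    using fin finite_tuples sub by (intro sum.group) auto
  also have "\<dots> = CARD('a) ^ (n * k)" by (simp add: card_carrier_mat)
  also have "(\<Sum>ps\<in>?T. N_count n k ps) = (\<Sum>d\<le>k. \<Sum>ps\<in>tuples k d. N_count n k (ps :: 'a poly list))"
  proof -
    have "tuples k i \<inter> (tuples k j :: 'a poly list set) = {}" if "i \<noteq> j" for i j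
      using that by (auto simp: tuples_def)
    then show ?thesis by (intro sum.UNION_disjoint) (auto simp: finite_tuples)
  qed
  finally show ?thesis .
qed

text \<open>The sum of \<open>1 / |Aut M|\<close> over the isomorphism classes of
  \<open>F[x]\<close>-modules \<open>M\<close> of dimension \<open>d\<close> over \<open>F\<close>
  that are generated by \<open>k\<close> elements.\<close>

definition aut_weight :: "'a::{field_gcd,finite} itself \<Rightarrow> nat \<Rightarrow> nat \<Rightarrow> real" where
  "aut_weight _ k d = (\<Sum>ps\<in>(tuples k d :: 'a poly list set). 1 / real (num_aut ps))"

text \<open>If the total degree is \<open>d\<close>, then at most \<open>d\<close> of the factors differ from 1.\<close>

lemma tuples_pad:
  assumes dk: "d \<le> k"
  shows "bij_betw (\<lambda>ps. replicate (k - d) 1 @ ps) (tuples d d) (tuples k d :: 'a::{field_gcd,finite} poly list set)"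
proof (rule bij_betw_imageI)
  show "inj_on (\<lambda>ps. replicate (k - d) 1 @ ps) (tuples d d :: 'a poly list set)" by (auto simp: inj_on_def)
  show "(\<lambda>ps. replicate (k - d) 1 @ ps) ` tuples d d = (tuples k d :: 'a poly list set)"
  proof (intro equalityI subsetI)
    fix qs assume "qs \<in> (\<lambda>ps. replicate (k - d) 1 @ ps) ` (tuples d d :: 'a poly list set)"
    then obtain ps :: "'a poly list" where ps: "ps \<in> tuples d d" "qs = replicate (k - d) 1 @ ps" by blast
    have "qs ! i dvd qs ! Suc i" if "Suc i < length qs" for i
    proof (cases "i < k - d")
      case True
      then show ?thesis by (simp add: ps(2) nth_append)
    next
      case False
      then have "Suc i - (k - d) = Suc (i - (k - d))" by simp
      then show ?thesis using False ps that by (auto simp: nth_append tuples_def is_inv_factor_tuple_def)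
    qed
    then show "qs \<in> tuples k d" using ps dk by (auto simp: tuples_def is_inv_factor_tuple_def)
  next
    fix qs :: "'a poly list" assume qs: "qs \<in> tuples k d"
    then have t: "is_inv_factor_tuple qs" "length qs = k" "degree (prod_list qs) = d" by (auto simp: tuples_def)
    have one: "qs ! i = 1" if i: "i < k - d" for i
    proof (rule ccontr)
      assume ne: "qs ! i \<noteq> 1"
      have lc: "lead_coeff (qs ! i) = 1" using t i by (auto simp: is_inv_factor_tuple_def)
      have pos: "0 < degree (qs ! i)"
      proof (rule ccontr)
        assume "\<not> 0 < degree (qs ! i)"
        then obtain a where "qs ! i = [:a:]" using degree_eq_zeroE by blast
        then show False using ne lc by simp
      qed
      have "1 \<le> degree (qs ! j)" if "j \<in> {i..<k}" for j
      proof -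
        have "qs ! i dvd qs ! j"
          using chain_dvd[of k "(!) qs" i j] t that by (auto simp: is_inv_factor_tuple_def)
        then have "degree (qs ! i) \<le> degree (qs ! j)"
          using inv_factor_tuple_nonzero[OF t(1), of "qs ! j"] t that by (intro dvd_imp_degree_le) auto
        then show ?thesis using pos by simp
      qed
      then have "(\<Sum>j=i..<k. 1) \<le> (\<Sum>j=i..<k. degree (qs ! j))" by (intro sum_mono)
      also have "\<dots> \<le> (\<Sum>j<k. degree (qs ! j))" by (intro sum_mono2) auto
      also have "\<dots> = d"
        using degree_prod_list_sum[of qs] inv_factor_tuple_nonzero[OF t(1)] t by auto
      finally show False using i by simp
    qed
    have tk: "take (k - d) qs = replicate (k - d) 1"
      using one t by (intro nth_equalityI) auto
    have q: "qs = replicate (k - d) 1 @ drop (k - d) qs" unfolding tk[symmetric] by simp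
    have "drop (k - d) qs ! i dvd drop (k - d) qs ! Suc i" if "Suc i < length (drop (k - d) qs)" for i
      using t that by (auto simp: is_inv_factor_tuple_def)
    moreover have "set (drop (k - d) qs) \<subseteq> set qs" by (rule set_drop_subset)
    ultimately have "is_inv_factor_tuple (drop (k - d) qs)"
      using t(1) by (auto simp: is_inv_factor_tuple_def)
    moreover have "prod_list qs = prod_list (drop (k - d) qs)" by (subst q) simp
    ultimately have "drop (k - d) qs \<in> tuples d d" using t dk by (simp add: tuples_def)
    then show "qs \<in> (\<lambda>ps. replicate (k - d) 1 @ ps) ` tuples d d" using q by blast
  qed
qed

text \<open>Frees the weight from \<open>k\<close>: the value found for square matrices of size
  \<open>d\<close> serves for every \<open>k \<ge> d\<close>.\<close>

lemma aut_weight_pad: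
  assumes dk: "d \<le> k"
  shows "aut_weight TYPE('a::{field_gcd,finite}) k d = aut_weight TYPE('a) d d"
  unfolding aut_weight_def
proof (rule sum.reindex_bij_betw[OF tuples_pad[OF dk], symmetric, THEN trans])
  show "(\<Sum>ps\<in>tuples d d. 1 / real (num_aut (replicate (k - d) 1 @ ps :: 'a poly list)))
      = (\<Sum>ps\<in>tuples d d. 1 / real (num_aut (ps :: 'a poly list)))"
  proof (rule sum.cong[OF refl])
    fix ps :: "'a poly list" assume ps: "ps \<in> tuples d d"
    then have "replicate (k - d) 1 @ ps \<in> tuples k d"
      using bij_betw_apply[OF tuples_pad[OF dk]] by blast
    then show "1 / real (num_aut (replicate (k - d) 1 @ ps)) = 1 / real (num_aut ps)"
      using num_aut_replicate_append[of ps "k - d"] ps by (simp add: tuples_def)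
  qed
qed

lemma sum_simple_count_weight:
  assumes kn: "k \<le> n"
  shows "(\<Sum>d\<le>k. real (card (surj_mats d k :: 'a::{field_gcd,finite} mat set)) *
    (real CARD('a) ^ (d * (k - d)) * real (simple_count TYPE('a) (n - d) (k - d))) * aut_weight TYPE('a) d d)
    = real CARD('a) ^ (n * k)"
proof -
  have "real CARD('a) ^ (n * k) = (\<Sum>d\<le>k. \<Sum>ps\<in>tuples k d. real (N_count n k (ps :: 'a poly list)))"
    using arg_cong[OF sum_N_count[OF kn, where 'a='a], of real] by simp
  also have "\<dots> = (\<Sum>d\<le>k. real (card (surj_mats d k :: 'a mat set)) *
    (real CARD('a) ^ (d * (k - d)) * real (simple_count TYPE('a) (n - d) (k - d))) * aut_weight TYPE('a) d d)"
  proof (rule sum.cong[OF refl])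
    fix d assume d: "d \<in> {..k}"
    have "(\<Sum>ps\<in>tuples k d. real (N_count n k (ps :: 'a poly list))) = real (card (surj_mats d k :: 'a mat set)) *
      (real CARD('a) ^ (d * (k - d)) * real (simple_count TYPE('a) (n - d) (k - d))) * aut_weight TYPE('a) k d"
      unfolding aut_weight_def sum_distrib_left using real_N_count[OF _ kn] by (intro sum.cong) auto
    then show "(\<Sum>ps\<in>tuples k d. real (N_count n k (ps :: 'a poly list))) = real (card (surj_mats d k :: 'a mat set)) *
      (real CARD('a) ^ (d * (k - d)) * real (simple_count TYPE('a) (n - d) (k - d))) * aut_weight TYPE('a) d d"
      using aut_weight_pad[of d k, where 'a='a] d by simp
  qed
  finally show ?thesis ..
qed

section \<open>Solving for the number of simple matrices\<close>

lemma simple_count_n_0: "simple_count TYPE('a::{field_gcd,finite}) n 0 = 1"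
proof -
  have "{D :: 'a mat. D \<in> carrier_mat n 0 \<and> char_image D = carrier_vec 0} = {0\<^sub>m n 0}"
  proof (intro equalityI subsetI)
    fix D :: "'a mat" assume "D \<in> {D. D \<in> carrier_mat n 0 \<and> char_image D = carrier_vec 0}"
    then show "D \<in> {0\<^sub>m n 0}" by (auto intro: eq_matI)
  next
    fix D :: "'a mat" assume "D \<in> {0\<^sub>m n 0}"
    then have D: "D \<in> carrier_mat n 0" by simp
    have "char_image D = carrier_vec 0"
    proof (intro equalityI subsetI)
      fix v :: "'a poly vec" assume "v \<in> carrier_vec 0"
      then have "v = 0\<^sub>v 0" by (intro eq_vecI) auto
      then show "v \<in> char_image D" using char_image_zero[OF D] by simp
    qed (use char_image_subset[OF D] in blast)
    then show "D \<in> {D. D \<in> carrier_mat n 0 \<and> char_image D = carrier_vec 0}" using D by simp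
  qed
  then show ?thesis by (simp add: simple_count_def)
qed

lemma simple_count_square: "0 < m \<Longrightarrow> simple_count TYPE('a::{field_gcd,finite}) m m = 0"
proof -
  assume m: "0 < m"
  then have "{D :: 'a mat. D \<in> carrier_mat m m \<and> char_image D = carrier_vec m} = {}"
    using char_image_square_proper by blast
  then show ?thesis unfolding simple_count_def by (simp only: card.empty)
qed

text \<open>For square matrices only \<open>D\<close> of size 0 is simple, so the sum in
  \<open>sum_simple_count_weight\<close> collapses to its last term.\<close>

lemma surj_mult_aut_weight:
  "real (card (surj_mats d d :: 'a::{field_gcd,finite} mat set)) * aut_weight TYPE('a) d d = real CARD('a) ^ (d * d)"
proof -
  let ?t = "\<lambda>d'. real (card (surj_mats d' d :: 'a mat set)) *
    (real CARD('a) ^ (d' * (d - d')) * real (simple_count TYPE('a) (d - d') (d - d'))) * aut_weight TYPE('a) d' d'"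
  have "real CARD('a) ^ (d * d) = (\<Sum>d'\<le>d. ?t d')"
    using sum_simple_count_weight[OF order_refl, of d, where 'a='a] by simp
  also have "\<dots> = (\<Sum>d'\<in>{d}. ?t d')"
    by (rule sum.mono_neutral_right) (auto simp: simple_count_square)
  finally show ?thesis by (simp add: simple_count_n_0)
qed

text \<open>The weight is \<open>q^(d^2) / |GL_d|\<close> by \<open>surj_mult_aut_weight\<close>,
  and the number of surjections divided by \<open>|GL_d|\<close> is the q-binomial coefficient. With
  the automorphism groups gone, the sum has the shape of \<open>sum_qbinom_prod\<close> at
  \<open>x = q^n\<close>.\<close>

lemma sum_qbinom_simple_count:
  assumes kn: "k \<le> n"
  shows "(\<Sum>d\<le>k. qbinom CARD('a::{field_gcd,finite}) k d * real CARD('a) ^ (d * d) *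
    (real CARD('a) ^ (d * (k - d)) * real (simple_count TYPE('a) (n - d) (k - d)))) = real CARD('a) ^ (n * k)"
proof -
  have q: "1 < CARD('a)" by (rule card_UNIV_gt_1)
  have "qbinom CARD('a) k d * real CARD('a) ^ (d * d) = real (card (surj_mats d k :: 'a mat set)) * aut_weight TYPE('a) d d"
    if "d \<le> k" for d
  proof -
    have "real (card (surj_mats d k :: 'a mat set)) = qbinom CARD('a) k d * real (card (surj_mats d d :: 'a mat set))"
      using qbinom_mult_surj[OF q that]
      unfolding real_card_surj_mats[OF that] real_card_surj_mats[OF order_refl] by simp
    then show ?thesis
      unfolding surj_mult_aut_weight[symmetric] by (simp add: mult.assoc)
  qed
  then show ?thesis
    using sum_simple_count_weight[OF kn, where 'a='a] by (simp add: mult_ac)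
qed

text \<open>The power in front, the number of choices of the block \<open>C\<close>, supplies a
  factor \<open>q^d\<close> for each of the \<open>k - d\<close> factors of the product.\<close>

lemma prod_shift_power:
  assumes "d \<le> k" "k \<le> n"
  shows "real q ^ (d * (k - d)) * (\<Prod>i=1..k - d. real q ^ (n - d) - real q ^ i) = (\<Prod>i=d+1..k. real q ^ n - real q ^ i)"
proof -
  have "(\<Prod>i=d+1..k. real q ^ n - real q ^ i) = (\<Prod>i=1..k - d. real q ^ n - real q ^ (i + d))"
    using prod.shift_bounds_cl_nat_ivl[of "\<lambda>i. real q ^ n - real q ^ i" 1 d "k - d"] assms by (simp add: add.commute)
  also have "\<dots> = (\<Prod>i=1..k - d. real q ^ d * (real q ^ (n - d) - real q ^ i))"
  proof (rule prod.cong[OF refl])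
    fix i
    have "real q ^ n = real q ^ d * real q ^ (n - d)" using assms by (simp flip: power_add)
    then show "real q ^ n - real q ^ (i + d) = real q ^ d * (real q ^ (n - d) - real q ^ i)"
      by (simp add: right_diff_distrib power_add)
  qed
  also have "\<dots> = real q ^ (d * (k - d)) * (\<Prod>i=1..k - d. real q ^ (n - d) - real q ^ i)"
    by (simp add: prod.distrib power_mult)
  finally show ?thesis ..
qed

text \<open>The sums in \<open>sum_qbinom_simple_count\<close> and in \<open>sum_qbinom_prod\<close>
  at \<open>x = q^n\<close> are both \<open>q^(n k)\<close>. Their terms for
  \<open>d \<ge> 1\<close> involve simple matrices with only \<open>k - d\<close> columns and agree
  by induction; hence the terms for \<open>d = 0\<close> agree, and these are the two sides of the
  claim.\<close>

lemma simple_count_eq: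
  "k \<le> n \<Longrightarrow> real (simple_count TYPE('a::{field_gcd,finite}) n k) = (\<Prod>i=1..k. real CARD('a) ^ n - real CARD('a) ^ i)"
proof (induction k arbitrary: n rule: less_induct)
  case (less k)
  let ?q = "CARD('a)"
  let ?s = "\<lambda>d. qbinom ?q k d * real ?q ^ (d * d) * (real ?q ^ (d * (k - d)) * real (simple_count TYPE('a) (n - d) (k - d)))"
  let ?t = "\<lambda>d. qbinom ?q k d * real ?q ^ (d * d) * (\<Prod>i=d+1..k. (real ?q ^ n - real ?q ^ i))"
  have eq: "?s d = ?t d" if d: "d \<in> {1..k}" for d
  proof -
    have "real (simple_count TYPE('a) (n - d) (k - d)) = (\<Prod>i=1..k - d. real ?q ^ (n - d) - real ?q ^ i)"
      using d less.prems by (intro less.IH) auto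
    then show ?thesis using prod_shift_power[of d k n ?q] d less.prems by simp
  qed
  have split: "(\<Sum>d\<le>k. f d) = f 0 + (\<Sum>d=1..k. f d)" for f :: "nat \<Rightarrow> real"
    by (simp add: atMost_atLeast0 sum.atLeast_Suc_atMost)
  have "(\<Sum>d\<le>k. ?s d) = (\<Sum>d\<le>k. ?t d)"
    using sum_qbinom_simple_count[OF less.prems, where 'a='a]
      sum_qbinom_prod[OF card_UNIV_gt_1[where 'a='a], of k "real ?q ^ n"] by (simp add: power_mult)
  then have "?s 0 = ?t 0"
    unfolding split using eq by simp
  then show ?case by (simp add: qbinom_0)
qed

theorem theorem3:
  fixes ps :: "'a::{field_gcd,finite} poly list" and n k d :: nat
  assumes "is_inv_factor_tuple ps" and "length ps = k"
    and "degree (prod_list ps) = d" and "d \<le> k" and "k \<le> n"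
  shows "real (N_count n k ps)
    = qbinom (card (UNIV :: 'a set)) k d * real (GL_card TYPE('a) d)
      / (\<Prod>f\<in>S_set ps. c_fun (card (UNIV :: 'a set)) (degree f) (Phi ps f))
      * (\<Prod>i=d+1..k. (real (card (UNIV :: 'a set)) ^ n - real (card (UNIV :: 'a set)) ^ i))"
proof -
  let ?q = "CARD('a)"
  have q: "1 < ?q" by (rule card_UNIV_gt_1)
  have ps: "ps \<in> tuples k d" using assms by (simp add: tuples_def)
  have "real (GL_card TYPE('a) d) = (\<Prod>i<d. real ?q ^ d - real ?q ^ i)"
    using real_card_surj_mats[OF order_refl, of d, where 'a='a] unfolding card_surj_mats GL_card_eq .
  \<comment> \<open>The q-binomial coefficient and the order of the general linear group combine to
    the number of surjections.\<close>
  then have "qbinom ?q k d * real (GL_card TYPE('a) d) = real (card (surj_mats d k :: 'a mat set))"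
    using qbinom_mult_surj[OF q assms(4)] real_card_surj_mats[OF assms(4), where 'a='a] by simp
  moreover have "real ?q ^ (d * (k - d)) * real (simple_count TYPE('a) (n - d) (k - d))
      = (\<Prod>i=d+1..k. real ?q ^ n - real ?q ^ i)"
    using simple_count_eq[of "k - d" "n - d", where 'a='a] prod_shift_power[OF assms(4,5), of ?q] assms by simp
  ultimately show ?thesis
    using real_N_count[OF ps assms(5)] num_aut_eq(1)[OF assms(1)] by simp
qed

end
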